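(* Consider the ODE–PDE system (for $t>0$, $\xi\in(0,1)$) $$\dot X(t)=A_1X(t)+G_1(\mathscr{K}_1z(\cdot,t))+G_1\Theta\Sigma(v(X(t),U(t)))(\mathscr{K}_2z(\cdot,t))+G_1h_1(v(X(t),U(t))),$$ $$\partial_tz(\xi,t)+\Lambda\partial_\xi z(\xi,t)=\Theta\Sigma(v(X(t),U(t)))z(\xi,t)+h_2(v(X(t),U(t))),\qquad z(0,t)=0,$$ where $\Sigma\in C^1(\mathbb{R}^{n_z};\mathbb{R}^{n_z\times n_z})$, $h_1,h_2\in C^1(\mathbb{R}^{n_z};\mathbb{R}^{n_z})$, $h_2$ is invertible, and $U\in C^1(\mathbb{R}_{\geq0};\mathbb{R}^{n_U})$. Suppose Assumption (A1) (forward completeness and boundedness) and Assumption (A2) (detectability) hold. Let $(X,z)\in C^1(\mathbb{R}_{\geq0};\mathcal{X})\cap C^0(\mathbb{R}_{\geq0};\mathscr{D}(\mathscr{A}))$ be a classical solution of this system, let $\hat\theta$ be generated by the adaptive law, $(\hat X,\hat z)$ by the observer, both described in the context, and let the observer error $(\tilde X,\tilde z)\triangleq(X-\hat X,z-\hat z)$ be a classical solution, $(\tilde X,\tilde z)\in C^1(\mathbb{R}_{\geq0};\mathcal{X})\cap C^0(\mathbb{R}_{\geq0};\mathscr{D}(\mathscr{A}))$. Then $(\tilde X,\tilde z)\in L^\infty(\mathbb{R}_{\geq0};\mathcal{Y})$. Moreover, if the filtered regressor $\varphi\in L^\infty(\mathbb{R}_{\geq0};\mathbb{R}^{n_z})$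 is persistently exciting, then $\|(\tilde X(t),\tilde z(\cdot,t))\|_{\mathcal{Y}}\to0$ exponentially fast as $t\to\infty$.
   Context: $n_X,n_z,n_U$ are positive integers. $\mathcal{X}\triangleq\mathbb{R}^{n_X}\times L^2((0,1);\mathbb{R}^{n_z})$ with norm $\|(Z,\zeta)\|_{\mathcal{X}}^2=\|Z\|_2^2+\|\zeta\|_{L^2}^2$; $\mathcal{Y}\triangleq\mathbb{R}^{n_X}\times H^1((0,1);\mathbb{R}^{n_z})$ with norm $\|(Z,\zeta)\|_{\mathcal{Y}}^2=\|Z\|_2^2+\|\zeta\|_{H^1}^2$; $\mathscr{D}(\mathscr{A})\triangleq\{(Z,\zeta)\in\mathcal{Y}:\zeta(0)=0\}$. Constant matrices: $A_1\in\mathbb{R}^{n_X\times n_X}$, $A_2\in\mathbb{R}^{n_z\times n_X}$, $G_1\in\mathbb{R}^{n_X\times n_z}$, $G_2\in\mathbb{R}^{n_z\times n_U}$; $v(X,U)\triangleq A_2X+G_2U$. $\Lambda=\mathrm{diag}\{\lambda_i\}$ with $\lambda_i>0$; $\Theta=\mathrm{diag}\{\theta_1,\dots,\theta_{n_z}\}$ with $\theta_i>0$ unknown. $\mathscr{K}_1\zeta\triangleq\int_0^1K_1(\xi)\zeta(\xi)d\xi+K_2\zeta(1)$, $\mathscr{K}_2\zeta\triangleq\int_0^1K_3(\xi)\zeta(\xi)d\xi$, with $K_1,K_3\in C^0([0,1];\mathbb{R}^{n_z\times n_z})$, $K_2\in\mathbb{R}^{n_z\times n_z}$. Assumption (A1):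 the system is forward complete (solutions exist for all $t\geq0$), $(X,z)\in L^\infty(\mathbb{R}_{\geq0};\mathcal{X})$ for mild solutions, $(X,z)\in L^\infty(\mathbb{R}_{\geq0};\mathcal{Y})$ for classical solutions, and $U\in L^\infty(\mathbb{R}_{\geq0};\mathbb{R}^{n_U})$. Assumption (A2): the pair $(A_1,A_2)$ is detectable. Measurements: $Y_1(t)=h_2(v(X(t),U(t)))$ and $Y_2(t)=\Theta\Lambda\Sigma(h_2^{-1}(Y_1(t)))\Lambda^{-1}Y_1(t)+\dot Y_1(t)$. Adaptive law: with $1_{n_z}=(1,\dots,1)^T$, set $Z_1=1_{n_z}^TY_1$, $Z_2=1_{n_z}^TY_2$, $\phi(t)=-\Lambda\Sigma(h_2^{-1}(Y_1(t)))\Lambda^{-1}Y_1(t)$; filters $\dot\zeta_1=-\varrho(\zeta_1-Z_1)$, $\dot\zeta_2=-\varrho\zeta_2+Z_2$, $\dot\varphi=-\varrho\varphi+\phi$ with $\varrho>0$, and $\zeta\triangleq\zeta_1+\zeta_2$; then $\dot{\hat\theta}=-\Gamma(R\hat\theta+Q)$, $\dot R=-\psi R+\varphi\varphi^T/(1+\|\varphi\|_2^2)$, $\dot Q=-\psi Q-(Z_1-\zeta)\varphi/(1+\|\varphi\|_2^2)$, with $\Gamma$ symmetric positive definite and $\psi>0$. Set $\hat\Theta(t)=\mathrm{diag}\{\hat\theta_1(t),\dots,\hat\theta_{n_z}(t)\}$. Observer: $L_1\in\mathbb{R}^{n_X\times n_z}$ is a constant matrix chosen so that $A_1+L_1A_2$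 is Hurwitz, $\hat Y_1(t)=h_2(A_2\hat X(t)+G_2U(t))$, and $\dot{\hat X}=A_1\hat X+G_1(\mathscr{K}_1\hat z)+G_1\hat\Theta\Sigma(h_2^{-1}(Y_1))(\mathscr{K}_2\hat z)+G_1h_1(h_2^{-1}(Y_1))-L_1(h_2^{-1}(Y_1)-h_2^{-1}(\hat Y_1))$, $\partial_t\hat z+\Lambda\partial_\xi\hat z=\hat\Theta\Sigma(h_2^{-1}(Y_1))\hat z+Y_1$, $\hat z(0,t)=0$. Persistent excitation: $\varphi$ is PE if there exist $T_0,\alpha_0>0$ with $\int_t^{t+T_0}\varphi(s)\varphi(s)^Tds\succeq\alpha_0 I_{n_z}$ for all $t\geq0$. *)

theory Defs
  imports "HOL-Analysis.Analysis"
begin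

definition diagm :: "real^'n \<Rightarrow> real^'n^'n" where
  "diagm d = (\<chi> i j. if i = j then d $ i else 0)"

definition outer :: "real^'n \<Rightarrow> real^'n \<Rightarrow> real^'n^'n" where
  "outer u w = (\<chi> i j. u $ i * w $ j)"

definition hurwitz :: "real^'n^'n \<Rightarrow> bool" where
  "hurwitz M \<longleftrightarrow> (\<forall>(lam::complex) (v::complex^'n).
      v \<noteq> 0 \<and> (\<forall>i. (\<Sum>j\<in>UNIV. complex_of_real (M $ i $ j) * v $ j) = lam * v $ i)
      \<longrightarrow> Re lam < 0)"

definition detectable :: "real^'n^'n \<Rightarrow> real^'n^'m \<Rightarrow> bool" where
  "detectable A C \<longleftrightarrow> (\<exists>L :: real^'m^'n. hurwitz (A + L ** C))"

definition loewner_ge :: "real^'n^'n \<Rightarrow> real^'n^'n \<Rightarrow> bool" where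
  "loewner_ge A B \<longleftrightarrow> (\<forall>x. 0 \<le> x \<bullet> ((A - B) *v x))"

definition sym_pos_def :: "real^'n^'n \<Rightarrow> bool" where
  "sym_pos_def G \<longleftrightarrow> transpose G = G \<and> (\<forall>x. x \<noteq> 0 \<longrightarrow> 0 < x \<bullet> (G *v x))"

definition C1_map :: "('a::real_normed_vector \<Rightarrow> 'b::real_normed_vector) \<Rightarrow> bool" where
  "C1_map f \<longleftrightarrow> (\<exists>D :: 'a \<Rightarrow> 'a \<Rightarrow>\<^sub>L 'b.
      (\<forall>x. (f has_derivative blinfun_apply (D x)) (at x)) \<and> continuous_on UNIV D)"

definition C1_halfline :: "(real \<Rightarrow> 'a::real_normed_vector) \<Rightarrow> bool" where
  "C1_halfline f \<longleftrightarrow> (\<exists>f'. (\<forall>t\<ge>0. (f has_vector_derivative f' t) (at t within {0..}))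
      \<and> continuous_on {0..} f')"

definition L2_01 :: "(real \<Rightarrow> 'a::euclidean_space) \<Rightarrow> bool" where
  "L2_01 f \<longleftrightarrow> set_borel_measurable lborel {0<..<1} f
      \<and> set_integrable lborel {0<..<1} (\<lambda>\<xi>. (norm (f \<xi>))\<^sup>2)"

definition L2norm :: "(real \<Rightarrow> 'a::euclidean_space) \<Rightarrow> real" where
  "L2norm f = sqrt (LINT \<xi>:{0<..<1}|lborel. (norm (f \<xi>))\<^sup>2)"

text \<open>g is the (weak) derivative of f on (0,1); f is identified with its absolutely
  continuous representative on [0,1].\<close>
definition weak_deriv01 :: "(real \<Rightarrow> 'a::euclidean_space) \<Rightarrow> (real \<Rightarrow> 'a) \<Rightarrow> bool" where
  "weak_deriv01 f g \<longleftrightarrow> L2_01 g \<and>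
      (\<forall>\<xi>\<in>{0..1}. f \<xi> = f 0 + (LINT s:{0..\<xi>}|lborel. g s))"

definition H1_01 :: "(real \<Rightarrow> 'a::euclidean_space) \<Rightarrow> bool" where
  "H1_01 f \<longleftrightarrow> L2_01 f \<and> (\<exists>g. weak_deriv01 f g)"

definition H1norm :: "(real \<Rightarrow> 'a::euclidean_space) \<Rightarrow> real" where
  "H1norm f = sqrt ((L2norm f)\<^sup>2 + (L2norm (SOME g. weak_deriv01 f g))\<^sup>2)"

definition Ynorm :: "'x::real_normed_vector \<Rightarrow> (real \<Rightarrow> 'a::euclidean_space) \<Rightarrow> real" where
  "Ynorm Z \<zeta> = sqrt ((norm Z)\<^sup>2 + (H1norm \<zeta>)\<^sup>2)"

definition L2_has_deriv :: "(real \<Rightarrow> real \<Rightarrow> 'a::euclidean_space) \<Rightarrow> (real \<Rightarrow> 'a) \<Rightarrow> real \<Rightarrow> bool" where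
  "L2_has_deriv z w t \<longleftrightarrow> L2_01 w \<and>
     ((\<lambda>s. L2norm (\<lambda>\<xi>. inverse (s - t) *\<^sub>R (z s \<xi> - z t \<xi>) - w \<xi>)) \<longlongrightarrow> 0) (at t within {0..})"

text \<open>(X,z) \<in> C^1([0,\<infinity>); X-space) \<inter> C^0([0,\<infinity>); D(A)).\<close>
definition classical_reg :: "(real \<Rightarrow> 'x::real_normed_vector) \<Rightarrow> (real \<Rightarrow> real \<Rightarrow> 'a::euclidean_space) \<Rightarrow> bool" where
  "classical_reg X z \<longleftrightarrow>
     C1_halfline X
   \<and> (\<exists>zt. (\<forall>t\<ge>0. L2_has_deriv z (zt t) t)
          \<and> (\<forall>t\<ge>0. ((\<lambda>s. L2norm (\<lambda>\<xi>. zt s \<xi> - zt t \<xi>)) \<longlongrightarrow> 0) (at t within {0..})))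
   \<and> (\<forall>t\<ge>0. H1_01 (z t) \<and> z t 0 = 0)
   \<and> (\<forall>t\<ge>0. ((\<lambda>s. H1norm (\<lambda>\<xi>. z s \<xi> - z t \<xi>)) \<longlongrightarrow> 0) (at t within {0..}))"

definition transport_eq ::
  "(real \<Rightarrow> real \<Rightarrow> real^'n) \<Rightarrow> real^'n \<Rightarrow> (real \<Rightarrow> real^'n \<Rightarrow> real^'n) \<Rightarrow> real \<Rightarrow> bool" where
  "transport_eq z lam F t \<longleftrightarrow> (\<exists>w g. L2_has_deriv z w t \<and> weak_deriv01 (z t) g \<and>
      (AE \<xi> in lborel. \<xi> \<in> {0<..<1} \<longrightarrow> w \<xi> + diagm lam *v g \<xi> = F \<xi> (z t \<xi>)))"

definition Kop1 :: "(real \<Rightarrow> real^'n^'n) \<Rightarrow> real^'n^'n \<Rightarrow> (real \<Rightarrow> real^'n) \<Rightarrow> real^'n" where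
  "Kop1 K1 K2 \<zeta> = (LINT \<xi>:{0..1}|lborel. K1 \<xi> *v \<zeta> \<xi>) + K2 *v \<zeta> 1"

definition Kop2 :: "(real \<Rightarrow> real^'n^'n) \<Rightarrow> (real \<Rightarrow> real^'n) \<Rightarrow> real^'n" where
  "Kop2 K3 \<zeta> = (LINT \<xi>:{0..1}|lborel. K3 \<xi> *v \<zeta> \<xi>)"

definition persistently_exciting :: "(real \<Rightarrow> real^'n) \<Rightarrow> bool" where
  "persistently_exciting \<phi> \<longleftrightarrow> (\<exists>T0 \<alpha>0. T0 > 0 \<and> \<alpha>0 > 0 \<and>
     (\<forall>t\<ge>0. loewner_ge (integral {t..t+T0} (\<lambda>s. outer (\<phi> s) (\<phi> s))) (\<alpha>0 *\<^sub>R mat 1)))"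

end

theory Submission
  imports Defs "HOL-Computational_Algebra.Fundamental_Theorem_Algebra"
begin

text \<open>
  The input nonlinearity \<open>h2 v\<close> cancels in the error equations. The error of the PDE state solves
  a transport equation with zero inflow, bounded zero-order coefficients \<open>diagm thh ** Sig v\<close> and the
  source \<open>(diagm (theta - thh) ** Sig v) *v z\<close>, all of them constant in space. The energy with weight
  \<open>exp (- k * \<xi>)\<close>, \<open>k\<close> large, dissipates at any prescribed rate. Applied to the space differences
  of the error, it bounds the weak space derivative in terms of the parameter error and of the
  \<open>H\<^sup>1\<close> bound on \<open>z\<close>, without any information on the derivative of the input \<open>U\<close>. The ODE error is
  then driven by an exponentially stable linear system.

  For the adaptive law, \<open>R *v theta + Q\<close> decays exponentially because of the filters, so that the
  parameter error \<open>w\<close> satisfies \<open>w' = - Gam *v (R *v w)\<close> up to a decaying term. The Lyapunov function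
  \<open>w \<bullet> (Gam\<^sup>-\<^sup>1 *v w)\<close> is bounded since \<open>R\<close> is positive semidefinite up to a decaying term, and it decays
  if \<open>R\<close> is eventually uniformly positive definite, which is what persistent excitation gives. Boundedness and
  exponential decay are treated at once, as the cases \<open>s = False\<close> and \<open>s = True\<close> of
  \<open>exp_bounded s\<close>.
\<close>

section \<open>Exponential bounds for differential inequalities\<close>

text \<open>Differentiating the error equation in time would bring in the derivative of
  \<open>Sig (v t)\<close>, hence that of \<open>U\<close>, on which no bound is assumed.
  Differentiating it in space is not directly possible either, since the weak derivative of the
  error is only square integrable. Space differences avoid both: they solve an equation of the same
  form whose initial value and source are of size \<open>h\<close>, and the bound survives division
  by \<open>h\<close> and the limit. As the error vanishes at the inflow end, this one L2 bound also
  controls its supremum, in particular the value at 1 that enters \<open>Kop1\<close>. Since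
  \<open>R 0\<close> and the initial filter states are arbitrary, semidefiniteness of
  \<open>R\<close> and the linear regression hold only up to exponentially decaying defects. A
  defect in the rate is integrable in time and costs a constant factor in a Gronwall estimate.
  Competing exponential rates are always kept apart, so that no factor \<open>t\<close> from
  resonance arises.\<close>

lemma exp_primitive_bound:
  fixes c t :: real
  assumes "c \<ge> 0" "t \<ge> 0" "a \<noteq> \<nu>"
  shows "c / (a - \<nu>) * (exp ((a - \<nu>) * t) - 1) * exp (- a * t) \<le> c / \<bar>a - \<nu>\<bar> * exp (- min a \<nu> * t)"
proof -
  \<comment> \<open>The left-hand side is the convolution of \<open>c * exp (- \<nu> * s)\<close>
    with \<open>exp (- a * s)\<close> over \<open>{0..t}\<close>. Whatever the sign of
    \<open>a - \<nu>\<close>, only the slower of the two exponentials has to be kept.\<close>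
  have e: "(exp ((a - \<nu>) * t) - 1) * exp (- a * t) = exp (- \<nu> * t) - exp (- a * t)"
    by (simp add: left_diff_distrib exp_add[symmetric])
  have "c / (a - \<nu>) * (exp ((a - \<nu>) * t) - 1) * exp (- a * t) = c / (a - \<nu>) * (exp (- \<nu> * t) - exp (- a * t))"
    using e by (metis mult.assoc)
  also have "\<dots> \<le> c / \<bar>a - \<nu>\<bar> * exp (- min a \<nu> * t)"
  proof (cases "a > \<nu>")
    case True
    have "c / (a - \<nu>) * (exp (- \<nu> * t) - exp (- a * t)) \<le> c / (a - \<nu>) * exp (- \<nu> * t)"
      using True assms by (intro mult_left_mono) auto
    then show ?thesis using True by (simp add: min_def)
  next
    case False
    then have "c / (a - \<nu>) * (exp (- \<nu> * t) - exp (- a * t)) = c / (\<nu> - a) * (exp (- a * t) - exp (- \<nu> * t))"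
      using assms by (simp add: field_simps)
    also have "\<dots> \<le> c / (\<nu> - a) * exp (- a * t)"
      using False assms by (intro mult_left_mono) auto
    finally show ?thesis using False assms by (simp add: min_def)
  qed
  finally show ?thesis .
qed

text \<open>The integrating factor \<open>exp (r * s)\<close> removes the linear term, and the mean
  value inequality for vector-valued functions compares what is left with an explicit scalar
  primitive.\<close>

lemma linear_ode_bound:
  fixes w f :: "real \<Rightarrow> 'a::real_normed_vector"
  assumes cont: "continuous_on {0..} w"
    and der: "\<And>t. t > 0 \<Longrightarrow> (w has_vector_derivative (- r *\<^sub>R w t + f t)) (at t)"
    and bd: "\<And>t. t > 0 \<Longrightarrow> norm (f t) \<le> D * exp (- \<nu> * t)"
    and D: "D \<ge> 0" and ne: "r \<noteq> \<nu>" and t: "t \<ge> 0"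
  shows "norm (w t) \<le> (norm (w 0) + D / \<bar>r - \<nu>\<bar>) * exp (- min r \<nu> * t)"
proof (cases "t = 0")
  case True then show ?thesis using D by simp
next
  case False
  with t have t0: "t > 0" by simp
  define u where "u = (\<lambda>s. exp (r * s) *\<^sub>R w s)"
  have cu: "continuous_on {0..t} u" unfolding u_def
    by (intro continuous_intros continuous_on_subset[OF cont]) auto
  have du: "(u has_vector_derivative (exp (r * s) *\<^sub>R f s)) (at s)" if "0 < s" for s
  proof -
    have "((\<lambda>s. exp (r * s)) has_real_derivative (exp (r * s) * r)) (at s)"
      by (auto intro!: derivative_eq_intros)
    from has_vector_derivative_scaleR[OF this der[OF that]]
    have "(u has_vector_derivative (exp (r * s) *\<^sub>R (- r *\<^sub>R w s + f s) + (exp (r * s) * r) *\<^sub>R w s)) (at s)"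
      unfolding u_def .
    then show ?thesis by (simp add: algebra_simps)
  qed
  \<comment> \<open>A primitive of \<open>D * exp ((r - \<nu>) * s)\<close>, which bounds the speed
    of \<open>u\<close>; it has this form because \<open>r \<noteq> \<nu>\<close>.\<close>
  define \<phi> where "\<phi> = (\<lambda>s. D / (r - \<nu>) * exp ((r - \<nu>) * s))"
  have "norm (u t - u 0) \<le> \<phi> t - \<phi> 0"
  proof (rule differentiable_bound_general[OF t0 cu _ du])
    show "continuous_on {0..t} \<phi>" unfolding \<phi>_def by (intro continuous_intros)
    show "(\<phi> has_vector_derivative D * exp ((r - \<nu>) * s)) (at s)" for s
      unfolding \<phi>_def has_real_derivative_iff_has_vector_derivative[symmetric]
      using ne by (auto intro!: derivative_eq_intros)
    fix s :: real assume s: "0 < s"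
    have "norm (exp (r * s) *\<^sub>R f s) \<le> exp (r * s) * (D * exp (- \<nu> * s))"
      using bd[OF s] by simp
    also have "\<dots> = D * exp ((r - \<nu>) * s)"
      by (simp add: exp_add[symmetric] left_diff_distrib exp_diff exp_minus field_simps)
    finally show "norm (exp (r * s) *\<^sub>R f s) \<le> D * exp ((r - \<nu>) * s)" .
  qed
  then have "norm (u t) \<le> norm (w 0) + D / (r - \<nu>) * (exp ((r - \<nu>) * t) - 1)"
    using norm_triangle_ineq2[of "u t" "u 0"] by (simp add: \<phi>_def u_def algebra_simps)
  then have "norm (u t) * exp (- r * t) \<le> (norm (w 0) + D / (r - \<nu>) * (exp ((r - \<nu>) * t) - 1)) * exp (- r * t)"
    by (intro mult_right_mono) auto
  moreover have "norm (u t) * exp (- r * t) = norm (w t)"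
    by (simp add: u_def exp_minus)
  moreover have "norm (w 0) * exp (- r * t) \<le> norm (w 0) * exp (- min r \<nu> * t)"
    using t by (intro mult_left_mono) (auto intro: mult_right_mono)
  moreover note exp_primitive_bound[OF D t ne]
  ultimately show ?thesis by (simp add: distrib_right)
qed

text \<open>The perturbation \<open>b * exp (- \<mu> * t)\<close> of the rate has total integral
  \<open>b / \<mu>\<close>, so it costs the factor \<open>exp (b / \<mu>)\<close> and leaves the
  decay rate untouched. The decaying defects in the estimate of the parameter error are absorbed in
  this way.\<close>

lemma gronwall_exp:
  fixes V V' :: "real \<Rightarrow> real"
  assumes cont: "continuous_on {0..} V"
    and der: "\<And>t. t > 0 \<Longrightarrow> (V has_real_derivative V' t) (at t)"
    and bd: "\<And>t. t > 0 \<Longrightarrow> V' t \<le> (b * exp (- \<mu> * t) - a) * V t + c * exp (- \<nu> * t)"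
    and pos: "V 0 \<ge> 0" and \<mu>: "\<mu> > 0" and b: "b \<ge> 0" and c: "c \<ge> 0" and ne: "a \<noteq> \<nu>" and t: "t \<ge> 0"
  shows "V t \<le> exp (b / \<mu>) * ((V 0 + c / \<bar>a - \<nu>\<bar>) * exp (- min a \<nu> * t))"
proof -
  \<comment> \<open>The primitive of \<open>- b * exp (- \<mu> * s)\<close> that vanishes at 0. It
    lies between \<open>- b / \<mu>\<close> and 0; the upper bound simplifies the source term and
    the lower one yields the final constant.\<close>
  define q where "q = (\<lambda>s. b / \<mu> * (exp (- \<mu> * s) - 1))"
  \<comment> \<open>\<open>W\<close> is the accumulated source minus \<open>V\<close> times its
    integrating factor; the differential inequality says that \<open>W\<close> does not
    decrease.\<close>
  define W where "W = (\<lambda>s. c / (a - \<nu>) * exp ((a - \<nu>) * s) - V s * exp (q s + a * s))"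
  have q0: "q s \<le> 0" if "s \<ge> 0" for s
    unfolding q_def using that \<mu> b by (intro mult_nonneg_nonpos) auto
  have "W 0 \<le> W t"
  proof (rule DERIV_nonneg_imp_increasing_open[OF t])
    show "continuous_on {0..t} W" unfolding W_def q_def
      by (intro continuous_intros continuous_on_subset[OF cont]) auto
    fix s assume s: "0 < s" "s < t"
    have dq: "(q has_real_derivative (- b * exp (- \<mu> * s))) (at s)"
      unfolding q_def using \<mu> by (auto intro!: derivative_eq_intros simp: field_simps)
    have dp: "((\<lambda>s. c / (a - \<nu>) * exp ((a - \<nu>) * s)) has_real_derivative (c * exp ((a - \<nu>) * s))) (at s)"
      using ne by (auto intro!: derivative_eq_intros)
    have dE: "((\<lambda>s. V s * exp (q s + a * s)) has_real_derivative ((V' s + (a - b * exp (- \<mu> * s)) * V s) * exp (q s + a * s))) (at s)"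
      by (auto intro!: derivative_eq_intros der[OF s(1)] dq simp: algebra_simps)
    have dW: "(W has_real_derivative (c * exp ((a - \<nu>) * s) - (V' s + (a - b * exp (- \<mu> * s)) * V s) * exp (q s + a * s))) (at s)"
      unfolding W_def by (rule DERIV_diff[OF dp dE])
    have "(V' s + (a - b * exp (- \<mu> * s)) * V s) * exp (q s + a * s) \<le> (c * exp (- \<nu> * s)) * exp (q s + a * s)"
      using bd[OF s(1)] by (intro mult_right_mono) (auto simp: algebra_simps)
    also have "\<dots> \<le> (c * exp (- \<nu> * s)) * exp (a * s)"
      using q0[of s] s c by (intro mult_left_mono) auto
    also have "\<dots> = c * exp ((a - \<nu>) * s)" by (simp add: exp_add[symmetric] algebra_simps)
    finally show "\<exists>y. (W has_real_derivative y) (at s) \<and> 0 \<le> y" using dW by force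
  qed
  then have "V t * exp (q t + a * t) \<le> V 0 + c / (a - \<nu>) * (exp ((a - \<nu>) * t) - 1)"
    by (simp add: W_def q_def algebra_simps)
  then have "V t * exp (q t + a * t) * exp (- a * t) \<le> (V 0 + c / (a - \<nu>) * (exp ((a - \<nu>) * t) - 1)) * exp (- a * t)"
    by (intro mult_right_mono) auto
  also have "V t * exp (q t + a * t) * exp (- a * t) = V t * exp (q t)"
    by (simp add: exp_add exp_minus)
  also have "(V 0 + c / (a - \<nu>) * (exp ((a - \<nu>) * t) - 1)) * exp (- a * t)
     \<le> (V 0 + c / \<bar>a - \<nu>\<bar>) * exp (- min a \<nu> * t)"
  proof -
    have "V 0 * exp (- a * t) \<le> V 0 * exp (- min a \<nu> * t)"
      using t pos by (intro mult_left_mono) (auto intro: mult_right_mono)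
    with exp_primitive_bound[OF c t ne] show ?thesis by (simp add: distrib_right)
  qed
  finally have *: "V t * exp (q t) \<le> (V 0 + c / \<bar>a - \<nu>\<bar>) * exp (- min a \<nu> * t)" .
  have "V t = (V t * exp (q t)) * exp (- q t)" by (simp add: exp_minus)
  also have "\<dots> \<le> ((V 0 + c / \<bar>a - \<nu>\<bar>) * exp (- min a \<nu> * t)) * exp (- q t)"
    using * by (intro mult_right_mono) auto
  also have "\<dots> \<le> ((V 0 + c / \<bar>a - \<nu>\<bar>) * exp (- min a \<nu> * t)) * exp (b / \<mu>)"
    using pos c \<mu> b t by (intro mult_left_mono) (auto simp: q_def algebra_simps)
  finally show ?thesis by (simp add: mult.commute)
qed

text \<open>With \<open>s\<close> false the choice \<open>\<kappa> = 0\<close> is permitted, which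
  leaves boundedness from above on the half-line. The bound is one-sided and is meant for norms and
  other nonnegative functions.\<close>

definition exp_bounded :: "bool \<Rightarrow> (real \<Rightarrow> real) \<Rightarrow> bool" where
  "exp_bounded s f \<longleftrightarrow> (\<exists>C \<kappa>. C \<ge> 0 \<and> \<kappa> \<ge> 0 \<and> (s \<longrightarrow> \<kappa> > 0) \<and> (\<forall>t\<ge>0. f t \<le> C * exp (- \<kappa> * t)))"

lemma exp_boundedI:
  "\<lbrakk>C \<ge> 0; \<kappa> \<ge> 0; s \<Longrightarrow> \<kappa> > 0; \<And>t. t \<ge> 0 \<Longrightarrow> f t \<le> C * exp (- \<kappa> * t)\<rbrakk> \<Longrightarrow> exp_bounded s f"
  unfolding exp_bounded_def by blast

lemma exp_bounded_mono:
  "\<lbrakk>exp_bounded s f; \<And>t. t \<ge> 0 \<Longrightarrow> g t \<le> f t\<rbrakk> \<Longrightarrow> exp_bounded s g"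
  unfolding exp_bounded_def by (meson order_trans)

lemma exp_bounded_cmult: "exp_bounded s f \<Longrightarrow> c \<ge> 0 \<Longrightarrow> exp_bounded s (\<lambda>t. c * f t)"
proof -
  assume "exp_bounded s f" and c: "c \<ge> 0"
  then obtain C \<kappa> where k: "C \<ge> 0" "\<kappa> \<ge> 0" "s \<longrightarrow> \<kappa> > 0" "\<forall>t\<ge>0. f t \<le> C * exp (- \<kappa> * t)"
    unfolding exp_bounded_def by blast
  show ?thesis
    by (rule exp_boundedI[of "c * C" \<kappa>]) (use k c in \<open>auto simp: mult.assoc intro!: mult_left_mono\<close>)
qed

lemma exp_bounded_add: "exp_bounded s f \<Longrightarrow> exp_bounded s g \<Longrightarrow> exp_bounded s (\<lambda>t. f t + g t)"
proof -
  assume "exp_bounded s f" "exp_bounded s g"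
  then obtain C \<kappa> C' \<kappa>' where k: "C \<ge> 0" "\<kappa> \<ge> 0" "s \<longrightarrow> \<kappa> > 0" "\<forall>t\<ge>0. f t \<le> C * exp (- \<kappa> * t)"
    and k': "C' \<ge> 0" "\<kappa>' \<ge> 0" "s \<longrightarrow> \<kappa>' > 0" "\<forall>t\<ge>0. g t \<le> C' * exp (- \<kappa>' * t)"
    unfolding exp_bounded_def by blast
  show ?thesis
  proof (rule exp_boundedI[of "C + C'" "min \<kappa> \<kappa>'"])
    fix t :: real assume t: "t \<ge> 0"
    have "C * exp (- \<kappa> * t) \<le> C * exp (- min \<kappa> \<kappa>' * t)" "C' * exp (- \<kappa>' * t) \<le> C' * exp (- min \<kappa> \<kappa>' * t)"
      using k k' t by (auto intro!: mult_left_mono mult_right_mono)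
    then show "f t + g t \<le> (C + C') * exp (- min \<kappa> \<kappa>' * t)"
      using k(4) k'(4) t by (simp add: distrib_right) (smt (verit))
  qed (use k k' in auto)
qed

lemma exp_bounded_sum: "finite I \<Longrightarrow> (\<And>i. i \<in> I \<Longrightarrow> exp_bounded s (f i)) \<Longrightarrow> exp_bounded s (\<lambda>t. \<Sum>i\<in>I. f i t)"
proof (induction I rule: finite_induct)
  case empty
  then show ?case by (intro exp_boundedI[of 0 1]) auto
next
  case (insert x F)
  then show ?case by (auto intro: exp_bounded_add)
qed

lemma exp_bounded_ode:
  fixes w f :: "real \<Rightarrow> 'a::real_normed_vector"
  assumes cont: "continuous_on {0..} w"
    and der: "\<And>t. t > 0 \<Longrightarrow> (w has_vector_derivative (- r *\<^sub>R w t + f t)) (at t)"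
    and bd: "exp_bounded s (\<lambda>t. norm (f t))" and r: "r > 0"
  shows "exp_bounded s (\<lambda>t. norm (w t))"
proof -
  obtain C \<kappa> where k: "C \<ge> 0" "\<kappa> \<ge> 0" "s \<longrightarrow> \<kappa> > 0" "\<And>t. t\<ge>0 \<Longrightarrow> norm (f t) \<le> C * exp (- \<kappa> * t)"
    using bd unfolding exp_bounded_def by blast
  \<comment> \<open>The rate of the source is lowered strictly below \<open>r\<close>: this excludes
    resonance and makes \<open>\<nu>\<close> the rate of the solution. It stays positive whenever
    \<open>\<kappa>\<close> is.\<close>
  define \<nu> where "\<nu> = min \<kappa> (r / 2)"
  have \<nu>: "\<nu> \<ge> 0" "s \<longrightarrow> \<nu> > 0" "\<nu> < r" "\<nu> \<le> \<kappa>" using k r by (auto simp: \<nu>_def)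
  have "norm (f t) \<le> C * exp (- \<nu> * t)" if "t > 0" for t
  proof -
    have "C * exp (- \<kappa> * t) \<le> C * exp (- \<nu> * t)"
      using k \<nu> that by (auto intro!: mult_left_mono mult_right_mono)
    then show ?thesis using k(4)[of t] that by simp
  qed
  then have "norm (w t) \<le> (norm (w 0) + C / \<bar>r - \<nu>\<bar>) * exp (- \<nu> * t)" if "t \<ge> 0" for t
    using linear_ode_bound[OF cont der _ k(1) _ that, where \<nu> = \<nu>] \<nu> by (simp add: min_def)
  then show ?thesis
    by (intro exp_boundedI[of "norm (w 0) + C / \<bar>r - \<nu>\<bar>" \<nu>]) (use k \<nu> in auto)
qed

text \<open>Multiplication by the unimodular function \<open>cis (- Im a * t)\<close> removes the
  imaginary part of \<open>a\<close> without changing norms, which reduces the claim to the real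
  rate \<open>- Re a\<close>.\<close>

lemma exp_bounded_complex_ode:
  fixes w f :: "real \<Rightarrow> complex"
  assumes cont: "continuous_on {0..} w"
    and der: "\<And>t. t > 0 \<Longrightarrow> (w has_vector_derivative (a * w t + f t)) (at t)"
    and bd: "exp_bounded s (\<lambda>t. norm (f t))" and r: "Re a < 0"
  shows "exp_bounded s (\<lambda>t. norm (w t))"
proof -
  define c where "c = (\<lambda>t. cis (- Im a * t))"
  have dc: "(c has_vector_derivative (- \<i> * Im a * c t)) (at t)" for t
    unfolding c_def has_vector_derivative_complex_iff
    by (auto intro!: derivative_eq_intros simp: )
  have nc: "norm (c t) = 1" for t by (simp add: c_def)
  have "exp_bounded s (\<lambda>t. norm (c t * w t))"
  proof (rule exp_bounded_ode[where r = "- Re a" and f = "\<lambda>t. c t * f t"])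
    show "continuous_on {0..} (\<lambda>t. c t * w t)" unfolding c_def
      by (intro continuous_intros cont)
    fix t :: real assume t: "t > 0"
    have "((\<lambda>t. c t * w t) has_vector_derivative (c t * (a * w t + f t) + (- \<i> * Im a * c t) * w t)) (at t)"
      by (rule has_vector_derivative_mult[OF dc der[OF t]])
    moreover have "c t * (a * w t + f t) + (- \<i> * Im a * c t) * w t = - (- Re a) *\<^sub>R (c t * w t) + c t * f t"
      by (subst (1) complex_eq[of a]) (simp add: scaleR_conv_of_real algebra_simps)
    ultimately show "((\<lambda>t. c t * w t) has_vector_derivative (- (- Re a) *\<^sub>R (c t * w t) + c t * f t)) (at t)"
      by simp
  qed (use r bd nc in \<open>auto simp: norm_mult\<close>)
  then show ?thesis by (simp add: norm_mult nc)
qed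

section \<open>Hurwitz matrices\<close>

text \<open>Linear dependence is a notion for sets, whereas a family is needed here. If the family
  is injective, its image has more elements than the dimension; otherwise two equal members with
  coefficients 1 and -1 give the relation.\<close>

lemma real_linear_relation:
  fixes f :: "nat \<Rightarrow> 'a::euclidean_space"
  obtains c :: "nat \<Rightarrow> real" where "\<exists>i\<le>DIM('a). c i \<noteq> 0" "(\<Sum>i\<le>DIM('a). c i *\<^sub>R f i) = 0"
proof (cases "inj_on f {..DIM('a)}")
  case True
  then have "dependent (f ` {..DIM('a)})"
    by (intro dependent_biggerset) (auto simp: card_image)
  then obtain u where u: "\<exists>v\<in>f ` {..DIM('a)}. u v \<noteq> 0" "(\<Sum>v\<in>f ` {..DIM('a)}. u v *\<^sub>R v) = 0"
    by (auto simp: dependent_finite)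
  show ?thesis
  proof (rule that[of "u \<circ> f"])
    show "(\<Sum>i\<le>DIM('a). (u \<circ> f) i *\<^sub>R f i) = 0"
      using u(2) sum.reindex[OF True, of "\<lambda>v. u v *\<^sub>R v"] by (simp add: o_def)
  qed (use u(1) in auto)
next
  case False
  then obtain i j where ij: "i \<le> DIM('a)" "j \<le> DIM('a)" "i \<noteq> j" "f i = f j" by (auto simp: inj_on_def)
  define c where "c = (\<lambda>k. (if k = i then 1 else 0) - (if k = j then 1 else 0 :: real))"
  have "(\<Sum>k\<le>DIM('a). c k *\<^sub>R f k) = (\<Sum>k\<le>DIM('a). (if k = i then f k else 0) - (if k = j then f k else 0))"
    by (intro sum.cong) (auto simp: c_def)
  also have "\<dots> = 0" using ij by (simp add: sum_subtractf)
  finally show ?thesis using ij by (intro that[of c]) (auto simp: c_def)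
qed

section \<open>Polynomials in a complex matrix acting on vectors\<close>

definition poly_act :: "complex^'n^'n \<Rightarrow> complex poly \<Rightarrow> complex^'n \<Rightarrow> complex^'n" where
  "poly_act M p v = (\<Sum>i\<le>degree p. coeff p i *s (((*v) M ^^ i) v))"

lemma poly_act_bound: "degree p \<le> n \<Longrightarrow> poly_act M p v = (\<Sum>i\<le>n. coeff p i *s (((*v) M ^^ i) v))"
  unfolding poly_act_def by (rule sum.mono_neutral_left) (auto simp: coeff_eq_0)

lemma matrix_vector_mult_sum: "M *v (\<Sum>i\<in>I. f i) = (\<Sum>i\<in>I. M *v (f i :: 'a::comm_ring_1^'n))"
  by (induction I rule: infinite_finite_induct) (auto simp: matrix_vector_right_distrib)

lemma matrix_vector_mult_smult: "M *v (c *s v) = c *s (M *v (v :: complex^'n))"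
  by (simp add: vec_eq_iff matrix_vector_mult_def sum_distrib_left mult_ac)

lemma poly_act_linear_factor:
  "poly_act M ([:-a, 1:] * q) v = M *v (poly_act M q v) - a *s poly_act M q v"
proof -
  \<comment> \<open>A common summation range for the product, for \<open>q\<close> shifted by one
    degree and for \<open>q\<close> itself. The shifted sum then becomes \<open>M\<close> applied to
    the action of \<open>q\<close>.\<close>
  let ?n = "Suc (degree q)"
  have "degree ([:-a, 1:] * q) \<le> ?n" by (rule order_trans[OF degree_mult_le]) simp
  then have "poly_act M ([:-a, 1:] * q) v = (\<Sum>i\<le>?n. coeff ([:-a, 1:] * q) i *s (((*v) M ^^ i) v))"
    by (rule poly_act_bound)
  also have "\<dots> = (\<Sum>i\<le>?n. coeff (pCons 0 q) i *s (((*v) M ^^ i) v)) - a *s (\<Sum>i\<le>?n. coeff q i *s (((*v) M ^^ i) v))"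
    by (simp add: vec_eq_iff sum_distrib_left sum_subtractf left_diff_distrib mult.assoc del: sum.atMost_Suc)
  also have "(\<Sum>i\<le>?n. coeff (pCons 0 q) i *s (((*v) M ^^ i) v)) = M *v poly_act M q v"
    unfolding poly_act_def
    by (subst sum.atMost_Suc_shift) (simp add: matrix_vector_mult_sum matrix_vector_mult_smult vec_eq_iff)
  also have "(\<Sum>i\<le>?n. coeff q i *s (((*v) M ^^ i) v)) = poly_act M q v"
    by (rule poly_act_bound[symmetric]) simp
  finally show ?thesis .
qed

lemma poly_act_apply: "poly_act M p (M *v v) = M *v poly_act M p v"
  by (simp add: poly_act_def matrix_vector_mult_sum matrix_vector_mult_smult funpow_swap1)

lemma poly_act_diff: "poly_act M p (u - v) = poly_act M p u - poly_act M p v"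
proof -
  have "((*v) M ^^ i) (u - v) = ((*v) M ^^ i) u - ((*v) M ^^ i) v" for i
    by (induction i) (auto simp: matrix_vector_mult_diff_distrib)
  then show ?thesis by (simp add: poly_act_def sum_subtractf vec_eq_iff right_diff_distrib)
qed

lemma poly_act_smult: "poly_act M p (c *s v) = c *s poly_act M p v"
proof -
  have "((*v) M ^^ i) (c *s v) = c *s ((*v) M ^^ i) v" for i
    by (induction i) (auto simp: matrix_vector_mult_smult)
  then show ?thesis by (simp add: poly_act_def vec_eq_iff sum_distrib_left mult_ac)
qed

text \<open>The powers of \<open>M\<close> up to the real dimension of the matrix space are one too
  many to be independent; the coefficients of a nontrivial relation between them are those of the
  polynomial.\<close>

lemma annihilating_poly:
  fixes M :: "complex^'n^'n"
  obtains p where "p \<noteq> 0" "\<And>v. poly_act M p v = 0"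
proof -
  define f where "f = (\<lambda>i. (((**) M) ^^ i) (mat 1))"
  define N where "N = DIM(complex^'n^'n)"
  obtain c :: "nat \<Rightarrow> real" where c: "\<exists>i\<le>N. c i \<noteq> 0" "(\<Sum>i\<le>N. c i *\<^sub>R f i) = 0"
    unfolding N_def by (rule real_linear_relation)
  define p where "p = (\<Sum>i\<le>N. monom (complex_of_real (c i)) i)"
  have cp: "coeff p i = (if i \<le> N then c i else 0)" for i
    by (simp add: p_def coeff_sum)
  have fv: "f i *v v = ((*v) M ^^ i) v" for i v
    by (induction i) (auto simp: f_def matrix_vector_mul_assoc[symmetric])
  show ?thesis
  proof (rule that[of p])
    show "p \<noteq> 0" using c(1) cp by (metis coeff_0 of_real_eq_0_iff)
    fix v
    have "degree p \<le> N" by (rule degree_le) (auto simp: cp)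
    then have "poly_act M p v = (\<Sum>i\<le>N. coeff p i *s (((*v) M ^^ i) v))" by (rule poly_act_bound)
    also have "\<dots> = (\<Sum>i\<le>N. (c i *\<^sub>R f i) *v v)"
      by (intro sum.cong refl)
        (simp add: fv[symmetric] cp vec_eq_iff matrix_vector_mult_def sum_distrib_left scaleR_conv_of_real[where 'a=complex] mult_ac)
    also have "\<dots> = (\<Sum>i\<le>N. c i *\<^sub>R f i) *v v"
      by (induction N) (auto simp: matrix_vector_mult_add_rdistrib)
    finally show "poly_act M p v = 0" using c(2) by simp
  qed
qed

lemma norm_le_sum_components:
  fixes v :: "'a::real_normed_vector^'n"
  shows "norm v \<le> (\<Sum>i\<in>UNIV. norm (v $ i))"
  unfolding norm_vec_def by (rule L2_set_le_sum) auto

lemma exp_bounded_norm_linear: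
  fixes L :: "'a::euclidean_space \<Rightarrow> 'b::real_normed_vector"
  assumes "linear L" "exp_bounded s (\<lambda>t. norm (d t))"
  shows "exp_bounded s (\<lambda>t. norm (L (d t)))"
proof -
  obtain K where K: "\<And>x. norm (L x) \<le> norm x * K" "K > 0"
    using assms(1) bounded_linear.pos_bounded linear_conv_bounded_linear by blast
  show ?thesis
    using exp_bounded_mono[OF exp_bounded_cmult[OF assms(2), of K]] K by (simp add: mult.commute)
qed

text \<open>Induction on an annihilating polynomial replaces the matrix exponential: a root \<open>a\<close> that is no
  eigenvalue can be dropped, and otherwise \<open>u = M *v w - a *s w\<close> is handled by the induction
  hypothesis and acts as a source in the scalar equations \<open>w' = a *s w + (u + d)\<close>.\<close>
lemma annihilated_ode_exp_bounded:
  fixes M :: "complex^'n^'n" and w d :: "real \<Rightarrow> complex^'n"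
  assumes M: "\<And>lam v. v \<noteq> 0 \<Longrightarrow> M *v v = lam *s v \<Longrightarrow> Re lam < 0"
    and "p \<noteq> 0"
    and "continuous_on {0..} w"
    and "\<And>t. t > 0 \<Longrightarrow> (w has_vector_derivative (M *v w t + d t)) (at t)"
    and "exp_bounded s (\<lambda>t. norm (d t))"
    and "\<And>t. t \<ge> 0 \<Longrightarrow> poly_act M p (w t) = 0"
  shows "exp_bounded s (\<lambda>t. norm (w t))"
  using assms(2-)
proof (induction "degree p" arbitrary: p w d)
  case 0
  then obtain c where p: "p = [:c:]" by (metis degree_eq_zeroE)
  with 0 have "w t = 0" if "t \<ge> 0" for t using "0.prems"(5)[OF that] by (auto simp: poly_act_def)
  then show ?case by (intro exp_boundedI[of 0 1]) auto
next
  case (Suc n)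
  then have "\<not> constant (poly p)" by (simp add: constant_degree)
  then obtain a where "poly p a = 0" using fundamental_theorem_of_algebra by blast
  then obtain q where q: "p = [:-a, 1:] * q" by (auto simp: poly_eq_0_iff_dvd dvd_def)
  with Suc.prems(1) have q0: "q \<noteq> 0" by auto
  have dq: "n = degree q" using Suc.hyps(2) q0 unfolding q by (subst (asm) degree_mult_eq) auto
  define T where "T = (\<lambda>v. M *v v - a *s v)"
  have T: "linear T" unfolding T_def
    by (rule linearI) (auto simp: vec_eq_iff matrix_vector_mult_def algebra_simps sum.distrib
        sum_distrib_left scaleR_conv_of_real[where 'a=complex])
  then have bT: "bounded_linear T" by (simp add: linear_conv_bounded_linear)
  show ?case
  proof (cases "\<exists>v. v \<noteq> 0 \<and> M *v v = a *s v")
    case False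
    have "poly_act M q (w t) = 0" if "t \<ge> 0" for t
      using Suc.prems(5)[OF that] False unfolding q poly_act_linear_factor by auto
    then show ?thesis using Suc.hyps(1)[OF dq q0 Suc.prems(2-4)] by blast
  next
    case True
    then have a: "Re a < 0" using M by blast
    \<comment> \<open>\<open>T\<close> commutes with \<open>M\<close>, so \<open>T (w t)\<close>
      solves the same system with source \<open>T (d t)\<close>. It is annihilated by
      \<open>q\<close> because \<open>w\<close> is annihilated by the product of \<open>q\<close>
      with the linear factor.\<close>
    have u: "exp_bounded s (\<lambda>t. norm (T (w t)))"
    proof (rule Suc.hyps(1)[OF dq q0])
      show "continuous_on {0..} (\<lambda>t. T (w t))"
        using bT Suc.prems(2) by (rule bounded_linear.continuous_on)
      show "((\<lambda>t. T (w t)) has_vector_derivative (M *v T (w t) + T (d t))) (at t)" if "t > 0" for t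
      proof -
        have "((\<lambda>t. T (w t)) has_vector_derivative T (M *v w t + d t)) (at t)"
          by (rule bounded_linear.has_vector_derivative[OF bT Suc.prems(3)[OF that]])
        moreover have "T (M *v w t + d t) = M *v T (w t) + T (d t)"
          by (simp add: linear_add[OF T]) (simp add: T_def matrix_vector_mult_diff_distrib matrix_vector_mult_smult)
        ultimately show ?thesis by simp
      qed
      show "exp_bounded s (\<lambda>t. norm (T (d t)))" by (rule exp_bounded_norm_linear[OF T Suc.prems(4)])
      show "poly_act M q (T (w t)) = 0" if "t \<ge> 0" for t
        using Suc.prems(5)[OF that] unfolding q poly_act_linear_factor
        by (simp add: T_def poly_act_diff poly_act_apply poly_act_smult)
    qed
    have ud: "exp_bounded s (\<lambda>t. norm (T (w t)) + norm (d t))"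
      by (rule exp_bounded_add[OF u Suc.prems(4)])
    have "exp_bounded s (\<lambda>t. norm (w t $ i))" for i
    proof (rule exp_bounded_complex_ode[OF _ _ _ a])
      show "continuous_on {0..} (\<lambda>t. w t $ i)" using Suc.prems(2) by (intro continuous_intros)
      show "((\<lambda>t. w t $ i) has_vector_derivative (a * w t $ i + (T (w t) + d t) $ i)) (at t)" if "t > 0" for t
      proof -
        have "((\<lambda>t. w t $ i) has_vector_derivative (M *v w t + d t) $ i) (at t)"
          by (rule bounded_linear.has_vector_derivative[OF bounded_linear_vec_nth Suc.prems(3)[OF that]])
        then show ?thesis by (simp add: T_def)
      qed
      show "exp_bounded s (\<lambda>t. norm ((T (w t) + d t) $ i))"
        by (rule exp_bounded_mono[OF ud]) (rule order_trans[OF Finite_Cartesian_Product.norm_nth_le norm_triangle_ineq])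
    qed
    then have "exp_bounded s (\<lambda>t. \<Sum>i\<in>UNIV. norm (w t $ i))" by (intro exp_bounded_sum) auto
    then show ?thesis by (rule exp_bounded_mono) (rule norm_le_sum_components)
  qed
qed

text \<open>Eigenvalues are complex, so the real system is embedded isometrically into
  \<open>complex^'n\<close>, where the polynomial argument applies.\<close>

lemma hurwitz_ode_exp_bounded:
  fixes A :: "real^'n^'n" and x d :: "real \<Rightarrow> real^'n"
  assumes A: "hurwitz A"
    and cont: "continuous_on {0..} x"
    and der: "\<And>t. t > 0 \<Longrightarrow> (x has_vector_derivative (A *v x t + d t)) (at t)"
    and bd: "exp_bounded s (\<lambda>t. norm (d t))"
  shows "exp_bounded s (\<lambda>t. norm (x t))"
proof -
  define cx :: "real^'n \<Rightarrow> complex^'n" where "cx = (\<lambda>v. \<chi> i. complex_of_real (v $ i))"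
  define M :: "complex^'n^'n" where "M = (\<chi> i j. complex_of_real (A $ i $ j))"
  have lin: "linear cx" unfolding cx_def by (rule linearI) (auto simp: vec_eq_iff scaleR_conv_of_real[where 'a=complex])
  then have bl: "bounded_linear cx" by (simp add: linear_conv_bounded_linear)
  have cA: "cx (A *v v) = M *v cx v" for v
    by (simp add: cx_def M_def vec_eq_iff matrix_vector_mult_def)
  have nc: "norm (cx v) = norm v" for v by (simp add: cx_def norm_vec_def)
  obtain p where p: "p \<noteq> 0" "\<And>v. poly_act M p v = 0" using annihilating_poly by blast
  have "exp_bounded s (\<lambda>t. norm (cx (x t)))"
  proof (rule annihilated_ode_exp_bounded[OF _ p(1) _ _ _ p(2)])
    show "Re lam < 0" if "v \<noteq> 0" "M *v v = lam *s v" for lam v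
      using A that unfolding hurwitz_def by (simp add: M_def vec_eq_iff matrix_vector_mult_def) blast
    show "continuous_on {0..} (\<lambda>t. cx (x t))" using bl cont by (rule bounded_linear.continuous_on)
    show "((\<lambda>t. cx (x t)) has_vector_derivative (M *v cx (x t) + cx (d t))) (at t)" if "t > 0" for t
      using bounded_linear.has_vector_derivative[OF bl der[OF that]] by (simp add: linear_add[OF lin] cA)
  qed (use bd nc in auto)
  then show ?thesis by (simp add: nc)
qed

section \<open>Square-integrable functions on the unit interval\<close>

text \<open>Truncation by zero makes every integral one over the whole line, so that translation
  invariance and Fubini's theorem apply without moving integration limits. The open interval matches
  \<open>L2_01\<close>.\<close>

definition cut01 :: "(real \<Rightarrow> 'a::euclidean_space) \<Rightarrow> real \<Rightarrow> 'a" where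
  "cut01 f = (\<lambda>\<xi>. indicator {0<..<1} \<xi> *\<^sub>R f \<xi>)"

lemma L2_01_iff:
  "L2_01 f \<longleftrightarrow> cut01 f \<in> borel_measurable borel \<and> integrable lborel (\<lambda>\<xi>. (norm (cut01 f \<xi>))\<^sup>2)"
proof -
  have "(\<lambda>\<xi>. (norm (cut01 f \<xi>))\<^sup>2) = (\<lambda>\<xi>. indicator {0<..<1} \<xi> *\<^sub>R (norm (f \<xi>))\<^sup>2)"
    by (auto simp: cut01_def indicator_def)
  then show ?thesis
    unfolding L2_01_def set_borel_measurable_def set_integrable_def cut01_def by simp
qed

lemma cut01_measurable: "L2_01 f \<Longrightarrow> cut01 f \<in> borel_measurable borel"
  by (simp add: L2_01_iff)

lemma L2norm_alt: "L2norm f = sqrt (\<integral>\<xi>. (norm (cut01 f \<xi>))\<^sup>2 \<partial>lborel)"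
proof -
  have "(\<lambda>\<xi>. (norm (cut01 f \<xi>))\<^sup>2) = (\<lambda>\<xi>. indicator {0<..<1} \<xi> *\<^sub>R (norm (f \<xi>))\<^sup>2)"
    by (auto simp: cut01_def indicator_def)
  then show ?thesis by (simp add: L2norm_def set_lebesgue_integral_def)
qed

lemma L2norm_nonneg [simp]: "L2norm f \<ge> 0"
  by (simp add: L2norm_alt Bochner_Integration.integral_nonneg)

lemma L2norm_power2: "(L2norm f)\<^sup>2 = (\<integral>\<xi>. (norm (cut01 f \<xi>))\<^sup>2 \<partial>lborel)"
  by (simp add: L2norm_alt Bochner_Integration.integral_nonneg)

text \<open>The L2 inner product with weight \<open>exp (- k * \<xi>)\<close>; \<open>k = 0\<close>
  is the ordinary one. A decreasing weight is what turns transport to the right into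
  dissipation.\<close>

definition wip :: "real \<Rightarrow> (real \<Rightarrow> 'a::euclidean_space) \<Rightarrow> (real \<Rightarrow> 'a) \<Rightarrow> real" where
  "wip k f g = (\<integral>\<xi>. exp (- k * \<xi>) * (cut01 f \<xi> \<bullet> cut01 g \<xi>) \<partial>lborel)"

lemma wip_bound_pointwise:
  assumes "k \<ge> 0"
  shows "\<bar>exp (- k * \<xi>) * (cut01 f \<xi> \<bullet> cut01 g \<xi>)\<bar> \<le> norm (cut01 f \<xi>) * norm (cut01 g \<xi>)"
proof (cases "\<xi> \<in> {0<..<1}")
  case True
  have "\<bar>exp (- k * \<xi>) * (cut01 f \<xi> \<bullet> cut01 g \<xi>)\<bar> \<le> 1 * \<bar>cut01 f \<xi> \<bullet> cut01 g \<xi>\<bar>"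
    unfolding abs_mult using True assms by (intro mult_right_mono) auto
  also have "\<dots> \<le> norm (cut01 f \<xi>) * norm (cut01 g \<xi>)" using Cauchy_Schwarz_ineq2 by simp
  finally show ?thesis .
qed (auto simp: cut01_def)

lemma L2_prod_integrable:
  assumes "L2_01 f" "L2_01 g"
  shows "integrable lborel (\<lambda>\<xi>. norm (cut01 f \<xi>) * norm (cut01 g \<xi>))"
proof (rule Bochner_Integration.integrable_bound)
  show "integrable lborel (\<lambda>\<xi>. (norm (cut01 f \<xi>))\<^sup>2 + (norm (cut01 g \<xi>))\<^sup>2)"
    using assms by (simp add: L2_01_iff)
  show "(\<lambda>\<xi>. norm (cut01 f \<xi>) * norm (cut01 g \<xi>)) \<in> borel_measurable lborel"
    using assms[THEN cut01_measurable] by measurable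
  have "a * b \<le> a\<^sup>2 + b\<^sup>2" if "a \<ge> 0" "b \<ge> 0" for a b :: real
    using sum_squares_bound[of a b] mult_nonneg_nonneg[OF that] by linarith
  then show "AE \<xi> in lborel. norm (norm (cut01 f \<xi>) * norm (cut01 g \<xi>)) \<le> norm ((norm (cut01 f \<xi>))\<^sup>2 + (norm (cut01 g \<xi>))\<^sup>2)"
    by simp
qed

lemma wip_integrable:
  assumes "L2_01 f" "L2_01 g" "k \<ge> 0"
  shows "integrable lborel (\<lambda>\<xi>. exp (- k * \<xi>) * (cut01 f \<xi> \<bullet> cut01 g \<xi>))"
proof (rule Bochner_Integration.integrable_bound[OF L2_prod_integrable[OF assms(1,2)]])
  show "(\<lambda>\<xi>. exp (- k * \<xi>) * (cut01 f \<xi> \<bullet> cut01 g \<xi>)) \<in> borel_measurable lborel"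
    using assms(1,2)[THEN cut01_measurable] by measurable
qed (use wip_bound_pointwise[OF assms(3)] in \<open>auto intro!: AE_I2\<close>)

lemma quadratic_nonneg_discriminant:
  fixes A B x :: real
  assumes "\<And>c. A * c\<^sup>2 - 2 * x * c + B \<ge> 0" "A \<ge> 0"
  shows "x\<^sup>2 \<le> A * B"
proof (cases "A = 0")
  case True
  have "x = 0"
  proof (rule ccontr)
    assume "x \<noteq> 0"
    \<comment> \<open>For \<open>A = 0\<close> this value of \<open>c\<close> makes the polynomial
      equal to -1.\<close>
    then show False using assms(1)[of "(B + 1) / (2 * x)"] True by simp
  qed
  then show ?thesis using True by simp
next
  case False
  then have "A > 0" using assms by simp
  have "A * (x / A)\<^sup>2 - 2 * x * (x / A) + B = B - x\<^sup>2 / A"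
    using False by (simp add: power2_eq_square)
  then have "x\<^sup>2 / A \<le> B" using assms(1)[of "x / A"] by simp
  then show ?thesis using \<open>A > 0\<close> by (simp add: pos_divide_le_eq mult.commute)
qed

text \<open>Cauchy-Schwarz from the discriminant of the nonnegative quadratic polynomial in
  \<open>c\<close> obtained by integrating the square of \<open>c\<close> times one norm minus the
  other.\<close>

lemma L2_prod_le:
  assumes f: "L2_01 f" and g: "L2_01 g"
  shows "(\<integral>\<xi>. norm (cut01 f \<xi>) * norm (cut01 g \<xi>) \<partial>lborel) \<le> L2norm f * L2norm g"
proof -
  let ?x = "\<integral>\<xi>. norm (cut01 f \<xi>) * norm (cut01 g \<xi>) \<partial>lborel"
  have "(L2norm f)\<^sup>2 * c\<^sup>2 - 2 * ?x * c + (L2norm g)\<^sup>2 \<ge> 0" for c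
  proof -
    have "0 \<le> (\<integral>\<xi>. (c * norm (cut01 f \<xi>) - norm (cut01 g \<xi>))\<^sup>2 \<partial>lborel)"
      by (intro Bochner_Integration.integral_nonneg) auto
    also have "\<dots> = (\<integral>\<xi>. c\<^sup>2 * (norm (cut01 f \<xi>))\<^sup>2 - (2 * c) * (norm (cut01 f \<xi>) * norm (cut01 g \<xi>)) + (norm (cut01 g \<xi>))\<^sup>2 \<partial>lborel)"
      by (intro Bochner_Integration.integral_cong refl) (simp add: power2_eq_square algebra_simps)
    also have "\<dots> = c\<^sup>2 * (L2norm f)\<^sup>2 - 2 * c * ?x + (L2norm g)\<^sup>2"
      using f g L2_prod_integrable[OF f g] by (simp add: L2_01_iff L2norm_power2)
    finally show ?thesis by (simp add: mult_ac)
  qed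
  then have "?x\<^sup>2 \<le> (L2norm f)\<^sup>2 * (L2norm g)\<^sup>2"
    by (rule quadratic_nonneg_discriminant) simp
  then have "?x\<^sup>2 \<le> (L2norm f * L2norm g)\<^sup>2" by (simp add: power_mult_distrib)
  then show ?thesis by (rule power2_le_imp_le) simp
qed

lemma wip_Cauchy_Schwarz:
  assumes "L2_01 f" "L2_01 g" "k \<ge> 0"
  shows "\<bar>wip k f g\<bar> \<le> L2norm f * L2norm g"
proof -
  have "\<bar>wip k f g\<bar> \<le> (\<integral>\<xi>. norm (cut01 f \<xi>) * norm (cut01 g \<xi>) \<partial>lborel)"
    unfolding wip_def
    by (rule integral_abs_bound[THEN order_trans], rule Bochner_Integration.integral_mono)
      (use assms wip_integrable[OF assms] L2_prod_integrable[OF assms(1,2)] wip_bound_pointwise[OF assms(3)] in auto)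
  also have "\<dots> \<le> L2norm f * L2norm g" by (rule L2_prod_le[OF assms(1,2)])
  finally show ?thesis .
qed

lemma cut01_simps:
  "cut01 (\<lambda>\<xi>. f \<xi> + g \<xi>) = (\<lambda>\<xi>. cut01 f \<xi> + cut01 g \<xi>)"
  "cut01 (\<lambda>\<xi>. f \<xi> - g \<xi>) = (\<lambda>\<xi>. cut01 f \<xi> - cut01 g \<xi>)"
  "cut01 (\<lambda>\<xi>. c *\<^sub>R f \<xi>) = (\<lambda>\<xi>. c *\<^sub>R cut01 f \<xi>)"
  by (auto simp: cut01_def algebra_simps)

lemma cut01_linear: "linear L \<Longrightarrow> cut01 (\<lambda>\<xi>. L (f \<xi>)) = (\<lambda>\<xi>. L (cut01 f \<xi>))"
  by (auto simp: cut01_def indicator_def linear_0)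

lemma wip_commute: "wip k f g = wip k g f"
  by (simp add: wip_def inner_commute)

lemma wip_add_left:
  assumes "L2_01 f" "L2_01 g" "L2_01 h" "k \<ge> 0"
  shows "wip k (\<lambda>\<xi>. f \<xi> + g \<xi>) h = wip k f h + wip k g h"
  unfolding wip_def cut01_simps inner_add_left distrib_left
  by (rule Bochner_Integration.integral_add) (use assms wip_integrable in auto)

lemma wip_add_right:
  assumes "L2_01 f" "L2_01 g" "L2_01 h" "k \<ge> 0"
  shows "wip k h (\<lambda>\<xi>. f \<xi> + g \<xi>) = wip k h f + wip k h g"
  using wip_add_left[OF assms] by (simp add: wip_commute)

lemma wip_scale_left: "wip k (\<lambda>\<xi>. c *\<^sub>R f \<xi>) h = c * wip k f h"
  unfolding wip_def cut01_simps by (simp add: mult.left_commute)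

lemma L2_01_linear:
  assumes "linear L" "L2_01 f"
  shows "L2_01 (\<lambda>\<xi>. L (f \<xi>))"
    and "(\<And>x. norm (L x) \<le> K * norm x) \<Longrightarrow> K \<ge> 0 \<Longrightarrow> L2norm (\<lambda>\<xi>. L (f \<xi>)) \<le> K * L2norm f"
proof -
  obtain B where B: "\<And>x. norm (L x) \<le> B * norm x" "B > 0"
    using assms(1) linear_bounded_pos by blast
  note [measurable] = cut01_measurable[OF assms(2)]
  have L[measurable]: "L \<in> borel_measurable borel"
    using assms(1) by (intro borel_measurable_continuous_onI linear_continuous_on) (simp add: linear_conv_bounded_linear)
  have sq: "(norm (L (cut01 f \<xi>)))\<^sup>2 \<le> K\<^sup>2 * (norm (cut01 f \<xi>))\<^sup>2" if "\<And>x. norm (L x) \<le> K * norm x" for \<xi> K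
    using power_mono[OF that, of "cut01 f \<xi>" 2] by (simp add: power_mult_distrib)
  have int: "integrable lborel (\<lambda>\<xi>. (norm (L (cut01 f \<xi>)))\<^sup>2)"
    by (rule Bochner_Integration.integrable_bound[of _ "\<lambda>\<xi>. B\<^sup>2 * (norm (cut01 f \<xi>))\<^sup>2"])
      (use assms(2) sq[OF B(1)] in \<open>auto simp: L2_01_iff\<close>)
  show "L2_01 (\<lambda>\<xi>. L (f \<xi>))"
    using int by (simp add: L2_01_iff cut01_linear[OF assms(1)])
  show "L2norm (\<lambda>\<xi>. L (f \<xi>)) \<le> K * L2norm f" if K: "\<And>x. norm (L x) \<le> K * norm x" "K \<ge> 0"
  proof (rule power2_le_imp_le)
    have "(L2norm (\<lambda>\<xi>. L (f \<xi>)))\<^sup>2 \<le> (\<integral>\<xi>. K\<^sup>2 * (norm (cut01 f \<xi>))\<^sup>2 \<partial>lborel)"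
      unfolding L2norm_power2 cut01_linear[OF assms(1)]
      by (rule Bochner_Integration.integral_mono[OF int]) (use assms(2) sq[OF K(1)] in \<open>auto simp: L2_01_iff\<close>)
    then show "(L2norm (\<lambda>\<xi>. L (f \<xi>)))\<^sup>2 \<le> (K * L2norm f)\<^sup>2"
      by (simp add: L2norm_power2 power_mult_distrib)
  qed (use K in simp)
qed

lemma L2_01_add:
  assumes "L2_01 f" "L2_01 g"
  shows "L2_01 (\<lambda>\<xi>. f \<xi> + g \<xi>)"
proof -
  note [measurable] = assms[THEN cut01_measurable]
  have "(norm (a + b))\<^sup>2 \<le> 2 * (norm a)\<^sup>2 + 2 * (norm b)\<^sup>2" for a b :: 'a
  proof -
    have "(norm (a + b))\<^sup>2 \<le> (norm a + norm b)\<^sup>2" by (intro power_mono norm_triangle_ineq) auto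
    also have "\<dots> \<le> 2 * (norm a)\<^sup>2 + 2 * (norm b)\<^sup>2"
      using sum_squares_bound[of "norm a" "norm b"] by (simp add: power2_sum)
    finally show ?thesis .
  qed
  note le = this
  have "integrable lborel (\<lambda>\<xi>. (norm (cut01 f \<xi> + cut01 g \<xi>))\<^sup>2)"
  proof (rule Bochner_Integration.integrable_bound[of _ "\<lambda>\<xi>. 2 * (norm (cut01 f \<xi>))\<^sup>2 + 2 * (norm (cut01 g \<xi>))\<^sup>2"])
    show "integrable lborel (\<lambda>\<xi>. 2 * (norm (cut01 f \<xi>))\<^sup>2 + 2 * (norm (cut01 g \<xi>))\<^sup>2)"
      using assms by (simp add: L2_01_iff)
    show "AE \<xi> in lborel. norm ((norm (cut01 f \<xi> + cut01 g \<xi>))\<^sup>2) \<le> norm (2 * (norm (cut01 f \<xi>))\<^sup>2 + 2 * (norm (cut01 g \<xi>))\<^sup>2)"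
      using le by (intro AE_I2) simp
  qed measurable
  then show ?thesis by (simp add: L2_01_iff cut01_simps)
qed

lemma L2_01_scale: "L2_01 f \<Longrightarrow> L2_01 (\<lambda>\<xi>. c *\<^sub>R f \<xi>)"
  by (rule L2_01_linear(1)[of "\<lambda>x. c *\<^sub>R x"]) (simp_all add: linear_conv_bounded_linear bounded_linear_scaleR_right)

lemma L2_01_diff: "L2_01 f \<Longrightarrow> L2_01 g \<Longrightarrow> L2_01 (\<lambda>\<xi>. f \<xi> - g \<xi>)"
  using L2_01_add[OF _ L2_01_scale[of g "-1"], of f] by simp

lemma wip_self: "wip 0 f f = (L2norm f)\<^sup>2"
  by (simp add: wip_def L2norm_power2 dot_square_norm)

lemma wip_self_le:
  assumes "L2_01 f" "k \<ge> 0" shows "wip k f f \<le> (L2norm f)\<^sup>2"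
  using wip_Cauchy_Schwarz[OF assms(1,1,2)] by (simp add: power2_eq_square)

lemma wip_self_ge:
  assumes "L2_01 f" "k \<ge> 0" shows "exp (- k) * (L2norm f)\<^sup>2 \<le> wip k f f"
proof -
  have "exp (- k) * (L2norm f)\<^sup>2 = (\<integral>\<xi>. exp (- k) * (cut01 f \<xi> \<bullet> cut01 f \<xi>) \<partial>lborel)"
    by (simp add: L2norm_power2 dot_square_norm)
  also have "\<dots> \<le> wip k f f" unfolding wip_def
  proof (rule Bochner_Integration.integral_mono[OF _ wip_integrable[OF assms(1,1,2)]])
    show "integrable lborel (\<lambda>\<xi>. exp (- k) * (cut01 f \<xi> \<bullet> cut01 f \<xi>))"
      using assms by (simp add: L2_01_iff dot_square_norm)
    show "exp (- k) * (cut01 f \<xi> \<bullet> cut01 f \<xi>) \<le> exp (- k * \<xi>) * (cut01 f \<xi> \<bullet> cut01 f \<xi>)" for \<xi>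
    proof (cases "\<xi> \<in> {0<..<1}")
      case True
      have "k * \<xi> \<le> k" using True assms by (simp add: mult_left_le)
      then show ?thesis by (intro mult_right_mono) auto
    qed (simp add: cut01_def)
  qed
  finally show ?thesis .
qed

lemma wip_nonneg: "wip k f f \<ge> 0"
  unfolding wip_def by (intro Bochner_Integration.integral_nonneg) auto

lemma L2norm_triangle:
  assumes "L2_01 f" "L2_01 g"
  shows "L2norm (\<lambda>\<xi>. f \<xi> + g \<xi>) \<le> L2norm f + L2norm g"
proof (rule power2_le_imp_le)
  note fg = L2_01_add[OF assms]
  have "(L2norm (\<lambda>\<xi>. f \<xi> + g \<xi>))\<^sup>2 = wip 0 f f + 2 * wip 0 f g + wip 0 g g"
    unfolding wip_self[symmetric]
    using assms fg wip_commute[of 0 g f] by (simp add: wip_add_left wip_add_right)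
  also have "\<dots> \<le> (L2norm f + L2norm g)\<^sup>2"
    using wip_Cauchy_Schwarz[OF assms, of 0] by (simp add: wip_self power2_sum)
  finally show "(L2norm (\<lambda>\<xi>. f \<xi> + g \<xi>))\<^sup>2 \<le> (L2norm f + L2norm g)\<^sup>2" .
qed simp

lemma L2norm_scale: "L2norm (\<lambda>\<xi>. c *\<^sub>R f \<xi>) = \<bar>c\<bar> * L2norm f"
  by (simp add: L2norm_alt cut01_simps power_mult_distrib real_sqrt_mult)

lemma L2norm_triangle_diff:
  assumes "L2_01 f" "L2_01 g"
  shows "L2norm (\<lambda>\<xi>. f \<xi> - g \<xi>) \<le> L2norm f + L2norm g"
  using L2norm_triangle[OF assms(1) L2_01_scale[OF assms(2), of "-1"]] L2norm_scale[of "-1" g] by simp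

lemma cut01_cong_AE:
  assumes "AE \<xi> in lborel. \<xi> \<in> {0<..<1} \<longrightarrow> f \<xi> = g \<xi>"
  shows "AE \<xi> in lborel. cut01 f \<xi> = cut01 g \<xi>"
  using assms by eventually_elim (auto simp: cut01_def indicator_def)

lemma wip_cong_AE:
  assumes "AE \<xi> in lborel. \<xi> \<in> {0<..<1} \<longrightarrow> f \<xi> = g \<xi>" "L2_01 f" "L2_01 g" "L2_01 h"
  shows "wip k f h = wip k g h"
  unfolding wip_def
proof (rule integral_cong_AE)
  note [measurable] = assms(2-4)[THEN cut01_measurable]
  show "(\<lambda>\<xi>. exp (- k * \<xi>) * (cut01 f \<xi> \<bullet> cut01 h \<xi>)) \<in> borel_measurable lborel" by measurable
  show "(\<lambda>\<xi>. exp (- k * \<xi>) * (cut01 g \<xi> \<bullet> cut01 h \<xi>)) \<in> borel_measurable lborel" by measurable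
  show "AE \<xi> in lborel. exp (- k * \<xi>) * (cut01 f \<xi> \<bullet> cut01 h \<xi>) = exp (- k * \<xi>) * (cut01 g \<xi> \<bullet> cut01 h \<xi>)"
    using cut01_cong_AE[OF assms(1)] by eventually_elim simp
qed

section \<open>Weak derivatives as indefinite integrals\<close>

lemma cut01_integrable:
  assumes "L2_01 g" shows "integrable lborel (cut01 g)"
proof (rule Bochner_Integration.integrable_bound[of _ "\<lambda>\<xi>. indicator {0<..<1} \<xi> + (norm (cut01 g \<xi>))\<^sup>2"])
  show "integrable lborel (\<lambda>\<xi>. indicator {0<..<1} \<xi> + (norm (cut01 g \<xi>))\<^sup>2 :: real)"
    using assms by (auto simp: L2_01_iff)
  show "cut01 g \<in> borel_measurable lborel" using assms cut01_measurable by simp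
  have "norm (cut01 g \<xi>) \<le> indicator {0<..<1} \<xi> + (norm (cut01 g \<xi>))\<^sup>2" for \<xi>
  proof (cases "\<xi> \<in> {0<..<1}")
    case True
    have "norm x \<le> 1 + (norm x)\<^sup>2" for x :: 'a
      using sum_squares_bound[of "norm x" 1] norm_ge_zero[of x] by (simp del: norm_ge_zero)
    then show ?thesis using True by simp
  qed (simp add: cut01_def)
  then show "AE \<xi> in lborel. norm (cut01 g \<xi>) \<le> norm (indicator {0<..<1} \<xi> + (norm (cut01 g \<xi>))\<^sup>2 :: real)"
    by (intro AE_I2) (metis abs_ge_self order_trans real_norm_def)
qed

lemma weak_deriv01_iff:
  "weak_deriv01 f g \<longleftrightarrow> L2_01 g \<and> (\<forall>x\<in>{0..1}. f x = f 0 + (\<integral>s. indicator {..x} s *\<^sub>R cut01 g s \<partial>lborel))"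
proof -
  have "(LINT s:{0..x}|lborel. g s) = (\<integral>s. indicator {..x} s *\<^sub>R cut01 g s \<partial>lborel)"
    if g: "L2_01 g" and x: "x \<in> {0..1}" for x
    unfolding set_lebesgue_integral_def
  proof (rule integral_cong_AE)
    note [measurable] = cut01_measurable[OF g]
    \<comment> \<open>\<open>L2_01 g\<close> gives measurability on the open interval only, so the
      values at the two endpoints are split off as multiples of indicators of points.\<close>
    have "(\<lambda>s. indicator {0..x} s *\<^sub>R g s) =
      (\<lambda>s. indicator {..x} s *\<^sub>R cut01 g s + indicator {0} s *\<^sub>R g 0 + indicator ({1} \<inter> {..x}) s *\<^sub>R g 1)"
      using x by (auto simp: fun_eq_iff cut01_def indicator_def)
    then show "(\<lambda>s. indicator {0..x} s *\<^sub>R g s) \<in> borel_measurable lborel" by simp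
    show "(\<lambda>s. indicator {..x} s *\<^sub>R cut01 g s) \<in> borel_measurable lborel" by measurable
    show "AE s in lborel. indicator {0..x} s *\<^sub>R g s = indicator {..x} s *\<^sub>R cut01 g s"
      using AE_lborel_singleton[of 0] AE_lborel_singleton[of 1]
      by eventually_elim (use x in \<open>auto simp: cut01_def indicator_def\<close>)
  qed
  then show ?thesis unfolding weak_deriv01_def
    by (intro conj_cong ball_cong refl) simp
qed

lemma weak_deriv01_L2: "weak_deriv01 f g \<Longrightarrow> L2_01 g"
  by (simp add: weak_deriv01_def)

lemma weak_deriv01_eq:
  "weak_deriv01 f g \<Longrightarrow> x \<in> {0..1} \<Longrightarrow> f x = f 0 + (\<integral>s. indicator {..x} s *\<^sub>R cut01 g s \<partial>lborel)"
  unfolding weak_deriv01_iff by blast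

lemma weak_deriv01I:
  assumes "L2_01 g" "\<And>x. x \<in> {0..1} \<Longrightarrow> f x = f 0 + (\<integral>s. indicator {..x} s *\<^sub>R cut01 g s \<partial>lborel)"
  shows "weak_deriv01 f g"
  unfolding weak_deriv01_iff using assms by blast

lemma integrable_indicator_cut01:
  assumes "L2_01 g" shows "integrable lborel (\<lambda>s. indicator {..x} s *\<^sub>R cut01 g s)"
  by (rule integrable_mult_indicator[OF _ cut01_integrable[OF assms]]) simp

text \<open>Cauchy-Schwarz against the constant function 1, whose norm on the unit interval is 1.
  The vanishing value at 0 lets the derivative alone control every point value.\<close>

lemma weak_deriv01_bound:
  assumes "weak_deriv01 f g" "f 0 = 0" "x \<in> {0..1}"
  shows "norm (f x) \<le> L2norm g"
proof -
  have g: "L2_01 g" using assms by (simp add: weak_deriv01_def)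
  note [measurable] = cut01_measurable[OF g]
  have one: "L2_01 (\<lambda>_. 1::real)" "L2norm (\<lambda>_. 1::real) = 1"
  proof -
    have "(\<lambda>\<xi>. (norm (cut01 (\<lambda>_. 1::real) \<xi>))\<^sup>2) = indicat_real {0<..<1}"
      by (auto simp: cut01_def indicator_def)
    then show "L2_01 (\<lambda>_. 1::real)" "L2norm (\<lambda>_. 1::real) = 1"
      by (simp_all add: L2_01_iff L2norm_alt) (simp add: cut01_def)
  qed
  have "norm (f x) = norm (\<integral>s. indicator {..x} s *\<^sub>R cut01 g s \<partial>lborel)"
    using weak_deriv01_eq[OF assms(1,3)] assms(2) by simp
  also have "\<dots> \<le> (\<integral>s. norm (cut01 g s) * norm (cut01 (\<lambda>_. 1::real) s) \<partial>lborel)"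
  proof (rule order_trans[OF integral_norm_bound], rule Bochner_Integration.integral_mono)
    show "integrable lborel (\<lambda>s. norm (indicator {..x} s *\<^sub>R cut01 g s))"
      by (intro integrable_norm integrable_indicator_cut01[OF g])
    show "integrable lborel (\<lambda>s. norm (cut01 g s) * norm (cut01 (\<lambda>_. 1::real) s))"
      by (rule L2_prod_integrable[OF g one(1)])
  qed (auto simp: cut01_def indicator_def)
  also have "\<dots> \<le> L2norm g" using L2_prod_le[OF g one(1)] one by simp
  finally show ?thesis .
qed

lemma weak_deriv01_diff:
  assumes "weak_deriv01 f g" "weak_deriv01 f' g'"
  shows "weak_deriv01 (\<lambda>\<xi>. f \<xi> - f' \<xi>) (\<lambda>\<xi>. g \<xi> - g' \<xi>)"
proof (rule weak_deriv01I)
  note g = assms[THEN weak_deriv01_L2]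
  show "L2_01 (\<lambda>\<xi>. g \<xi> - g' \<xi>)" by (rule L2_01_diff[OF g])
  fix x :: real assume x: "x \<in> {0..1}"
  show "f x - f' x = f 0 - f' 0 + (\<integral>s. indicator {..x} s *\<^sub>R cut01 (\<lambda>\<xi>. g \<xi> - g' \<xi>) s \<partial>lborel)"
    unfolding assms[THEN weak_deriv01_eq, OF x]
    by (simp add: cut01_simps scaleR_diff_right integrable_indicator_cut01[OF g(1)] integrable_indicator_cut01[OF g(2)])
qed

lemma weak_deriv01_linear:
  assumes "linear L" "weak_deriv01 f g"
  shows "weak_deriv01 (\<lambda>\<xi>. L (f \<xi>)) (\<lambda>\<xi>. L (g \<xi>))"
proof (rule weak_deriv01I)
  note g = weak_deriv01_L2[OF assms(2)]
  show "L2_01 (\<lambda>\<xi>. L (g \<xi>))" by (rule L2_01_linear(1)[OF assms(1) g])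
  fix x :: real assume x: "x \<in> {0..1}"
  have bl: "bounded_linear L" using assms(1) by (simp add: linear_conv_bounded_linear)
  show "L (f x) = L (f 0) + (\<integral>s. indicator {..x} s *\<^sub>R cut01 (\<lambda>\<xi>. L (g \<xi>)) s \<partial>lborel)"
    unfolding weak_deriv01_eq[OF assms(2) x] linear_add[OF assms(1)] cut01_linear[OF assms(1)]
    using integral_bounded_linear[OF bl integrable_indicator_cut01[OF g, of x]] linear_scale[OF assms(1)] by simp
qed

lemma weak_deriv01_continuous:
  assumes "weak_deriv01 f g"
  shows "continuous_on {0..1} f"
proof -
  have g: "L2_01 g" using assms by (auto simp: weak_deriv01_def)
  have "set_integrable lborel {0..x} (cut01 g)" for x :: real
    unfolding set_integrable_def by (rule integrable_mult_indicator[OF _ cut01_integrable[OF g]]) simp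
  then have hk: "cut01 g integrable_on {0..x}" "(LINT s:{0..x}|lborel. cut01 g s) = integral {0..x} (cut01 g)" for x
    using set_borel_integral_eq_integral by blast+
  have eq: "f 0 + integral {0..x} (cut01 g) = f x" if "x \<in> {0..1}" for x
  proof -
    have "(\<lambda>s. indicator {..x} s *\<^sub>R cut01 g s) = (\<lambda>s. indicator {0..x} s *\<^sub>R cut01 g s)"
      by (auto simp: cut01_def indicator_def)
    then show ?thesis using hk(2)[of x] unfolding weak_deriv01_eq[OF assms that] set_lebesgue_integral_def by simp
  qed
  have "continuous_on {0..1} (\<lambda>x. f 0 + integral {0..x} (cut01 g))"
    using hk(1) by (intro continuous_intros indefinite_integral_continuous_1)
  then show ?thesis by (rule continuous_on_eq) (rule eq)
qed

lemma continuous_imp_L2_01: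
  assumes "continuous_on {0..1} f"
  shows "L2_01 f"
proof -
  have "continuous_on {0..1} (\<lambda>x. (norm (f x))\<^sup>2)" using assms by (intro continuous_intros)
  then have "set_integrable lborel {0..1} (\<lambda>x. (norm (f x))\<^sup>2)" by (rule borel_integrable_atLeastAtMost')
  then have "set_integrable lborel {0<..<1} (\<lambda>x. (norm (f x))\<^sup>2)" by (rule set_integrable_subset) auto
  moreover have "set_borel_measurable lborel {0<..<1} f"
    unfolding set_borel_measurable_def measurable_lborel2
    by (rule borel_measurable_continuous_on_indicator[OF _ continuous_on_subset[OF assms]]) auto
  ultimately show ?thesis by (simp add: L2_01_def)
qed

section \<open>The weighted energy and integration by parts\<close>

text \<open>Integration by parts for indefinite integrals of integrable functions: Fubini's theorem
  for \<open>g1 x * g2 y\<close>, with the plane split along the diagonal into two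
  half-planes.\<close>

lemma indefinite_integral_product:
  fixes g1 g2 :: "real \<Rightarrow> real"
  assumes g1: "integrable lborel g1" and g2: "integrable lborel g2"
  defines "F1 \<equiv> \<lambda>x. \<integral>s. indicator {..x} s * g1 s \<partial>lborel"
    and "F2 \<equiv> \<lambda>x. \<integral>s. indicator {..x} s * g2 s \<partial>lborel"
  shows "integrable lborel (\<lambda>s. g1 s * F2 s)" "integrable lborel (\<lambda>s. F1 s * g2 s)"
    "(\<integral>s. g1 s \<partial>lborel) * (\<integral>s. g2 s \<partial>lborel) = (\<integral>s. g1 s * F2 s \<partial>lborel) + (\<integral>s. F1 s * g2 s \<partial>lborel)"
proof -
  have [measurable]: "g1 \<in> borel_measurable borel" "g2 \<in> borel_measurable borel"
    using g1 g2 by (auto dest: borel_measurable_integrable)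
  let ?P = "lborel \<Otimes>\<^sub>M (lborel :: real measure)"
  have int: "integrable ?P (\<lambda>p. g1 (fst p) * g2 (snd p))"
  proof (rule lborel_pair.Fubini_integrable)
    show "integrable lborel (\<lambda>x. \<integral>y. norm (g1 (fst (x, y)) * g2 (snd (x, y))) \<partial>lborel)"
      using g1 by (simp add: abs_mult)
    show "AE x in lborel. integrable lborel (\<lambda>y. g1 (fst (x, y)) * g2 (snd (x, y)))"
      using g2 by simp
  qed simp
  define f1 f2 where "f1 = (\<lambda>p::real\<times>real. if snd p \<le> fst p then g1 (fst p) * g2 (snd p) else 0)"
    and "f2 = (\<lambda>p::real\<times>real. if fst p < snd p then g1 (fst p) * g2 (snd p) else 0)"
  have i1: "integrable ?P f1" and i2: "integrable ?P f2"
    by (rule Bochner_Integration.integrable_bound[OF int]; force simp: f1_def f2_def)+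
  have e1: "(\<integral>y. f1 (x, y) \<partial>lborel) = g1 x * F2 x" for x
  proof -
    have "(\<integral>y. f1 (x, y) \<partial>lborel) = (\<integral>y. g1 x * (indicator {..x} y * g2 y) \<partial>lborel)"
      by (intro Bochner_Integration.integral_cong) (auto simp: f1_def)
    then show ?thesis by (simp add: F2_def)
  qed
  have e2: "(\<integral>x. f2 (x, y) \<partial>lborel) = F1 y * g2 y" for y
  proof -
    have "(\<integral>x. f2 (x, y) \<partial>lborel) = (\<integral>x. indicator {..y} x * g1 x * g2 y \<partial>lborel)"
    proof (rule integral_cong_AE)
      show "AE x in lborel. f2 (x, y) = indicator {..y} x * g1 x * g2 y"
        \<comment> \<open>The diagonal belongs to \<open>f1\<close>; on a section of
          \<open>f2\<close> it is a single point, hence a null set.\<close>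
        using AE_lborel_singleton[of y] by eventually_elim (auto simp: f2_def indicator_def)
      show "(\<lambda>x. f2 (x, y)) \<in> borel_measurable lborel"
        unfolding f2_def fst_conv snd_conv by measurable
    qed measurable
    then show ?thesis by (simp add: F1_def)
  qed
  show "integrable lborel (\<lambda>s. g1 s * F2 s)"
    using lborel_pair.integrable_fst'[OF i1] by (simp add: e1)
  have i2': "integrable ?P (case_prod (\<lambda>x y. f2 (x, y)))" using i2 by (simp add: case_prod_eta)
  show "integrable lborel (\<lambda>s. F1 s * g2 s)"
    using lborel_pair.integrable_snd[OF i2'] by (simp add: e2)
  have "(\<integral>s. g1 s \<partial>lborel) * (\<integral>s. g2 s \<partial>lborel) = (\<integral>p. g1 (fst p) * g2 (snd p) \<partial>?P)"
    using lborel_pair.integral_fst'[OF int] by simp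
  also have "\<dots> = (\<integral>p. f1 p + f2 p \<partial>?P)"
    by (intro Bochner_Integration.integral_cong) (auto simp: f1_def f2_def)
  also have "\<dots> = integral\<^sup>L ?P f1 + integral\<^sup>L ?P f2" using i1 i2 by simp
  also have "integral\<^sup>L ?P f1 = (\<integral>s. g1 s * F2 s \<partial>lborel)"
    using lborel_pair.integral_fst'[OF i1] by (simp add: e1)
  also have "integral\<^sup>L ?P f2 = (\<integral>s. F1 s * g2 s \<partial>lborel)"
    using lborel_pair.integral_snd[OF i2'] by (simp add: e2 case_prod_eta)
  finally show "(\<integral>s. g1 s \<partial>lborel) * (\<integral>s. g2 s \<partial>lborel) = (\<integral>s. g1 s * F2 s \<partial>lborel) + (\<integral>s. F1 s * g2 s \<partial>lborel)" .
qed

text \<open>The product formula for \<open>g\<close> truncated at \<open>x\<close>, taken with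
  itself. This is the chain rule for the square of an absolutely continuous function.\<close>

lemma indefinite_integral_square:
  fixes g :: "real \<Rightarrow> real"
  assumes g: "integrable lborel g"
  defines "F \<equiv> \<lambda>x. \<integral>s. indicator {..x} s * g s \<partial>lborel"
  shows "integrable lborel (\<lambda>s. 2 * g s * F s)"
    "(\<integral>s. indicator {..x} s * (2 * g s * F s) \<partial>lborel) = (F x)\<^sup>2"
proof -
  show "integrable lborel (\<lambda>s. 2 * g s * F s)"
    using indefinite_integral_product(1)[OF g g] by (simp add: F_def mult.assoc)
  have gx: "integrable lborel (\<lambda>s. indicator {..x} s * g s)"
    using integrable_mult_indicator[OF _ g, of "{..x}"] by simp
  have trunc: "indicator {..x} s * g s * (\<integral>r. indicator {..s} r * (indicator {..x} r * g r) \<partial>lborel) = indicator {..x} s * (g s * F s)" for s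
  proof (cases "s \<le> x")
    case True
    then have "(\<lambda>r. indicator {..s} r * (indicator {..x} r * g r)) = (\<lambda>r. indicator {..s} r * g r)"
      by (auto simp: indicator_def)
    then show ?thesis by (simp add: F_def)
  qed simp
  have "(F x)\<^sup>2 = (\<integral>s. indicator {..x} s * (g s * F s) \<partial>lborel) + (\<integral>s. indicator {..x} s * (g s * F s) \<partial>lborel)"
    using indefinite_integral_product(3)[OF gx gx] trunc
    by (simp add: F_def power2_eq_square mult.commute[of "integral\<^sup>L lborel (\<lambda>r. indicator {..s} r * (indicator {..x} r * g r))" for s])
  also have "\<dots> = (\<integral>s. 2 * (indicator {..x} s * (g s * F s)) \<partial>lborel)" by simp
  finally show "(\<integral>s. indicator {..x} s * (2 * g s * F s) \<partial>lborel) = (F x)\<^sup>2"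
    by (simp add: mult_ac)
qed

text \<open>Integrating the derivative of \<open>exp (- k * \<xi>)\<close> times the square of
  \<open>f\<close> over the unit interval gives \<open>2 * wip k g f - k * wip k f f\<close> as the
  boundary value at 1, which is nonnegative. The boundary value at 0 vanishes because of
  \<open>f0\<close>.\<close>

lemma wip_weak_deriv_ge_real:
  fixes f g :: "real \<Rightarrow> real"
  assumes fg: "weak_deriv01 f g" and f0: "f 0 = 0" and k: "k \<ge> 0"
  shows "k * wip k f f \<le> 2 * wip k g f"
proof -
  note g = weak_deriv01_L2[OF fg]
  note f = continuous_imp_L2_01[OF weak_deriv01_continuous[OF fg]]
  define G where "G = cut01 g"
  have G: "integrable lborel G" unfolding G_def by (rule cut01_integrable[OF g])
  define F where "F = (\<lambda>x. \<integral>s. indicator {..x} s * G s \<partial>lborel)"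
  have Ff: "F x = f x" if "x \<in> {0..1}" for x
    using weak_deriv01_eq[OF fg that] f0 by (simp add: F_def G_def)
  \<comment> \<open>The derivative of the weight. Its indefinite integral \<open>Q\<close> is the
    weight minus 1, hence the boundary term subtracted again in the computation of the integral of
    \<open>g1 s * Q s\<close>.\<close>
  define q where "q = cut01 (\<lambda>\<xi>. - k * exp (- k * \<xi>))"
  have q: "integrable lborel q" unfolding q_def
    by (intro cut01_integrable continuous_imp_L2_01 continuous_intros)
  define Q where "Q = (\<lambda>x. \<integral>s. indicator {..x} s * q s \<partial>lborel)"
  have Qe: "Q x = exp (- k * x) - 1" if "x \<in> {0..1}" for x
  proof -
    have "weak_deriv01 (\<lambda>x. exp (- k * x)) (\<lambda>\<xi>. - k * exp (- k * \<xi>))"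
      unfolding weak_deriv01_def
    proof (intro conjI ballI)
      show "L2_01 (\<lambda>\<xi>. - k * exp (- k * \<xi>))" by (intro continuous_imp_L2_01 continuous_intros)
      fix x :: real assume "x \<in> {0..1}"
      then have "(\<integral>s. indicator {0..x} s *\<^sub>R (- k * exp (- k * s)) \<partial>lborel) = exp (- k * x) - exp (- k * 0)"
        by (intro integral_FTC_atLeastAtMost)
          (auto intro!: continuous_intros derivative_eq_intros simp: has_real_derivative_iff_has_vector_derivative[symmetric])
      then show "exp (- k * x) = exp (- k * 0) + (LINT s:{0..x}|lborel. - k * exp (- k * s))"
        by (simp add: set_lebesgue_integral_def)
    qed
    from weak_deriv01_eq[OF this that] show ?thesis by (simp add: Q_def q_def)
  qed
  \<comment> \<open>The derivative of the square of \<open>F\<close>, so that the product formula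
    for \<open>g1\<close> and \<open>q\<close> integrates by parts the weighted square.\<close>
  define g1 where "g1 = (\<lambda>s. 2 * G s * F s)"
  have g1: "integrable lborel g1" and F1: "(\<integral>s. indicator {..x} s * g1 s \<partial>lborel) = (F x)\<^sup>2" for x
    unfolding g1_def F_def using indefinite_integral_square[OF G] by auto
  have "(\<integral>s. g1 s \<partial>lborel) = (\<integral>s. indicator {..1} s * g1 s \<partial>lborel)"
    by (intro Bochner_Integration.integral_cong) (auto simp: g1_def G_def cut01_def indicator_def)
  then have t1: "(\<integral>s. g1 s \<partial>lborel) = (F 1)\<^sup>2" using F1 by simp
  have "(\<integral>s. q s \<partial>lborel) = (\<integral>s. indicator {..1} s * q s \<partial>lborel)"
    by (intro Bochner_Integration.integral_cong) (auto simp: q_def cut01_def indicator_def)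
  then have t2: "(\<integral>s. q s \<partial>lborel) = exp (- k) - 1" using Qe[of 1] by (simp add: Q_def)
  have prod: "(\<integral>s. g1 s \<partial>lborel) * (\<integral>s. q s \<partial>lborel) = (\<integral>s. g1 s * Q s \<partial>lborel) + (\<integral>s. (F s)\<^sup>2 * q s \<partial>lborel)"
    using indefinite_integral_product(3)[OF g1 q] unfolding F1 Q_def .
  have "(\<integral>s. g1 s * Q s \<partial>lborel) = (\<integral>s. 2 * (exp (- k * s) * (cut01 g s \<bullet> cut01 f s)) - g1 s \<partial>lborel)"
  proof (intro Bochner_Integration.integral_cong refl)
    show "g1 s * Q s = 2 * (exp (- k * s) * (cut01 g s \<bullet> cut01 f s)) - g1 s" for s
    proof (cases "s \<in> {0<..<1}")
      case True
      then have "Q s = exp (- k * s) - 1" "F s = f s" using Qe[of s] Ff[of s] by auto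
      with True show ?thesis by (simp add: g1_def G_def cut01_def right_diff_distrib)
    qed (simp add: g1_def G_def cut01_def)
  qed
  also have "\<dots> = 2 * wip k g f - (F 1)\<^sup>2"
    using wip_integrable[OF g f k] g1 t1 by (simp add: wip_def)
  finally have a: "(\<integral>s. g1 s * Q s \<partial>lborel) = 2 * wip k g f - (F 1)\<^sup>2" .
  have "(\<integral>s. (F s)\<^sup>2 * q s \<partial>lborel) = (\<integral>s. - k * (exp (- k * s) * (cut01 f s \<bullet> cut01 f s)) \<partial>lborel)"
  proof (intro Bochner_Integration.integral_cong refl)
    show "(F s)\<^sup>2 * q s = - k * (exp (- k * s) * (cut01 f s \<bullet> cut01 f s))" for s
      using Ff[of s] by (cases "s \<in> {0<..<1}") (auto simp: q_def cut01_def power2_eq_square)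
  qed
  also have "\<dots> = - k * wip k f f"
    using wip_integrable[OF f f k] by (simp add: wip_def)
  finally have "2 * wip k g f - k * wip k f f = (F 1)\<^sup>2 * exp (- k)"
    using prod a t1 t2 by (simp add: algebra_simps)
  moreover have "(F 1)\<^sup>2 * exp (- k) \<ge> 0" by simp
  ultimately show ?thesis by linarith
qed

lemma diagm_component [simp]: "(diagm d *v x) $ i = d $ i * x $ i"
  by (simp add: diagm_def matrix_vector_mult_def if_distrib if_distribR cong: if_cong)

lemma wip_components:
  fixes u v :: "real \<Rightarrow> real^'n"
  assumes "L2_01 u" "L2_01 v" "k \<ge> 0"
  shows "wip k u v = (\<Sum>i\<in>UNIV. wip k (\<lambda>\<xi>. u \<xi> $ i) (\<lambda>\<xi>. v \<xi> $ i))"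
proof -
  have lin: "linear (\<lambda>x::real^'n. x $ i)" for i by (rule linearI) auto
  have int: "integrable lborel (\<lambda>\<xi>. exp (- k * \<xi>) * (cut01 u \<xi> $ i * cut01 v \<xi> $ i))" for i
    using wip_integrable[OF L2_01_linear(1)[OF lin assms(1)] L2_01_linear(1)[OF lin assms(2)] assms(3), of i i]
    by (simp add: cut01_linear[OF lin])
  show ?thesis
    unfolding wip_def cut01_linear[OF lin] inner_vec_def sum_distrib_left
    using int by (subst Bochner_Integration.integral_sum) auto
qed

text \<open>A diagonal speed matrix decouples the components. Each scalar inequality is multiplied
  by its own speed, and the resulting dissipation is bounded below through the common lower bound
  \<open>l\<close>.\<close>

lemma wip_weak_deriv_ge:
  fixes f g :: "real \<Rightarrow> real^'n"
  assumes fg: "weak_deriv01 f g" and f0: "f 0 = 0" and k: "k \<ge> 0"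
    and lam: "\<And>i. l \<le> lam $ i" and l: "l \<ge> 0"
  shows "k * l * wip k f f \<le> 2 * wip k (\<lambda>\<xi>. diagm lam *v g \<xi>) f"
proof -
  note g = weak_deriv01_L2[OF fg]
  note f = continuous_imp_L2_01[OF weak_deriv01_continuous[OF fg]]
  have lin: "linear (\<lambda>x::real^'n. x $ i)" for i by (rule linearI) auto
  have Lg: "L2_01 (\<lambda>\<xi>. diagm lam *v g \<xi>)"
    by (rule L2_01_linear(1)[OF _ g]) simp
  have comp: "k * l * wip k (\<lambda>\<xi>. f \<xi> $ i) (\<lambda>\<xi>. f \<xi> $ i) \<le> 2 * (lam $ i * wip k (\<lambda>\<xi>. g \<xi> $ i) (\<lambda>\<xi>. f \<xi> $ i))" for i
  proof -
    have "k * wip k (\<lambda>\<xi>. f \<xi> $ i) (\<lambda>\<xi>. f \<xi> $ i) \<le> 2 * wip k (\<lambda>\<xi>. g \<xi> $ i) (\<lambda>\<xi>. f \<xi> $ i)"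
      by (rule wip_weak_deriv_ge_real[OF weak_deriv01_linear[OF lin fg] _ k]) (simp add: f0)
    then have "lam $ i * (k * wip k (\<lambda>\<xi>. f \<xi> $ i) (\<lambda>\<xi>. f \<xi> $ i)) \<le> lam $ i * (2 * wip k (\<lambda>\<xi>. g \<xi> $ i) (\<lambda>\<xi>. f \<xi> $ i))"
      using lam[of i] l by (intro mult_left_mono) auto
    moreover have "l * (k * wip k (\<lambda>\<xi>. f \<xi> $ i) (\<lambda>\<xi>. f \<xi> $ i)) \<le> lam $ i * (k * wip k (\<lambda>\<xi>. f \<xi> $ i) (\<lambda>\<xi>. f \<xi> $ i))"
      using lam[of i] by (intro mult_right_mono mult_nonneg_nonneg[OF k wip_nonneg]) auto
    ultimately show ?thesis by (simp add: mult_ac)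
  qed
  have "k * l * wip k f f = (\<Sum>i\<in>UNIV. k * l * wip k (\<lambda>\<xi>. f \<xi> $ i) (\<lambda>\<xi>. f \<xi> $ i))"
    by (subst wip_components[OF f f k]) (simp add: sum_distrib_left)
  also have "\<dots> \<le> (\<Sum>i\<in>UNIV. 2 * (lam $ i * wip k (\<lambda>\<xi>. g \<xi> $ i) (\<lambda>\<xi>. f \<xi> $ i)))"
    by (intro sum_mono comp)
  also have "\<dots> = 2 * wip k (\<lambda>\<xi>. diagm lam *v g \<xi>) f"
    by (subst wip_components[OF Lg f k])
      (simp add: sum_distrib_left wip_scale_left[where 'a=real, simplified])
  finally show ?thesis .
qed

section \<open>Space translation\<close>

text \<open>Translation to the right by \<open>h\<close> of the extension by zero to the left. What
  is moved beyond 1 is lost, so the L2 norm can only decrease. For \<open>f 0 = 0\<close> no jump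
  arises at \<open>h\<close>, which keeps the weak derivative free of a point mass.\<close>

definition shift01 :: "real \<Rightarrow> (real \<Rightarrow> 'a::zero) \<Rightarrow> real \<Rightarrow> 'a" where
  "shift01 h f = (\<lambda>\<xi>. if \<xi> \<le> h then 0 else f (\<xi> - h))"

lemma cut01_shift01: "h > 0 \<Longrightarrow> cut01 (shift01 h f) = (\<lambda>\<xi>. indicator {..<1} \<xi> *\<^sub>R cut01 f (\<xi> - h))"
  by (auto simp: shift01_def cut01_def indicator_def fun_eq_iff)

lemma L2_01_shift01:
  assumes "L2_01 f" "h > 0"
  shows "L2_01 (shift01 h f)" "L2norm (shift01 h f) \<le> L2norm f"
proof -
  note [measurable] = cut01_measurable[OF assms(1)]
  have sq: "integrable lborel (\<lambda>\<xi>. (norm (cut01 f \<xi>))\<^sup>2)" using assms by (simp add: L2_01_iff)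
  have i: "integrable lborel (\<lambda>\<xi>. (norm (cut01 f (\<xi> - h)))\<^sup>2)"
    using lborel_integrable_real_affine[OF sq, of 1 "-h"] by simp
  have e: "(\<integral>\<xi>. (norm (cut01 f (\<xi> - h)))\<^sup>2 \<partial>lborel) = (L2norm f)\<^sup>2"
    using lborel_integral_real_affine[of 1 "\<lambda>\<xi>. (norm (cut01 f \<xi>))\<^sup>2" "-h"] by (simp add: L2norm_power2)
  have i': "integrable lborel (\<lambda>\<xi>. (norm (indicator {..<1} \<xi> *\<^sub>R cut01 f (\<xi> - h)))\<^sup>2)"
    by (rule Bochner_Integration.integrable_bound[OF i]) (auto simp: indicator_def)
  then show "L2_01 (shift01 h f)"
    unfolding L2_01_iff cut01_shift01[OF assms(2)] by simp
  show "L2norm (shift01 h f) \<le> L2norm f"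
  proof (rule power2_le_imp_le)
    have "(L2norm (shift01 h f))\<^sup>2 \<le> (\<integral>\<xi>. (norm (cut01 f (\<xi> - h)))\<^sup>2 \<partial>lborel)"
      unfolding L2norm_power2 cut01_shift01[OF assms(2)]
      by (rule Bochner_Integration.integral_mono[OF i' i]) (auto simp: indicator_def)
    then show "(L2norm (shift01 h f))\<^sup>2 \<le> (L2norm f)\<^sup>2" by (simp add: e)
  qed simp
qed

lemma weak_deriv01_shift01:
  assumes "weak_deriv01 f g" "f 0 = 0" "h > 0"
  shows "weak_deriv01 (shift01 h f) (shift01 h g)"
proof (rule weak_deriv01I)
  note g = weak_deriv01_L2[OF assms(1)]
  note [measurable] = cut01_measurable[OF g]
  show "L2_01 (shift01 h g)" by (rule L2_01_shift01[OF g assms(3)])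
  fix x :: real assume x: "x \<in> {0..1}"
  have "(\<integral>s. indicator {..x} s *\<^sub>R cut01 (shift01 h g) s \<partial>lborel)
      = (\<integral>s. indicator {..x - h} (s - h) *\<^sub>R cut01 g (s - h) \<partial>lborel)"
  proof (rule integral_cong_AE)
    show "AE s in lborel. indicator {..x} s *\<^sub>R cut01 (shift01 h g) s = indicator {..x - h} (s - h) *\<^sub>R cut01 g (s - h)"
      using AE_lborel_singleton[of 1]
      by eventually_elim (use x in \<open>auto simp: cut01_shift01[OF assms(3)] indicator_def\<close>)
  qed (auto simp: cut01_shift01[OF assms(3)])
  also have "\<dots> = (\<integral>s. indicator {..x - h} s *\<^sub>R cut01 g s \<partial>lborel)"
    using lborel_integral_real_affine[of 1 "\<lambda>s. indicator {..x - h} s *\<^sub>R cut01 g s" "-h"] by simp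
  also have "\<dots> = shift01 h f x"
  proof (cases "x \<le> h")
    case True
    then have "(\<lambda>s. indicator {..x - h} s *\<^sub>R cut01 g s) = (\<lambda>_. 0)" by (auto simp: indicator_def cut01_def)
    then show ?thesis using True by (simp only:) (simp add: shift01_def)
  next
    case False
    then have "x - h \<in> {0..1}" using x assms(3) by auto
    from weak_deriv01_eq[OF assms(1) this] show ?thesis using False assms(2) by (simp add: shift01_def)
  qed
  finally show "shift01 h f x = shift01 h f 0 + (\<integral>s. indicator {..x} s *\<^sub>R cut01 (shift01 h g) s \<partial>lborel)"
    using assms(3) by (simp add: shift01_def)
qed

lemma AE_lborel_shift:
  fixes h :: real
  assumes "AE \<xi> in lborel. P \<xi>" shows "AE \<xi> in lborel. P (\<xi> - h)"
proof -
  have "AE \<xi> in distr lborel borel ((+) (- h)). P \<xi>" unfolding lborel_distr_plus by (rule assms)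
  from AE_distrD[OF _ this] show ?thesis by simp
qed

text \<open>The difference is the integral of \<open>g\<close> over a window of length
  \<open>h\<close> ending at \<open>\<xi>\<close>; rescaling the window to the unit interval makes
  it \<open>h\<close> times an average of translates of \<open>g\<close>.\<close>

lemma shift01_diff_average:
  assumes fg: "weak_deriv01 f g" and f0: "f 0 = 0" and h: "h > 0" and \<xi>: "\<xi> \<in> {0<..<1}"
  shows "f \<xi> - shift01 h f \<xi> = h *\<^sub>R (\<integral>u. indicator {0..<1} u *\<^sub>R cut01 g (\<xi> - h * u) \<partial>lborel)"
proof -
  note g = weak_deriv01_L2[OF fg]
  have 1: "f \<xi> = (\<integral>s. indicator {..\<xi>} s *\<^sub>R cut01 g s \<partial>lborel)"
    using weak_deriv01_eq[OF fg, of \<xi>] \<xi> f0 by simp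
  have 2: "shift01 h f \<xi> = (\<integral>s. indicator {..\<xi> - h} s *\<^sub>R cut01 g s \<partial>lborel)"
  proof (cases "\<xi> \<le> h")
    case True
    then have "(\<lambda>s. indicator {..\<xi> - h} s *\<^sub>R cut01 g s) = (\<lambda>_. 0)" by (auto simp: indicator_def cut01_def)
    then show ?thesis using True by (simp only:) (simp add: shift01_def)
  next
    case False
    then have "\<xi> - h \<in> {0..1}" using \<xi> h by auto
    from weak_deriv01_eq[OF fg this] show ?thesis using False f0 by (simp add: shift01_def)
  qed
  have "f \<xi> - shift01 h f \<xi> = (\<integral>s. indicator {..\<xi>} s *\<^sub>R cut01 g s - indicator {..\<xi> - h} s *\<^sub>R cut01 g s \<partial>lborel)"
    unfolding 1 2 using integrable_indicator_cut01[OF g] by simp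
  also have "\<dots> = (\<integral>s. indicator {\<xi> - h<..\<xi>} s *\<^sub>R cut01 g s \<partial>lborel)"
    using h by (intro Bochner_Integration.integral_cong) (auto simp: indicator_def)
  \<comment> \<open>The substitution \<open>s = \<xi> - h * u\<close> reverses orientation, so the
    window open at its left end becomes \<open>{0..<1}\<close>, open at its right end.\<close>
  also have "\<dots> = \<bar>- h\<bar> *\<^sub>R (\<integral>u. indicator {\<xi> - h<..\<xi>} (\<xi> + - h * u) *\<^sub>R cut01 g (\<xi> + - h * u) \<partial>lborel)"
    using h by (intro lborel_integral_real_affine) simp
  also have "(\<lambda>u. indicator {\<xi> - h<..\<xi>} (\<xi> + - h * u) :: real) = indicator {0..<1}"
    using h by (auto simp: indicator_def fun_eq_iff zero_le_mult_iff)
  finally show ?thesis using h by simp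
qed

text \<open>Cauchy-Schwarz bounds the squared average by the average of squares. Exchanging the
  integrals then leaves, for each \<open>u\<close>, the norm of a translate of \<open>g\<close>.
  Extended nonnegative integrals allow the exchange on measurability alone.\<close>

lemma L2norm_shift01_diff_le:
  assumes fg: "weak_deriv01 f g" and f0: "f 0 = 0" and h: "h > 0"
  shows "L2norm (\<lambda>\<xi>. f \<xi> - shift01 h f \<xi>) \<le> h * L2norm g"
proof -
  note g = weak_deriv01_L2[OF fg]
  note [measurable] = cut01_measurable[OF g]
  note f = continuous_imp_L2_01[OF weak_deriv01_continuous[OF fg]]
  note d = L2_01_diff[OF f L2_01_shift01(1)[OF f h]]
  let ?d = "\<lambda>\<xi>. f \<xi> - shift01 h f \<xi>"
  have pw: "ennreal ((norm (cut01 ?d \<xi>))\<^sup>2) \<le> ennreal (h\<^sup>2) * (\<integral>\<^sup>+u. indicator {0..<1} u * ennreal ((norm (cut01 g (\<xi> - h * u)))\<^sup>2) \<partial>lborel)" for \<xi>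
  proof (cases "\<xi> \<in> {0<..<1}")
    case True
    let ?a = "\<integral>u. indicator {0..<1} u *\<^sub>R cut01 g (\<xi> - h * u) \<partial>lborel"
    let ?g = "\<lambda>u. ennreal (norm (cut01 g (\<xi> - h * u)))"
    have "integrable lborel (\<lambda>u. cut01 g (\<xi> + (- h) * u))"
      using h by (intro lborel_integrable_real_affine cut01_integrable[OF g]) simp
    then have int: "integrable lborel (\<lambda>u. indicator {0..<1} u *\<^sub>R cut01 g (\<xi> - h * u))"
      by (intro integrable_mult_indicator) auto
    have "ennreal (norm ?a) \<le> (\<integral>\<^sup>+u. norm (indicator {0..<1} u *\<^sub>R cut01 g (\<xi> - h * u)) \<partial>lborel)"
      by (rule integral_norm_bound_ennreal[OF int])
    also have "\<dots> = (\<integral>\<^sup>+u. indicator {0..<1} u * (indicator {0..<1} u * ?g u) \<partial>lborel)"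
      by (intro nn_integral_cong) (auto simp: indicator_def)
    finally have "(ennreal (norm ?a))\<^sup>2 \<le> (\<integral>\<^sup>+u. indicator {0..<1} u * (indicator {0..<1} u * ?g u) \<partial>lborel)\<^sup>2"
      by (intro power_mono) auto
    also have "\<dots> \<le> (\<integral>\<^sup>+u. (indicator {0..<1} (u::real))\<^sup>2 \<partial>lborel) * (\<integral>\<^sup>+u. (indicator {0..<1} u * ?g u)\<^sup>2 \<partial>lborel)"
      by (rule Cauchy_Schwarz_nn_integral) measurable
    also have "(\<integral>\<^sup>+u. (indicator {0..<1} (u::real))\<^sup>2 \<partial>lborel) = (\<integral>\<^sup>+u. indicator {0..<1} (u::real) \<partial>lborel)"
      by (intro nn_integral_cong) (auto simp: indicator_def)
    also have "\<dots> = 1" by simp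
    also have "(\<integral>\<^sup>+u. (indicator {0..<1} u * ?g u)\<^sup>2 \<partial>lborel) = (\<integral>\<^sup>+u. indicator {0..<1} u * ennreal ((norm (cut01 g (\<xi> - h * u)))\<^sup>2) \<partial>lborel)"
      by (intro nn_integral_cong) (auto simp: indicator_def ennreal_power)
    finally have "ennreal ((norm ?a)\<^sup>2) \<le> (\<integral>\<^sup>+u. indicator {0..<1} u * ennreal ((norm (cut01 g (\<xi> - h * u)))\<^sup>2) \<partial>lborel)"
      by (simp add: ennreal_power)
    then have "ennreal (h\<^sup>2) * ennreal ((norm ?a)\<^sup>2) \<le> ennreal (h\<^sup>2) * (\<integral>\<^sup>+u. indicator {0..<1} u * ennreal ((norm (cut01 g (\<xi> - h * u)))\<^sup>2) \<partial>lborel)"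
      by (intro mult_left_mono) auto
    moreover have "norm (cut01 ?d \<xi>) = h * norm ?a"
      using True shift01_diff_average[OF fg f0 h True] h by (simp add: cut01_def)
    ultimately show ?thesis by (simp add: power_mult_distrib ennreal_mult)
  qed (simp add: cut01_def)
  have sq: "integrable lborel (\<lambda>\<xi>. (norm (cut01 g \<xi>))\<^sup>2)" using g by (simp add: L2_01_iff)
  have inner: "(\<integral>\<^sup>+\<xi>. ennreal ((norm (cut01 g (\<xi> - h * u)))\<^sup>2) \<partial>lborel) = ennreal ((L2norm g)\<^sup>2)" for u
  proof -
    have "integrable lborel (\<lambda>\<xi>. (norm (cut01 g (- (h * u) + 1 * \<xi>)))\<^sup>2)"
      by (rule lborel_integrable_real_affine[OF sq]) simp
    then have "(\<integral>\<^sup>+\<xi>. ennreal ((norm (cut01 g (\<xi> - h * u)))\<^sup>2) \<partial>lborel) = ennreal (\<integral>\<xi>. (norm (cut01 g (\<xi> - h * u)))\<^sup>2 \<partial>lborel)"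
      by (intro nn_integral_eq_integral) auto
    also have "(\<integral>\<xi>. (norm (cut01 g (\<xi> - h * u)))\<^sup>2 \<partial>lborel) = (L2norm g)\<^sup>2"
      using lborel_integral_real_affine[of 1 "\<lambda>\<xi>. (norm (cut01 g \<xi>))\<^sup>2" "- (h * u)"] by (simp add: L2norm_power2)
    finally show ?thesis .
  qed
  have "ennreal ((L2norm ?d)\<^sup>2) = (\<integral>\<^sup>+\<xi>. ennreal ((norm (cut01 ?d \<xi>))\<^sup>2) \<partial>lborel)"
    unfolding L2norm_power2 using d by (intro nn_integral_eq_integral[symmetric]) (auto simp: L2_01_iff)
  also have "\<dots> \<le> (\<integral>\<^sup>+\<xi>. ennreal (h\<^sup>2) * (\<integral>\<^sup>+u. indicator {0..<1} u * ennreal ((norm (cut01 g (\<xi> - h * u)))\<^sup>2) \<partial>lborel) \<partial>lborel)"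
    by (intro nn_integral_mono pw)
  also have "\<dots> = ennreal (h\<^sup>2) * (\<integral>\<^sup>+\<xi>. \<integral>\<^sup>+u. indicator {0..<1} u * ennreal ((norm (cut01 g (\<xi> - h * u)))\<^sup>2) \<partial>lborel \<partial>lborel)"
    by (rule nn_integral_cmult) measurable
  also have "(\<integral>\<^sup>+\<xi>. \<integral>\<^sup>+u. indicator {0..<1} u * ennreal ((norm (cut01 g (\<xi> - h * u)))\<^sup>2) \<partial>lborel \<partial>lborel)
     = (\<integral>\<^sup>+u. \<integral>\<^sup>+\<xi>. indicator {0..<1} u * ennreal ((norm (cut01 g (\<xi> - h * u)))\<^sup>2) \<partial>lborel \<partial>lborel)"
    by (rule lborel_pair.Fubini') measurable
  also have "\<dots> = (\<integral>\<^sup>+u. indicator {0..<1} (u::real) * ennreal ((L2norm g)\<^sup>2) \<partial>lborel)"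
    by (subst nn_integral_cmult) (auto simp: inner)
  also have "\<dots> = ennreal ((L2norm g)\<^sup>2)"
    by (subst nn_integral_multc) auto
  finally have "(L2norm ?d)\<^sup>2 \<le> h\<^sup>2 * (L2norm g)\<^sup>2"
    by (simp add: ennreal_mult[symmetric] ennreal_le_iff)
  then have "(L2norm ?d)\<^sup>2 \<le> (h * L2norm g)\<^sup>2" by (simp add: power_mult_distrib)
  then show ?thesis by (rule power2_le_imp_le) (use h in simp)
qed

text \<open>Weak convergence of the difference quotients to \<open>g\<close>. As \<open>g\<close>
  need not be continuous, the translation is moved onto the test function, where continuity gives
  pointwise convergence and \<open>B * norm (cut01 g x)\<close> dominates.\<close>

lemma shift01_difference_quotient_test:
  fixes f g \<eta> :: "real \<Rightarrow> 'a::euclidean_space"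
  assumes fg: "weak_deriv01 f g" and f0: "f 0 = 0"
    and cont: "continuous_on UNIV \<eta>" and B: "\<And>x. norm (\<eta> x) \<le> B"
  shows "(\<lambda>n. wip 0 (\<lambda>\<xi>. (1 / inverse (real (Suc n))) *\<^sub>R (f \<xi> - shift01 (inverse (real (Suc n))) f \<xi>)) \<eta>)
      \<longlonglongrightarrow> wip 0 g \<eta>"
proof -
  note g = weak_deriv01_L2[OF fg]
  have [measurable]: "\<eta> \<in> borel_measurable borel" by (rule borel_measurable_continuous_onI[OF cont])
  note [measurable] = cut01_measurable[OF g]
  have cm[measurable]: "cut01 \<eta> \<in> borel_measurable borel" unfolding cut01_def by measurable
  have B0: "B \<ge> 0" using B[of 0] norm_ge_zero order_trans by blast
  have cB: "norm (cut01 \<eta> x) \<le> B" for x using B[of x] B0 by (auto simp: cut01_def indicator_def)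
  let ?P = "lborel \<Otimes>\<^sub>M (lborel :: real measure)"
  \<comment> \<open>\<open>\<Phi>\<close> carries the translation on the test function,
    \<open>\<Psi>\<close> on \<open>g\<close>, and \<open>\<Phi>0\<close> is the limit. For each
    \<open>u\<close> the first two differ by the change of variable \<open>s + h * u\<close>, so
    their integrals agree.\<close>
  define \<Phi> where "\<Phi> = (\<lambda>h p. indicat_real {0..<1} (fst p) * (cut01 g (snd p) \<bullet> cut01 \<eta> (snd p + h * fst p)))"
  define \<Psi> where "\<Psi> = (\<lambda>h p. indicat_real {0..<1} (fst p) * (cut01 g (snd p - h * fst p) \<bullet> cut01 \<eta> (snd p)))"
  define \<Phi>0 where "\<Phi>0 = (\<lambda>p::real\<times>real. indicat_real {0..<1} (fst p) * (cut01 g (snd p) \<bullet> cut01 \<eta> (snd p)))"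
  have [measurable]: "\<Phi> h \<in> borel_measurable ?P" "\<Psi> h \<in> borel_measurable ?P" "\<Phi>0 \<in> borel_measurable ?P" for h
    unfolding \<Phi>_def \<Psi>_def \<Phi>0_def by measurable
  have gi: "integrable lborel (\<lambda>x. norm (cut01 g x))" using cut01_integrable[OF g] by simp
  have ipb: "\<bar>x \<bullet> cut01 \<eta> y\<bar> \<le> B * norm x" for x :: 'a and y
  proof -
    have "\<bar>x \<bullet> cut01 \<eta> y\<bar> \<le> norm x * norm (cut01 \<eta> y)" by (rule Cauchy_Schwarz_ineq2)
    also have "\<dots> \<le> norm x * B" by (intro mult_left_mono cB) auto
    finally show ?thesis by (simp add: mult.commute)
  qed
  have gs: "integrable lborel (\<lambda>x. norm (cut01 g (x - c)))" "(\<integral>x. norm (cut01 g (x - c)) \<partial>lborel) = (\<integral>x. norm (cut01 g x) \<partial>lborel)" for c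
    using lborel_integrable_real_affine[OF gi, of 1 "-c"] lborel_integral_real_affine[of 1 "\<lambda>x. norm (cut01 g x)" "-c"]
    by simp_all
  have dom: "integrable ?P (\<lambda>p. indicat_real {0..<1} (fst p) * (B * norm (cut01 g (snd p - h * fst p))))" for h
  proof (rule lborel_pair.Fubini_integrable)
    have "(\<lambda>x. \<integral>y. norm (indicat_real {0..<1} (fst (x, y)) * (B * norm (cut01 g (snd (x, y) - h * fst (x, y))))) \<partial>lborel)
       = (\<lambda>x. indicat_real {0..<1} x * (B * (\<integral>y. norm (cut01 g y) \<partial>lborel)))"
      using B0 by (simp add: abs_mult gs)
    then show "integrable lborel (\<lambda>x. \<integral>y. norm (indicat_real {0..<1} (fst (x, y)) * (B * norm (cut01 g (snd (x, y) - h * fst (x, y))))) \<partial>lborel)"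
      by simp
    show "AE x in lborel. integrable lborel (\<lambda>y. indicat_real {0..<1} (fst (x, y)) * (B * norm (cut01 g (snd (x, y) - h * fst (x, y)))))"
      using gs by simp
  qed measurable
  have \<Psi>i: "integrable ?P (\<Psi> h)" for h
  proof (rule Bochner_Integration.integrable_bound[OF dom[of h]])
    show "AE x in ?P. norm (\<Psi> h x) \<le> norm (indicat_real {0..<1} (fst x) * (B * norm (cut01 g (snd x - h * fst x))))"
      using B0 ipb by (intro AE_I2) (auto simp: \<Psi>_def indicator_def)
  qed measurable
  have \<Phi>b: "norm (\<Phi> h p) \<le> indicat_real {0..<1} (fst p) * (B * norm (cut01 g (snd p)))" for h p
    using B0 ipb by (auto simp: \<Phi>_def indicator_def)
  have dom0: "integrable ?P (\<lambda>p::real\<times>real. indicat_real {0..<1} (fst p) * (B * norm (cut01 g (snd p))))"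
    using dom[of 0] by simp
  have \<Phi>i: "integrable ?P (\<Phi> h)" for h
    by (rule Bochner_Integration.integrable_bound[OF dom0]) (use \<Phi>b[of h] in \<open>auto intro!: AE_I2 intro: order_trans[OF _ abs_ge_self]\<close>)
  have \<Phi>\<Psi>: "integral\<^sup>L ?P (\<Phi> h) = integral\<^sup>L ?P (\<Psi> h)" for h
  proof -
    have "integral\<^sup>L ?P (\<Phi> h) = (\<integral>u. \<integral>s. \<Phi> h (u, s) \<partial>lborel \<partial>lborel)"
      using lborel_pair.integral_fst'[OF \<Phi>i] by simp
    also have "\<dots> = (\<integral>u. \<integral>s. \<Psi> h (u, s) \<partial>lborel \<partial>lborel)"
    proof (rule Bochner_Integration.integral_cong[OF refl])
      show "(\<integral>s. \<Phi> h (u, s) \<partial>lborel) = (\<integral>s. \<Psi> h (u, s) \<partial>lborel)" for u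
        using lborel_integral_real_affine[of 1 "\<lambda>s. \<Psi> h (u, s)" "h * u"]
        by (auto simp: \<Phi>_def \<Psi>_def add.commute)
    qed
    also have "\<dots> = integral\<^sup>L ?P (\<Psi> h)" using lborel_pair.integral_fst'[OF \<Psi>i] by simp
    finally show ?thesis .
  qed
  \<comment> \<open>Integrating over \<open>u\<close> first turns \<open>\<Psi>\<close> into the
    average of translates of \<open>g\<close>, that is, into the difference quotient of
    \<open>f\<close>.\<close>
  have \<Psi>q: "integral\<^sup>L ?P (\<Psi> h) = wip 0 (\<lambda>\<xi>. (1 / h) *\<^sub>R (f \<xi> - shift01 h f \<xi>)) \<eta>" if h: "h > 0" for h
  proof -
    have "integrable ?P (case_prod (\<lambda>x y. \<Psi> h (x, y)))" using \<Psi>i by (simp add: case_prod_eta)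
    from lborel_pair.integral_snd[OF this]
    have "integral\<^sup>L ?P (\<Psi> h) = (\<integral>\<xi>. \<integral>u. \<Psi> h (u, \<xi>) \<partial>lborel \<partial>lborel)"
      by (simp add: case_prod_eta)
    also have "\<dots> = wip 0 (\<lambda>\<xi>. (1 / h) *\<^sub>R (f \<xi> - shift01 h f \<xi>)) \<eta>"
      unfolding wip_def
    proof (rule Bochner_Integration.integral_cong[OF refl])
      fix \<xi>
      show "(\<integral>u. \<Psi> h (u, \<xi>) \<partial>lborel) = exp (- 0 * \<xi>) * (cut01 (\<lambda>\<xi>. (1 / h) *\<^sub>R (f \<xi> - shift01 h f \<xi>)) \<xi> \<bullet> cut01 \<eta> \<xi>)"
      proof (cases "\<xi> \<in> {0<..<1}")
        case True
        have "integrable lborel (\<lambda>u. cut01 g (\<xi> + (- h) * u))"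
          using h by (intro lborel_integrable_real_affine cut01_integrable[OF g]) simp
        then have int: "integrable lborel (\<lambda>u. indicat_real {0..<1} u *\<^sub>R cut01 g (\<xi> - h * u))"
          by (intro integrable_mult_indicator) auto
        have "(\<integral>u. \<Psi> h (u, \<xi>) \<partial>lborel) = (\<integral>u. (indicat_real {0..<1} u *\<^sub>R cut01 g (\<xi> - h * u)) \<bullet> cut01 \<eta> \<xi> \<partial>lborel)"
          by (simp add: \<Psi>_def)
        also have "\<dots> = (\<integral>u. indicat_real {0..<1} u *\<^sub>R cut01 g (\<xi> - h * u) \<partial>lborel) \<bullet> cut01 \<eta> \<xi>"
          using int by (intro integral_inner_left) auto
        also have "(\<integral>u. indicat_real {0..<1} u *\<^sub>R cut01 g (\<xi> - h * u) \<partial>lborel) = cut01 (\<lambda>\<xi>. (1 / h) *\<^sub>R (f \<xi> - shift01 h f \<xi>)) \<xi>"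
          using shift01_diff_average[OF fg f0 h True] h True by (simp add: cut01_def)
        finally show ?thesis by simp
      qed (simp add: \<Psi>_def cut01_def)
    qed
    finally show ?thesis .
  qed
  have "(\<lambda>n. integral\<^sup>L ?P (\<Phi> (inverse (real (Suc n))))) \<longlonglongrightarrow> integral\<^sup>L ?P \<Phi>0"
  proof (rule integral_dominated_convergence[OF _ _ dom0])
    show "AE p in ?P. (\<lambda>n. \<Phi> (inverse (real (Suc n))) p) \<longlonglongrightarrow> \<Phi>0 p"
    proof (rule AE_I2)
      fix p :: "real \<times> real"
      show "(\<lambda>n. \<Phi> (inverse (real (Suc n))) p) \<longlonglongrightarrow> \<Phi>0 p"
      \<comment> \<open>\<open>cut01 \<eta>\<close> may jump at 0 and 1. At an interior point the
        translates are eventually interior too; elsewhere the factor \<open>cut01 g (snd p)\<close>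
        is zero.\<close>
      proof (cases "snd p \<in> {0<..<1}")
        case True
        have lim: "(\<lambda>n. snd p + inverse (real (Suc n)) * fst p) \<longlonglongrightarrow> snd p + 0 * fst p"
          by (intro tendsto_intros LIMSEQ_inverse_real_of_nat)
        then have lim: "(\<lambda>n. snd p + inverse (real (Suc n)) * fst p) \<longlonglongrightarrow> snd p" by simp
        have "isCont \<eta> (snd p)" using cont by (simp add: continuous_on_eq_continuous_at)
        then have lim2: "(\<lambda>n. \<eta> (snd p + inverse (real (Suc n)) * fst p)) \<longlonglongrightarrow> \<eta> (snd p)"
          using lim by (rule isCont_tendsto_compose)
        have "\<forall>\<^sub>F n in sequentially. snd p + inverse (real (Suc n)) * fst p \<in> {0<..<1}"
          using lim True by (rule topological_tendstoD[OF _ open_greaterThanLessThan])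
        then have "\<forall>\<^sub>F n in sequentially. \<eta> (snd p + inverse (real (Suc n)) * fst p) = cut01 \<eta> (snd p + inverse (real (Suc n)) * fst p)"
          by eventually_elim (simp add: cut01_def)
        then have "(\<lambda>n. cut01 \<eta> (snd p + inverse (real (Suc n)) * fst p)) \<longlonglongrightarrow> cut01 \<eta> (snd p)"
          using Lim_transform_eventually[OF lim2] True by (simp add: cut01_def)
        then show ?thesis unfolding \<Phi>_def \<Phi>0_def by (intro tendsto_intros)
      qed (simp add: \<Phi>_def \<Phi>0_def cut01_def)
    qed
  qed (use \<Phi>b in auto)
  moreover have "integral\<^sup>L ?P \<Phi>0 = wip 0 g \<eta>"
  proof -
    have "\<Phi>0 = \<Phi> 0" by (simp add: \<Phi>_def \<Phi>0_def)
    then have "integral\<^sup>L ?P \<Phi>0 = (\<integral>u. \<integral>s. \<Phi>0 (u, s) \<partial>lborel \<partial>lborel)"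
      using lborel_pair.integral_fst'[OF \<Phi>i[of 0]] by simp
    then show ?thesis by (simp add: \<Phi>0_def wip_def)
  qed
  ultimately show ?thesis by (simp add: \<Phi>\<Psi> \<Psi>q del: inverse_eq_divide)
qed


text \<open>Lower semicontinuity: the difference quotients are tested against continuous functions
  approximating a truncation of \<open>g\<close>.\<close>
lemma L2norm_le_of_shift01_diff:
  fixes f g :: "real \<Rightarrow> 'a::euclidean_space"
  assumes fg: "weak_deriv01 f g" and f0: "f 0 = 0"
    and C: "\<And>h. h > 0 \<Longrightarrow> L2norm (\<lambda>\<xi>. f \<xi> - shift01 h f \<xi>) \<le> C * h"
  shows "L2norm g \<le> C"
proof -
  note g = weak_deriv01_L2[OF fg]
  note [measurable] = cut01_measurable[OF g]
  note f = continuous_imp_L2_01[OF weak_deriv01_continuous[OF fg]]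
  have C0: "C \<ge> 0" using C[of 1] order_trans[OF L2norm_nonneg] by fastforce
  have sq: "integrable lborel (\<lambda>\<xi>. (norm (cut01 g \<xi>))\<^sup>2)" using g by (simp add: L2_01_iff)
  have test: "wip 0 g \<eta> \<le> C * L2norm \<eta>"
    if cont: "continuous_on UNIV \<eta>" and B: "\<And>x. norm (\<eta> x) \<le> B" for \<eta> :: "real \<Rightarrow> 'a" and B
  proof (rule LIMSEQ_le_const2[OF shift01_difference_quotient_test[OF fg f0 cont B]])
    have \<eta>: "L2_01 \<eta>" by (rule continuous_imp_L2_01[OF continuous_on_subset[OF cont]]) simp
    have "wip 0 (\<lambda>\<xi>. (1 / inverse (real (Suc n))) *\<^sub>R (f \<xi> - shift01 (inverse (real (Suc n))) f \<xi>)) \<eta> \<le> C * L2norm \<eta>" for n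
    proof -
      let ?h = "inverse (real (Suc n))"
      have h: "?h > 0" by simp
      note d = L2_01_diff[OF f L2_01_shift01(1)[OF f h]]
      have "wip 0 (\<lambda>\<xi>. (1 / ?h) *\<^sub>R (f \<xi> - shift01 ?h f \<xi>)) \<eta> = (1 / ?h) * wip 0 (\<lambda>\<xi>. f \<xi> - shift01 ?h f \<xi>) \<eta>"
        by (rule wip_scale_left)
      also have "\<dots> \<le> (1 / ?h) * (C * ?h * L2norm \<eta>)"
      proof (intro mult_left_mono)
        have "wip 0 (\<lambda>\<xi>. f \<xi> - shift01 ?h f \<xi>) \<eta> \<le> L2norm (\<lambda>\<xi>. f \<xi> - shift01 ?h f \<xi>) * L2norm \<eta>"
          using wip_Cauchy_Schwarz[OF d \<eta>, of 0] by simp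
        also have "\<dots> \<le> C * ?h * L2norm \<eta>" by (intro mult_right_mono C h) simp
        finally show "wip 0 (\<lambda>\<xi>. f \<xi> - shift01 ?h f \<xi>) \<eta> \<le> C * ?h * L2norm \<eta>" .
      qed (use h in simp)
      also have "\<dots> = C * L2norm \<eta>" using h by (simp add: field_simps del: of_nat_Suc)
      finally show ?thesis .
    qed
    then show "\<exists>N. \<forall>n\<ge>N. wip 0 (\<lambda>\<xi>. (1 / inverse (real (Suc n))) *\<^sub>R (f \<xi> - shift01 (inverse (real (Suc n))) f \<xi>)) \<eta> \<le> C * L2norm \<eta>"
      by blast
  qed
  \<comment> \<open>\<open>g\<close> itself need not be bounded, so it is cut off at height
    \<open>N\<close>; the cutoff is removed at the end by dominated convergence.\<close>
  define gt where "gt = (\<lambda>(N::nat) \<xi>. if norm (cut01 g \<xi>) \<le> real N then cut01 g \<xi> else 0)"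
  have [measurable]: "gt N \<in> borel_measurable borel" for N unfolding gt_def by measurable
  have gt_le: "norm (gt N \<xi>) \<le> norm (cut01 g \<xi>)" "norm (gt N \<xi>) \<le> real N"
    "gt N \<xi> \<noteq> 0 \<Longrightarrow> \<xi> \<in> {0<..<1}" for N \<xi>
    by (auto simp: gt_def cut01_def indicator_def split: if_splits)
  have trunc: "(\<integral>\<xi>. (norm (gt N \<xi>))\<^sup>2 \<partial>lborel) \<le> C\<^sup>2" for N
  proof -
    let ?I = "\<integral>\<xi>. (norm (gt N \<xi>))\<^sup>2 \<partial>lborel"
    have "gt N \<in> borel_measurable lebesgue" by (rule measurable_completion) simp
    then have "gt N measurable_on UNIV" by (rule lebesgue_measurable_imp_measurable_on) simp
    then obtain S e where S: "negligible S" and e: "\<And>n. continuous_on UNIV (e n)"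
      and lim: "\<And>x. x \<notin> S \<Longrightarrow> (\<lambda>n. e n x) \<longlonglongrightarrow> gt N x"
      unfolding measurable_on_def by auto
    \<comment> \<open>The continuous approximants may be unbounded. Projecting them onto the ball of
      radius \<open>N\<close> preserves continuity, supplies a uniform bound, and does not change
      the limit, which already lies in the ball.\<close>
    define \<eta> where "\<eta> = (\<lambda>n::nat. \<lambda>x. closest_point (cball (0::'a) (real N)) (e n x))"
    have cont: "continuous_on UNIV (\<eta> n)" for n unfolding \<eta>_def
      by (rule continuous_on_compose2[OF continuous_on_closest_point[of "cball 0 (real N)"] e]) auto
    have bd: "norm (\<eta> n x) \<le> real N" for n x
      using closest_point_in_set[of "cball (0::'a) (real N)" "e n x"] by (simp add: \<eta>_def)
    have [measurable]: "\<eta> n \<in> borel_measurable borel" for n by (rule borel_measurable_continuous_onI[OF cont])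
    have ae: "AE x in lborel. x \<notin> S"
    proof -
      have "S \<in> null_sets lebesgue" using S by (simp add: negligible_iff_null_sets)
      then have "AE x in lebesgue. x \<notin> S" by (rule AE_not_in)
      then show ?thesis by (simp add: AE_completion_iff)
    qed
    have lim\<eta>: "(\<lambda>n. \<eta> n x) \<longlonglongrightarrow> gt N x" if "x \<notin> S" for x
    proof -
      have "isCont (closest_point (cball (0::'a) (real N))) (gt N x)"
        by (rule continuous_at_closest_point) auto
      then have "(\<lambda>n. \<eta> n x) \<longlonglongrightarrow> closest_point (cball 0 (real N)) (gt N x)"
        unfolding \<eta>_def using lim[OF that] by (rule isCont_tendsto_compose)
      then show ?thesis using gt_le(2)[of N x] by (simp add: closest_point_self)
    qed
    have lim_cut: "(\<lambda>n. cut01 (\<eta> n) x) \<longlonglongrightarrow> gt N x" if "x \<notin> S" for x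
      proof (cases "x \<in> {0<..<1}")
      case False
      then have "gt N x = 0" using gt_le(3) by blast
      with False show ?thesis by (simp add: cut01_def)
    qed (use lim\<eta>[OF that] in \<open>simp add: cut01_def\<close>)
    have cbd: "norm (cut01 (\<eta> n) x) \<le> indicator {0<..<1} x * real N" for n x
      using bd by (auto simp: cut01_def indicator_def)
    have [measurable]: "cut01 (\<eta> n) \<in> borel_measurable borel" for n unfolding cut01_def by measurable
    have 1: "(\<lambda>n. wip 0 g (\<eta> n)) \<longlonglongrightarrow> (\<integral>x. cut01 g x \<bullet> gt N x \<partial>lborel)"
      unfolding wip_def
    proof (rule integral_dominated_convergence)
      show "integrable lborel (\<lambda>x. norm (cut01 g x) * real N)" using cut01_integrable[OF g] by simp
      show "AE x in lborel. (\<lambda>n. exp (- 0 * x) * (cut01 g x \<bullet> cut01 (\<eta> n) x)) \<longlonglongrightarrow> cut01 g x \<bullet> gt N x"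
        using ae
      proof eventually_elim
        case (elim x)
        then show ?case using tendsto_inner[OF tendsto_const lim_cut[OF elim], of "cut01 g x"] by simp
      qed
      show "AE x in lborel. norm (exp (- 0 * x) * (cut01 g x \<bullet> cut01 (\<eta> n) x)) \<le> norm (cut01 g x) * real N" for n
      proof (rule AE_I2)
        fix x
        have "norm (exp (- 0 * x) * (cut01 g x \<bullet> cut01 (\<eta> n) x)) \<le> norm (cut01 g x) * norm (cut01 (\<eta> n) x)"
          using Cauchy_Schwarz_ineq2 by simp
        also have "\<dots> \<le> norm (cut01 g x) * real N"
          using order_trans[OF cbd[of n x], of "real N"] by (intro mult_left_mono) (auto simp: indicator_def)
        finally show "norm (exp (- 0 * x) * (cut01 g x \<bullet> cut01 (\<eta> n) x)) \<le> norm (cut01 g x) * real N" .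
      qed
    qed measurable
    have "(\<lambda>n. (\<integral>x. (norm (cut01 (\<eta> n) x))\<^sup>2 \<partial>lborel)) \<longlonglongrightarrow> ?I"
    proof (rule integral_dominated_convergence)
      show "integrable lborel (\<lambda>x::real. indicator {0<..<1} x * (real N)\<^sup>2)"
        by simp
      show "AE x in lborel. (\<lambda>n. (norm (cut01 (\<eta> n) x))\<^sup>2) \<longlonglongrightarrow> (norm (gt N x))\<^sup>2"
        using ae by eventually_elim (intro tendsto_intros lim_cut)
      show "AE x in lborel. norm ((norm (cut01 (\<eta> n) x))\<^sup>2) \<le> indicator {0<..<1} x * (real N)\<^sup>2" for n
      proof (rule AE_I2)
        fix x
        have "(norm (cut01 (\<eta> n) x))\<^sup>2 \<le> (indicator {0<..<1} x * real N)\<^sup>2" by (intro power_mono cbd) simp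
        also have "\<dots> = indicator {0<..<1} x * (real N)\<^sup>2" by (simp add: indicator_def)
        finally show "norm ((norm (cut01 (\<eta> n) x))\<^sup>2) \<le> indicator {0<..<1} x * (real N)\<^sup>2"
          by (simp only: real_norm_def abs_power2)
      qed
    qed measurable
    then have 2: "(\<lambda>n. L2norm (\<eta> n)) \<longlonglongrightarrow> sqrt ?I" unfolding L2norm_alt by (intro tendsto_intros)
    \<comment> \<open>Both sides of the tested inequality pass to the limit. The left one is
      \<open>?I\<close> itself because \<open>gt N\<close> is either \<open>cut01 g\<close> or 0,
      and dividing by \<open>sqrt ?I\<close> gives the bound.\<close>
    have "(\<integral>x. cut01 g x \<bullet> gt N x \<partial>lborel) \<le> C * sqrt ?I"
      by (rule LIMSEQ_le[OF 1 tendsto_mult[OF tendsto_const 2]]) (use test[OF cont bd] in blast)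
    moreover have "(\<integral>x. cut01 g x \<bullet> gt N x \<partial>lborel) = ?I"
      by (intro Bochner_Integration.integral_cong) (auto simp: gt_def dot_square_norm)
    moreover have I0: "?I \<ge> 0" by (intro Bochner_Integration.integral_nonneg) simp
    ultimately have le: "sqrt ?I * sqrt ?I \<le> C * sqrt ?I" by simp
    have "sqrt ?I \<le> C"
    proof (cases "?I = 0")
      case False
      have "sqrt ?I > 0" unfolding real_sqrt_gt_0_iff by (rule le_neq_trans[OF I0 False[symmetric]])
      with le show ?thesis by (rule mult_right_le_imp_le)
    qed (use C0 in simp)
    then show ?thesis by (rule sqrt_le_D)
  qed
  have "(\<lambda>N. \<integral>\<xi>. (norm (gt N \<xi>))\<^sup>2 \<partial>lborel) \<longlonglongrightarrow> (\<integral>\<xi>. (norm (cut01 g \<xi>))\<^sup>2 \<partial>lborel)"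
  proof (rule integral_dominated_convergence[OF _ _ sq])
    show "AE \<xi> in lborel. (\<lambda>N. (norm (gt N \<xi>))\<^sup>2) \<longlonglongrightarrow> (norm (cut01 g \<xi>))\<^sup>2"
    proof (rule AE_I2)
      fix \<xi>
      obtain N0 where N0: "norm (cut01 g \<xi>) \<le> real N0" using real_arch_simple by blast
      have "\<forall>\<^sub>F N in sequentially. (norm (cut01 g \<xi>))\<^sup>2 = (norm (gt N \<xi>))\<^sup>2"
        using eventually_ge_at_top[of N0] by eventually_elim (use N0 in \<open>auto simp: gt_def\<close>)
      then show "(\<lambda>N. (norm (gt N \<xi>))\<^sup>2) \<longlonglongrightarrow> (norm (cut01 g \<xi>))\<^sup>2"
        by (rule Lim_transform_eventually[OF tendsto_const])
    qed
    show "AE \<xi> in lborel. norm ((norm (gt N \<xi>))\<^sup>2) \<le> (norm (cut01 g \<xi>))\<^sup>2" for N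
      using gt_le(1) by (intro AE_I2) (simp add: power_mono)
  qed measurable
  then have "(\<integral>\<xi>. (norm (cut01 g \<xi>))\<^sup>2 \<partial>lborel) \<le> C\<^sup>2"
    by (rule LIMSEQ_le_const2) (use trunc in blast)
  then have "(L2norm g)\<^sup>2 \<le> C\<^sup>2" by (simp add: L2norm_power2)
  then show ?thesis using C0 by (rule power2_le_imp_le)
qed

section \<open>The transport equation\<close>

lemma wip_add_scale:
  assumes a: "L2_01 a" and D: "L2_01 D" and k: "k \<ge> 0"
  shows "wip k (\<lambda>\<xi>. a \<xi> + c *\<^sub>R D \<xi>) (\<lambda>\<xi>. a \<xi> + c *\<^sub>R D \<xi>) = wip k a a + 2 * c * wip k D a + c * (c * wip k D D)"
proof -
  let ?u = "\<lambda>\<xi>. a \<xi> + c *\<^sub>R D \<xi>"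
  note cD = L2_01_scale[OF D, of c]
  have 1: "wip k ?u v = wip k a v + c * wip k D v" if "L2_01 v" for v
    by (simp only: wip_add_left[OF a cD that k] wip_scale_left)
  show ?thesis
    using 1[OF L2_01_add[OF a cD]] 1[OF a] 1[OF D]
    unfolding wip_commute[of k a ?u] wip_commute[of k D ?u] wip_commute[of k a D]
    by (simp add: algebra_simps)
qed

text \<open>With \<open>D\<close> the difference quotient, \<open>y s\<close> is \<open>y t\<close>
  plus \<open>(s - t)\<close> times \<open>D\<close>. Expanding the quadratic form leaves
  \<open>2 * wip k D (y t)\<close> and a remainder of order \<open>s - t\<close>, and
  \<open>D\<close> tends to \<open>w\<close> in L2.\<close>

lemma wip_has_derivative:
  assumes y: "\<And>s. s \<ge> 0 \<Longrightarrow> L2_01 (y s)" and d: "L2_has_deriv y w t" and t: "t \<ge> 0" and k: "k \<ge> 0"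
  shows "((\<lambda>s. wip k (y s) (y s)) has_real_derivative 2 * wip k w (y t)) (at t within {0..})"
proof -
  have w: "L2_01 w" and lim: "((\<lambda>s. L2norm (\<lambda>\<xi>. inverse (s - t) *\<^sub>R (y s \<xi> - y t \<xi>) - w \<xi>)) \<longlongrightarrow> 0) (at t within {0..})"
    using d by (auto simp: L2_has_deriv_def)
  define e where "e = (\<lambda>s \<xi>. inverse (s - t) *\<^sub>R (y s \<xi> - y t \<xi>) - w \<xi>)"
  have lim: "((\<lambda>s. L2norm (e s)) \<longlongrightarrow> 0) (at t within {0..})" unfolding e_def by (rule lim)
  have bound: "norm ((wip k (y s) (y s) - wip k (y t) (y t)) / (s - t) - 2 * wip k w (y t))
      \<le> 2 * (L2norm (e s) * L2norm (y t)) + \<bar>s - t\<bar> * (L2norm w + L2norm (e s))\<^sup>2"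
    if s: "s \<ge> 0" "s \<noteq> t" for s
  proof -
    have e: "L2_01 (e s)" unfolding e_def
      using y[OF s(1)] y[OF t] w by (intro L2_01_diff L2_01_scale)
    define D where "D = (\<lambda>\<xi>. w \<xi> + e s \<xi>)"
    have D: "L2_01 D" unfolding D_def by (rule L2_01_add[OF w e])
    have ys: "y s = (\<lambda>\<xi>. y t \<xi> + (s - t) *\<^sub>R D \<xi>)"
      using s by (auto simp: D_def e_def fun_eq_iff)
    have "wip k (y s) (y s) = wip k (y t) (y t) + 2 * (s - t) * wip k D (y t) + (s - t) * ((s - t) * wip k D D)"
      unfolding ys by (rule wip_add_scale[OF y[OF t] D k])
    also have "wip k D (y t) = wip k w (y t) + wip k (e s) (y t)"
      unfolding D_def by (rule wip_add_left[OF w e y[OF t] k])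
    finally have "(wip k (y s) (y s) - wip k (y t) (y t)) / (s - t) - 2 * wip k w (y t) = 2 * wip k (e s) (y t) + (s - t) * wip k D D"
      using s by (simp add: field_simps)
    moreover have "\<bar>wip k (e s) (y t)\<bar> \<le> L2norm (e s) * L2norm (y t)"
      by (rule wip_Cauchy_Schwarz[OF e y[OF t] k])
    moreover have "\<bar>wip k D D\<bar> \<le> (L2norm w + L2norm (e s))\<^sup>2"
    proof -
      have "\<bar>wip k D D\<bar> \<le> (L2norm D)\<^sup>2" using wip_self_le[OF D k] wip_nonneg[of k D] by simp
      also have "\<dots> \<le> (L2norm w + L2norm (e s))\<^sup>2"
        unfolding D_def by (intro power_mono L2norm_triangle w e) simp
      finally show ?thesis .
    qed
    then have "\<bar>(s - t) * wip k D D\<bar> \<le> \<bar>s - t\<bar> * (L2norm w + L2norm (e s))\<^sup>2"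
      unfolding abs_mult by (intro mult_left_mono) auto
    ultimately show ?thesis by simp
  qed
  have "((\<lambda>s. (wip k (y s) (y s) - wip k (y t) (y t)) / (s - t) - 2 * wip k w (y t)) \<longlongrightarrow> 0) (at t within {0..})"
  proof (rule Lim_null_comparison)
    show "\<forall>\<^sub>F s in at t within {0..}. norm ((wip k (y s) (y s) - wip k (y t) (y t)) / (s - t) - 2 * wip k w (y t))
      \<le> 2 * (L2norm (e s) * L2norm (y t)) + \<bar>s - t\<bar> * (L2norm w + L2norm (e s))\<^sup>2"
      unfolding eventually_at_filter using bound by (intro always_eventually) auto
    have "((\<lambda>s. 2 * (L2norm (e s) * L2norm (y t)) + \<bar>s - t\<bar> * (L2norm w + L2norm (e s))\<^sup>2) \<longlongrightarrow>
      2 * (0 * L2norm (y t)) + \<bar>t - t\<bar> * (L2norm w + 0)\<^sup>2) (at t within {0..})"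
      by (intro tendsto_intros lim)
    then show "((\<lambda>s. 2 * (L2norm (e s) * L2norm (y t)) + \<bar>s - t\<bar> * (L2norm w + L2norm (e s))\<^sup>2) \<longlongrightarrow> 0) (at t within {0..})"
      by simp
  qed
  then show ?thesis
    unfolding has_field_derivative_iff by (rule Lim_null[THEN iffD2])
qed

lemma L2_has_deriv_diff:
  assumes "L2_has_deriv y w t" "L2_has_deriv y' w' t" "t \<ge> 0"
    and y: "\<And>s. s \<ge> 0 \<Longrightarrow> L2_01 (y s)" and y': "\<And>s. s \<ge> 0 \<Longrightarrow> L2_01 (y' s)"
  shows "L2_has_deriv (\<lambda>s \<xi>. y s \<xi> - y' s \<xi>) (\<lambda>\<xi>. w \<xi> - w' \<xi>) t"
proof -
  let ?e = "\<lambda>y w s \<xi>. inverse (s - t) *\<^sub>R (y s \<xi> - y t \<xi>) - w \<xi>"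
  have w: "L2_01 w" "L2_01 w'" and lim: "((\<lambda>s. L2norm (?e y w s)) \<longlongrightarrow> 0) (at t within {0..})"
    "((\<lambda>s. L2norm (?e y' w' s)) \<longlongrightarrow> 0) (at t within {0..})"
    using assms by (auto simp: L2_has_deriv_def)
  have bound: "L2norm (\<lambda>\<xi>. inverse (s - t) *\<^sub>R ((y s \<xi> - y' s \<xi>) - (y t \<xi> - y' t \<xi>)) - (w \<xi> - w' \<xi>))
      \<le> L2norm (?e y w s) + L2norm (?e y' w' s)" if "s \<ge> 0" for s
  proof -
    have "(\<lambda>\<xi>. inverse (s - t) *\<^sub>R ((y s \<xi> - y' s \<xi>) - (y t \<xi> - y' t \<xi>)) - (w \<xi> - w' \<xi>)) = (\<lambda>\<xi>. ?e y w s \<xi> - ?e y' w' s \<xi>)"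
      by (auto simp: algebra_simps)
    then show ?thesis
      using y[OF that] y'[OF that] y[OF assms(3)] y'[OF assms(3)] w
      by (simp only:) (intro L2norm_triangle_diff L2_01_diff L2_01_scale)
  qed
  have "((\<lambda>s. L2norm (\<lambda>\<xi>. inverse (s - t) *\<^sub>R ((y s \<xi> - y' s \<xi>) - (y t \<xi> - y' t \<xi>)) - (w \<xi> - w' \<xi>))) \<longlongrightarrow> 0) (at t within {0..})"
  proof (rule Lim_null_comparison)
    show "((\<lambda>s. L2norm (?e y w s) + L2norm (?e y' w' s)) \<longlongrightarrow> 0) (at t within {0..})"
      using tendsto_add[OF lim] by simp
  qed (use bound in \<open>auto simp: eventually_at_filter intro!: always_eventually\<close>)
  then show ?thesis using L2_01_diff[OF w] by (simp add: L2_has_deriv_def)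
qed

text \<open>Translation is linear and does not increase the L2 norm, so the error of the translated
  quotient is dominated by the original one.\<close>

lemma L2_has_deriv_shift01:
  assumes "L2_has_deriv y w t" "t \<ge> 0" "h > 0"
    and y: "\<And>s. s \<ge> 0 \<Longrightarrow> L2_01 (y s)"
  shows "L2_has_deriv (\<lambda>s. shift01 h (y s)) (shift01 h w) t"
proof -
  let ?e = "\<lambda>s \<xi>. inverse (s - t) *\<^sub>R (y s \<xi> - y t \<xi>) - w \<xi>"
  have w: "L2_01 w" and lim: "((\<lambda>s. L2norm (?e s)) \<longlongrightarrow> 0) (at t within {0..})"
    using assms by (auto simp: L2_has_deriv_def)
  have bound: "L2norm (\<lambda>\<xi>. inverse (s - t) *\<^sub>R (shift01 h (y s) \<xi> - shift01 h (y t) \<xi>) - shift01 h w \<xi>) \<le> L2norm (?e s)"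
    if "s \<ge> 0" for s
  proof -
    have "(\<lambda>\<xi>. inverse (s - t) *\<^sub>R (shift01 h (y s) \<xi> - shift01 h (y t) \<xi>) - shift01 h w \<xi>) = shift01 h (?e s)"
      by (auto simp: shift01_def)
    then show ?thesis
      using y[OF that] y[OF assms(2)] w assms(3)
      by (simp only:) (intro L2_01_shift01(2) L2_01_diff L2_01_scale)
  qed
  have "((\<lambda>s. L2norm (\<lambda>\<xi>. inverse (s - t) *\<^sub>R (shift01 h (y s) \<xi> - shift01 h (y t) \<xi>) - shift01 h w \<xi>)) \<longlongrightarrow> 0) (at t within {0..})"
    by (rule Lim_null_comparison[OF _ lim]) (use bound in \<open>auto simp: eventually_at_filter intro!: always_eventually\<close>)
  then show ?thesis using L2_01_shift01[OF w assms(3)] by (simp add: L2_has_deriv_def)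
qed

lemma wip_le_quadratic:
  assumes "L2_01 u" "L2_01 v" "L2_01 s" "k \<ge> 0"
    and le: "\<And>\<xi>. 2 * (u \<xi> \<bullet> v \<xi>) \<le> a * (norm (v \<xi>))\<^sup>2 + b * (norm (s \<xi>))\<^sup>2"
  shows "2 * wip k u v \<le> a * wip k v v + b * wip k s s"
proof -
  let ?p = "\<lambda>\<xi> u v. exp (- k * \<xi>) * (cut01 u \<xi> \<bullet> cut01 v \<xi>)"
  note int = wip_integrable[OF assms(1,2,4)] wip_integrable[OF assms(2,2,4)] wip_integrable[OF assms(3,3,4)]
  have "(\<integral>\<xi>. 2 * ?p \<xi> u v \<partial>lborel) \<le> (\<integral>\<xi>. a * ?p \<xi> v v + b * ?p \<xi> s s \<partial>lborel)"
  proof (rule Bochner_Integration.integral_mono)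
    show "2 * ?p \<xi> u v \<le> a * ?p \<xi> v v + b * ?p \<xi> s s" for \<xi>
    proof (cases "\<xi> \<in> {0<..<1}")
      case True
      have "exp (- k * \<xi>) * (2 * (u \<xi> \<bullet> v \<xi>)) \<le> exp (- k * \<xi>) * (a * (norm (v \<xi>))\<^sup>2 + b * (norm (s \<xi>))\<^sup>2)"
        by (intro mult_left_mono le) simp
      then show ?thesis using True by (simp add: cut01_def dot_square_norm algebra_simps)
    qed (simp add: cut01_def)
  qed (use int in auto)
  then show ?thesis using int by (simp add: wip_def)
qed

text \<open>Testing the equation with \<open>y t\<close> in the weighted product: transport
  contributes at least \<open>k * l\<close> of dissipation, the zero-order term at most
  \<open>2 * \<beta>\<close> of growth, and Young's inequality for the source costs the additional
  1.\<close>

lemma transport_energy_ineq: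
  fixes y :: "real \<Rightarrow> real \<Rightarrow> real^'n"
  assumes y: "\<And>s. s \<ge> 0 \<Longrightarrow> L2_01 (y s)" and t: "t > 0"
    and d: "L2_has_deriv y w t" and g: "weak_deriv01 (y t) g" and y0: "y t 0 = 0"
    and pde: "AE \<xi> in lborel. \<xi> \<in> {0<..<1} \<longrightarrow> w \<xi> + diagm lam *v g \<xi> = B *v y t \<xi> + D *v s \<xi>"
    and s: "L2_01 s" and B: "\<And>x. norm (B *v x) \<le> \<beta> * norm x" and D: "\<And>x. norm (D *v x) \<le> \<delta> * norm x"
    and lam: "\<And>i. l \<le> lam $ i" and l: "l \<ge> 0" and k: "k \<ge> 0" and \<delta>: "\<delta> \<ge> 0"
  shows "2 * wip k w (y t) \<le> (2 * \<beta> + 1 - k * l) * wip k (y t) (y t) + (\<delta> * L2norm s)\<^sup>2"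
proof -
  have t0: "t \<ge> 0" using t by simp
  have w: "L2_01 w" using d by (simp add: L2_has_deriv_def)
  note g2 = weak_deriv01_L2[OF g]
  have Lg: "L2_01 (\<lambda>\<xi>. diagm lam *v g \<xi>)" by (rule L2_01_linear(1)[OF _ g2]) simp
  have By: "L2_01 (\<lambda>\<xi>. B *v y t \<xi>)" by (rule L2_01_linear(1)[OF _ y[OF t0]]) simp
  have Ds: "L2_01 (\<lambda>\<xi>. D *v s \<xi>)" by (rule L2_01_linear(1)[OF _ s]) simp
  note F = L2_01_add[OF By Ds]
  have "wip k w (y t) + wip k (\<lambda>\<xi>. diagm lam *v g \<xi>) (y t) = wip k (\<lambda>\<xi>. w \<xi> + diagm lam *v g \<xi>) (y t)"
    by (rule wip_add_left[OF w Lg y[OF t0] k, symmetric])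
  also have "\<dots> = wip k (\<lambda>\<xi>. B *v y t \<xi> + D *v s \<xi>) (y t)"
    by (rule wip_cong_AE[OF pde L2_01_add[OF w Lg] F y[OF t0]])
  finally have "2 * wip k w (y t) = 2 * wip k (\<lambda>\<xi>. B *v y t \<xi> + D *v s \<xi>) (y t) - 2 * wip k (\<lambda>\<xi>. diagm lam *v g \<xi>) (y t)"
    by simp
  moreover have "k * l * wip k (y t) (y t) \<le> 2 * wip k (\<lambda>\<xi>. diagm lam *v g \<xi>) (y t)"
    by (rule wip_weak_deriv_ge[OF g y0 k lam l])
  moreover have "2 * wip k (\<lambda>\<xi>. B *v y t \<xi> + D *v s \<xi>) (y t) \<le> (2 * \<beta> + 1) * wip k (y t) (y t) + \<delta>\<^sup>2 * wip k s s"
  proof (rule wip_le_quadratic[OF F y[OF t0] s k])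
    fix \<xi>
    let ?Y = "norm (y t \<xi>)" let ?S = "norm (s \<xi>)"
    have "(B *v y t \<xi> + D *v s \<xi>) \<bullet> y t \<xi> \<le> norm (B *v y t \<xi> + D *v s \<xi>) * ?Y" by (rule norm_cauchy_schwarz)
    also have "\<dots> \<le> (\<beta> * ?Y + \<delta> * ?S) * ?Y"
      using norm_triangle_ineq[of "B *v y t \<xi>" "D *v s \<xi>"] B[of "y t \<xi>"] D[of "s \<xi>"]
      by (intro mult_right_mono) auto
    finally have "2 * ((B *v y t \<xi> + D *v s \<xi>) \<bullet> y t \<xi>) \<le> 2 * \<beta> * ?Y\<^sup>2 + 2 * (\<delta> * ?S) * ?Y"
      by (simp add: algebra_simps power2_eq_square)
    also have "2 * (\<delta> * ?S) * ?Y \<le> (\<delta> * ?S)\<^sup>2 + ?Y\<^sup>2" by (rule sum_squares_bound)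
    finally show "2 * ((B *v y t \<xi> + D *v s \<xi>) \<bullet> y t \<xi>) \<le> (2 * \<beta> + 1) * ?Y\<^sup>2 + \<delta>\<^sup>2 * ?S\<^sup>2"
      by (simp add: algebra_simps power_mult_distrib)
  qed
  moreover have "\<delta>\<^sup>2 * wip k s s \<le> (\<delta> * L2norm s)\<^sup>2"
    unfolding power_mult_distrib by (intro mult_left_mono wip_self_le s k) simp
  ultimately show ?thesis by (simp add: algebra_simps)
qed

lemma transport_L2_bound:
  fixes y :: "real \<Rightarrow> real \<Rightarrow> real^'n"
  assumes y: "\<And>s. s \<ge> 0 \<Longrightarrow> L2_01 (y s)"
    and yd: "\<And>t. t \<ge> 0 \<Longrightarrow> \<exists>w. L2_has_deriv y w t" and y0: "\<And>t. t > 0 \<Longrightarrow> y t 0 = 0"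
    and pde: "\<And>t. t > 0 \<Longrightarrow> \<exists>w g. L2_has_deriv y w t \<and> weak_deriv01 (y t) g \<and>
      (AE \<xi> in lborel. \<xi> \<in> {0<..<1} \<longrightarrow> w \<xi> + diagm lam *v g \<xi> = B t *v y t \<xi> + D t *v s t \<xi>)"
    and s: "\<And>t. t > 0 \<Longrightarrow> L2_01 (s t)"
    and B: "\<And>t x. t > 0 \<Longrightarrow> norm (B t *v x) \<le> \<beta> * norm x"
    and D: "\<And>t x. t > 0 \<Longrightarrow> norm (D t *v x) \<le> \<delta> t * norm x" and \<delta>: "\<And>t. t > 0 \<Longrightarrow> \<delta> t \<ge> 0"
    and c: "\<And>t. t > 0 \<Longrightarrow> (\<delta> t * L2norm (s t))\<^sup>2 \<le> c * exp (- \<nu> * t)" and c0: "c \<ge> 0"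
    and lam: "\<And>i. l \<le> lam $ i" and l: "l > 0" and \<beta>: "\<beta> \<ge> 0" and \<nu>: "\<nu> \<ge> 0" and t: "t \<ge> 0"
  shows "(L2norm (y t))\<^sup>2 \<le> exp ((2 * \<beta> + 2 + \<nu>) / l) * ((L2norm (y 0))\<^sup>2 + c) * exp (- \<nu> * t)"
proof -
  \<comment> \<open>Chosen so that \<open>2 * \<beta> + 1 - k * l\<close> equals
    \<open>- (\<nu> + 1)\<close>. The energy then dissipates faster than the source decays, with a
    gap of exactly 1, so \<open>c\<close> enters the Gronwall bound undivided. Passing between
    weighted and unweighted norms costs \<open>exp k\<close>.\<close>
  define k where "k = (2 * \<beta> + 2 + \<nu>) / l"
  have k: "k \<ge> 0" and kl: "k * l = 2 * \<beta> + 2 + \<nu>" using l \<beta> \<nu> by (auto simp: k_def)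
  define V where "V = (\<lambda>t. wip k (y t) (y t))"
  have "continuous_on {0..} V"
    unfolding continuous_on_eq_continuous_within
  proof
    fix t :: real assume "t \<in> {0..}"
    then have "t \<ge> 0" by simp
    with yd obtain w where "L2_has_deriv y w t" by blast
    from wip_has_derivative[OF y this \<open>t \<ge> 0\<close> k]
    show "continuous (at t within {0..}) V"
      unfolding V_def using DERIV_continuous by blast
  qed
  moreover have "\<exists>V'. \<forall>t>0. (V has_real_derivative V' t) (at t) \<and> V' t \<le> (0 * exp (- 1 * t) - (\<nu> + 1)) * V t + c * exp (- \<nu> * t)"
  proof (rule choice, rule allI)
    fix t :: real
    show "\<exists>V'. 0 < t \<longrightarrow> (V has_real_derivative V') (at t) \<and> V' \<le> (0 * exp (- 1 * t) - (\<nu> + 1)) * V t + c * exp (- \<nu> * t)"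
    proof (cases "t > 0")
      case True
      then obtain w g where wg: "L2_has_deriv y w t" "weak_deriv01 (y t) g"
        "AE \<xi> in lborel. \<xi> \<in> {0<..<1} \<longrightarrow> w \<xi> + diagm lam *v g \<xi> = B t *v y t \<xi> + D t *v s t \<xi>"
        using pde by blast
      have "(V has_real_derivative 2 * wip k w (y t)) (at t within {0..})"
        unfolding V_def by (rule wip_has_derivative[OF y wg(1) _ k]) (use True in auto)
      moreover have "at t within {0..} = at t"
        using True by (intro at_within_interior) (auto simp: interior_real_atLeast)
      moreover have "2 * wip k w (y t) \<le> (2 * \<beta> + 1 - k * l) * V t + (\<delta> t * L2norm (s t))\<^sup>2"
        unfolding V_def
        by (rule transport_energy_ineq[OF y True wg(1,2) y0[OF True] wg(3) s[OF True] B[OF True] D[OF True] lam _ k \<delta>[OF True]])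
          (use l in auto)
      ultimately show ?thesis using c[OF True] kl by (intro exI[of _ "2 * wip k w (y t)"]) (simp add: algebra_simps)
    qed simp
  qed
  ultimately obtain V' where cont: "continuous_on {0..} V"
    and V': "\<And>t. t > 0 \<Longrightarrow> (V has_real_derivative V' t) (at t)"
      "\<And>t. t > 0 \<Longrightarrow> V' t \<le> (0 * exp (- 1 * t) - (\<nu> + 1)) * V t + c * exp (- \<nu> * t)" by blast
  have V0: "0 \<le> V 0" "V 0 \<le> (L2norm (y 0))\<^sup>2"
    unfolding V_def using wip_nonneg wip_self_le[OF y k] by auto
  have "V t \<le> exp (0 / 1) * ((V 0 + c / \<bar>\<nu> + 1 - \<nu>\<bar>) * exp (- min (\<nu> + 1) \<nu> * t))"
    by (rule gronwall_exp[OF cont V' V0(1) _ _ c0 _ t]) auto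
  also have "\<dots> = (V 0 + c) * exp (- \<nu> * t)" by (simp add: min_def)
  also have "\<dots> \<le> ((L2norm (y 0))\<^sup>2 + c) * exp (- \<nu> * t)" using V0 by (intro mult_right_mono) auto
  finally have *: "V t \<le> ((L2norm (y 0))\<^sup>2 + c) * exp (- \<nu> * t)" .
  have "(L2norm (y t))\<^sup>2 = exp k * (exp (- k) * (L2norm (y t))\<^sup>2)" by (simp add: exp_minus)
  also have "\<dots> \<le> exp k * V t" unfolding V_def by (intro mult_left_mono wip_self_ge y t k) simp
  also have "\<dots> \<le> exp k * (((L2norm (y 0))\<^sup>2 + c) * exp (- \<nu> * t))" using * by (intro mult_left_mono) auto
  finally show ?thesis by (simp add: k_def mult.assoc)
qed

text \<open>The weak space derivative is estimated through the differences \<open>y - shift01 h y\<close>: since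
  \<open>y\<close> vanishes at the inflow boundary, its extension by zero, and hence its translate, solves the
  same transport equation.\<close>
lemma transport_weak_deriv_bound:
  fixes y s :: "real \<Rightarrow> real \<Rightarrow> real^'n"
  assumes yw: "\<And>t. t \<ge> 0 \<Longrightarrow> \<exists>g. weak_deriv01 (y t) g"
    and yd: "\<And>t. t \<ge> 0 \<Longrightarrow> \<exists>w. L2_has_deriv y w t" and y0: "\<And>t. t \<ge> 0 \<Longrightarrow> y t 0 = 0"
    and pde: "\<And>t. t > 0 \<Longrightarrow> \<exists>w g. L2_has_deriv y w t \<and> weak_deriv01 (y t) g \<and>
      (AE \<xi> in lborel. \<xi> \<in> {0<..<1} \<longrightarrow> w \<xi> + diagm lam *v g \<xi> = B t *v y t \<xi> + D t *v s t \<xi>)"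
    and s: "\<And>t. t > 0 \<Longrightarrow> \<exists>g. weak_deriv01 (s t) g \<and> L2norm g \<le> M" and s0: "\<And>t. t > 0 \<Longrightarrow> s t 0 = 0"
    and B: "\<And>t x. t > 0 \<Longrightarrow> norm (B t *v x) \<le> \<beta> * norm x"
    and D: "\<And>t x. t > 0 \<Longrightarrow> norm (D t *v x) \<le> d * exp (- \<kappa> * t) * norm x"
    and lam: "\<And>i. l \<le> lam $ i" and l: "l > 0" and \<beta>: "\<beta> \<ge> 0" and \<kappa>: "\<kappa> \<ge> 0" and d: "d \<ge> 0" and M: "M \<ge> 0"
  shows "\<exists>C\<ge>0. \<forall>t\<ge>0. \<forall>g. weak_deriv01 (y t) g \<longrightarrow> L2norm g \<le> C * exp (- \<kappa> * t)"
proof -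
  obtain g0 where g0: "weak_deriv01 (y 0) g0" using yw by blast
  \<comment> \<open>Both the initial difference and its source are at most \<open>h\<close> times
    the norm of a weak derivative, so a factor \<open>h\<close> squared splits off and
    \<open>K\<close> remains. The rate is \<open>2 * \<kappa>\<close> because the energy is
    quadratic.\<close>
  define K where "K = exp ((2 * \<beta> + 2 + 2 * \<kappa>) / l) * ((L2norm g0)\<^sup>2 + (d * M)\<^sup>2)"
  have K: "K \<ge> 0" by (simp add: K_def)
  have yL: "L2_01 (y t)" if "t \<ge> 0" for t
    using yw[OF that] continuous_imp_L2_01 weak_deriv01_continuous by blast
  have sL: "L2_01 (s t)" if "t > 0" for t
    using s[OF that] continuous_imp_L2_01 weak_deriv01_continuous by blast
  have main: "L2norm (\<lambda>\<xi>. y t \<xi> - shift01 h (y t) \<xi>) \<le> sqrt K * exp (- \<kappa> * t) * h" if h: "h > 0" and t: "t \<ge> 0" for h t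
  proof -
    let ?y = "\<lambda>t \<xi>. y t \<xi> - shift01 h (y t) \<xi>"
    let ?s = "\<lambda>t \<xi>. s t \<xi> - shift01 h (s t) \<xi>"
    have "(L2norm (?y t))\<^sup>2 \<le> exp ((2 * \<beta> + 2 + 2 * \<kappa>) / l) * ((L2norm (?y 0))\<^sup>2 + (d * (h * M))\<^sup>2) * exp (- (2 * \<kappa>) * t)"
    proof (rule transport_L2_bound[where B = B and D = D and s = ?s and \<delta> = "\<lambda>t. d * exp (- \<kappa> * t)" and lam = lam])
      show "L2_01 (?y t)" if "t \<ge> 0" for t
        using yL[OF that] h by (intro L2_01_diff L2_01_shift01(1))
      show "L2_01 (?s t)" if "t > 0" for t
        using sL[OF that] h by (intro L2_01_diff L2_01_shift01(1))
      show "\<exists>w. L2_has_deriv ?y w t" if t: "t \<ge> 0" for t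
      proof -
        obtain w where w: "L2_has_deriv y w t" using yd[OF t] by blast
        have "L2_has_deriv ?y (\<lambda>\<xi>. w \<xi> - shift01 h w \<xi>) t"
          by (rule L2_has_deriv_diff[OF w L2_has_deriv_shift01[OF w t h yL] t yL L2_01_shift01(1)[OF yL h]])
        then show ?thesis by blast
      qed
      show "?y t 0 = 0" if "t > 0" for t using y0[of t] that h by (simp add: shift01_def)
      show "(d * exp (- \<kappa> * t) * L2norm (?s t))\<^sup>2 \<le> (d * (h * M))\<^sup>2 * exp (- (2 * \<kappa>) * t)" if t: "t > 0" for t
      proof -
        obtain gs where gs: "weak_deriv01 (s t) gs" "L2norm gs \<le> M" using s[OF t] by blast
        have "L2norm (?s t) \<le> h * L2norm gs" by (rule L2norm_shift01_diff_le[OF gs(1) s0[OF t] h])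
        also have "\<dots> \<le> h * M" using gs h by (intro mult_left_mono) auto
        finally have "(d * exp (- \<kappa> * t) * L2norm (?s t))\<^sup>2 \<le> (d * exp (- \<kappa> * t) * (h * M))\<^sup>2"
          using d by (intro power_mono mult_left_mono) auto
        also have "\<dots> = (d * (h * M))\<^sup>2 * (exp (- \<kappa> * t))\<^sup>2" by (simp add: power_mult_distrib)
        also have "(exp (- \<kappa> * t))\<^sup>2 = exp (- (2 * \<kappa>) * t)" by (simp add: exp_double[symmetric])
        finally show ?thesis .
      qed
      show "\<exists>w g. L2_has_deriv ?y w t \<and> weak_deriv01 (?y t) g \<and>
         (AE \<xi> in lborel. \<xi> \<in> {0<..<1} \<longrightarrow> w \<xi> + diagm lam *v g \<xi> = B t *v ?y t \<xi> + D t *v ?s t \<xi>)" if t: "t > 0" for t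
      proof -
        have t': "t \<ge> 0" using t by simp
        obtain w g where wg: "L2_has_deriv y w t" "weak_deriv01 (y t) g"
          "AE \<xi> in lborel. \<xi> \<in> {0<..<1} \<longrightarrow> w \<xi> + diagm lam *v g \<xi> = B t *v y t \<xi> + D t *v s t \<xi>"
          using pde[OF t] by blast
        have "L2_has_deriv ?y (\<lambda>\<xi>. w \<xi> - shift01 h w \<xi>) t"
          by (rule L2_has_deriv_diff[OF wg(1) L2_has_deriv_shift01[OF wg(1) t' h yL] t' yL L2_01_shift01(1)[OF yL h]])
        moreover have "weak_deriv01 (?y t) (\<lambda>\<xi>. g \<xi> - shift01 h g \<xi>)"
          by (rule weak_deriv01_diff[OF wg(2) weak_deriv01_shift01[OF wg(2) y0[OF t'] h]])
        moreover have "AE \<xi> in lborel. \<xi> \<in> {0<..<1} \<longrightarrow> (w \<xi> - shift01 h w \<xi>) + diagm lam *v (g \<xi> - shift01 h g \<xi>) = B t *v ?y t \<xi> + D t *v ?s t \<xi>"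
          \<comment> \<open>The equation also holds almost everywhere at \<open>\<xi> - h\<close>.
            For \<open>\<xi> \<le> h\<close> all translated terms are zero and the original equation
            remains; otherwise the two equations are subtracted, the matrices being the same at both
            points.\<close>
          using wg(3) AE_lborel_shift[OF wg(3), of h]
        proof eventually_elim
          case (elim \<xi>)
          show ?case
          proof (cases "\<xi> \<le> h")
            case True
            then show ?thesis using elim(1) by (simp add: shift01_def)
          next
            case False
            show ?thesis
            proof
              assume "\<xi> \<in> {0<..<1}"
              then have a: "w \<xi> + diagm lam *v g \<xi> = B t *v y t \<xi> + D t *v s t \<xi>"
                and b: "w (\<xi> - h) + diagm lam *v g (\<xi> - h) = B t *v y t (\<xi> - h) + D t *v s t (\<xi> - h)"
                using elim False h by auto
              have "(w \<xi> - w (\<xi> - h)) + diagm lam *v (g \<xi> - g (\<xi> - h)) = (w \<xi> + diagm lam *v g \<xi>) - (w (\<xi> - h) + diagm lam *v g (\<xi> - h))"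
                by (simp add: matrix_vector_mult_diff_distrib)
              also have "\<dots> = B t *v (y t \<xi> - y t (\<xi> - h)) + D t *v (s t \<xi> - s t (\<xi> - h))"
                unfolding a b by (simp add: matrix_vector_mult_diff_distrib)
              finally show "(w \<xi> - shift01 h w \<xi>) + diagm lam *v (g \<xi> - shift01 h g \<xi>) = B t *v ?y t \<xi> + D t *v ?s t \<xi>"
                using False by (simp add: shift01_def)
            qed
          qed
        qed
        ultimately show ?thesis by blast
      qed
    qed (use B D lam l \<beta> \<kappa> d t in auto)
    also have "(L2norm (?y 0))\<^sup>2 \<le> (h * L2norm g0)\<^sup>2"
      by (intro power_mono L2norm_shift01_diff_le[OF g0 y0 h]) auto
    finally have "(L2norm (?y t))\<^sup>2 \<le> exp ((2 * \<beta> + 2 + 2 * \<kappa>) / l) * ((h * L2norm g0)\<^sup>2 + (d * (h * M))\<^sup>2) * exp (- (2 * \<kappa>) * t)"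
      by (simp add: mult_left_mono mult_right_mono)
    also have "\<dots> = h\<^sup>2 * K * exp (- (2 * \<kappa>) * t)"
      by (simp add: K_def power_mult_distrib algebra_simps)
    also have "exp (- (2 * \<kappa>) * t) = (exp (- \<kappa> * t))\<^sup>2" by (simp add: exp_double[symmetric])
    also have "h\<^sup>2 * K * (exp (- \<kappa> * t))\<^sup>2 = (sqrt K * exp (- \<kappa> * t) * h)\<^sup>2"
      using K by (simp add: power_mult_distrib)
    finally show ?thesis by (rule power2_le_imp_le) (use K h in simp)
  qed
  have "L2norm g \<le> sqrt K * exp (- \<kappa> * t)" if "t \<ge> 0" "weak_deriv01 (y t) g" for t g
    by (rule L2norm_le_of_shift01_diff[OF that(2) y0[OF that(1)]]) (rule main[OF _ that(1)])
  then show ?thesis using K by (intro exI[of _ "sqrt K"]) auto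
qed

section \<open>The adaptive law\<close>

lemma at_within_halfline: "t > 0 \<Longrightarrow> at t within {0..} = at (t::real)"
  by (intro at_within_interior) (auto simp: interior_real_atLeast)

lemma outer_mult_vec: "outer u w *v x = (w \<bullet> x) *\<^sub>R u"
  by (simp add: outer_def vec_eq_iff matrix_vector_mult_def inner_vec_def sum_distrib_left sum_distrib_right mult_ac)

lemma bounded_linear_matrix_apply: "bounded_linear (\<lambda>M::real^'n^'m. M *v x)"
  unfolding linear_conv_bounded_linear[symmetric]
  by (rule linearI) (auto simp: matrix_vector_mult_add_rdistrib scaleR_matrix_vector_assoc)

lemma norm_matrix_vector_le: "norm (A *v x) \<le> norm A * norm x" for A :: "real^'n^'m"
proof -
  have "norm ((A *v x) $ i) \<le> norm (norm x *\<^sub>R (\<chi> j. norm (A $ j)) $ i)" for i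
    using Cauchy_Schwarz_ineq2[of "A $ i" x] by (simp add: matrix_vector_mult_def inner_vec_def mult.commute)
  then have "norm (A *v x) \<le> norm (norm x *\<^sub>R (\<chi> j. norm (A $ j)))"
    unfolding norm_vec_def[of "A *v x"] norm_vec_def[of "norm x *\<^sub>R (\<chi> j. norm (A $ j))"]
    by (intro L2_set_mono) auto
  also have "norm (norm x *\<^sub>R (\<chi> j. norm (A $ j))) = norm x * norm (\<chi> j. norm (A $ j))" by simp
  also have "norm (\<chi> j. norm (A $ j)) = norm A" by (simp add: norm_vec_def)
  finally show ?thesis by (simp add: mult.commute)
qed

lemma norm_diagm_vector_le: "norm (diagm d *v x) \<le> norm d * norm x"
proof -
  have "norm ((diagm d *v x) $ i) \<le> norm ((norm d *\<^sub>R x) $ i)" for i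
    using Finite_Cartesian_Product.norm_nth_le[of d i] by (simp add: abs_mult mult_right_mono)
  then have "norm (diagm d *v x) \<le> norm (norm d *\<^sub>R x)"
    unfolding norm_vec_def[of "diagm d *v x"] norm_vec_def[of "norm d *\<^sub>R x"]
    by (intro L2_set_mono) auto
  then show ?thesis by simp
qed

text \<open>Along a fixed \<open>x\<close> the quadratic form of \<open>R t\<close> obeys a scalar
  equation with rate \<open>- psi\<close> and nonnegative forcing, so \<open>exp (psi * t)\<close>
  times it never decreases. This bounds the effect of a possibly indefinite \<open>R 0\<close>. In
  the excited case each window of length \<open>T0\<close> adds a fixed multiple of the squared norm
  of \<open>x\<close>.\<close>

lemma normalized_regressor_lower_bound:
  fixes R :: "real \<Rightarrow> real^'n^'n" and \<phi> :: "real \<Rightarrow> real^'n"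
  assumes psi: "psi > 0"
    and cont: "continuous_on {0..} \<phi>"
    and R: "\<And>t. t \<ge> 0 \<Longrightarrow> (R has_vector_derivative
        (- psi *\<^sub>R R t + inverse (1 + (norm (\<phi> t))\<^sup>2) *\<^sub>R outer (\<phi> t) (\<phi> t))) (at t within {0..})"
    and pe: "s \<Longrightarrow> (\<exists>M. \<forall>t\<ge>0. norm (\<phi> t) \<le> M) \<and> persistently_exciting \<phi>"
  obtains \<alpha> c where "\<alpha> \<ge> 0" "c \<ge> 0" "s \<longrightarrow> \<alpha> > 0"
    "\<And>t x. t \<ge> 0 \<Longrightarrow> (\<alpha> - c * exp (- psi * t)) * (norm x)\<^sup>2 \<le> x \<bullet> (R t *v x)"
proof -
  define q where "q = (\<lambda>x t. x \<bullet> (R t *v x))"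
  have dq: "(q x has_real_derivative (- psi * q x t + (\<phi> t \<bullet> x)\<^sup>2 / (1 + (norm (\<phi> t))\<^sup>2))) (at t within {0..})" if "t \<ge> 0" for x t
  proof -
    have bl: "bounded_linear (\<lambda>M. x \<bullet> (M *v x))"
      by (rule bounded_linear_compose[OF bounded_linear_inner_right bounded_linear_matrix_apply])
    have "x \<bullet> ((- psi *\<^sub>R R t + inverse (1 + (norm (\<phi> t))\<^sup>2) *\<^sub>R outer (\<phi> t) (\<phi> t)) *v x)
        = - psi * q x t + (\<phi> t \<bullet> x)\<^sup>2 / (1 + (norm (\<phi> t))\<^sup>2)"
      unfolding matrix_vector_mult_add_rdistrib scaleR_matrix_vector_assoc[symmetric] outer_mult_vec q_def
      by (simp add: inner_diff_right inner_commute[of x "\<phi> t"] power2_eq_square divide_inverse mult_ac)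
    then show ?thesis
      using bounded_linear.has_vector_derivative[OF bl R[OF that]]
      unfolding q_def has_real_derivative_iff_has_vector_derivative by simp
  qed
  have growth: "q x a \<le> exp (psi * (b - a)) * q x b" if "0 \<le> a" "a \<le> b" for x a b
  proof -
    have "exp (psi * (a - a)) * q x a \<le> exp (psi * (b - a)) * q x b"
    proof (rule DERIV_nonneg_imp_increasing_open[OF that(2)])
      show "continuous_on {a..b} (\<lambda>\<tau>. exp (psi * (\<tau> - a)) * q x \<tau>)"
      proof (intro continuous_intros)
        show "continuous_on {a..b} (q x)"
          using DERIV_continuous_on[of "{0..}" "q x", OF dq] that by (auto elim: continuous_on_subset)
      qed
      fix \<tau> assume \<tau>: "a < \<tau>" "\<tau> < b"
      have d: "(q x has_real_derivative (- psi * q x \<tau> + (\<phi> \<tau> \<bullet> x)\<^sup>2 / (1 + (norm (\<phi> \<tau>))\<^sup>2))) (at \<tau>)"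
        using dq[of \<tau> x] at_within_halfline[of \<tau>] \<tau> that by simp
      have "((\<lambda>\<tau>. exp (psi * (\<tau> - a)) * q x \<tau>) has_real_derivative
         (exp (psi * (\<tau> - a)) * ((\<phi> \<tau> \<bullet> x)\<^sup>2 / (1 + (norm (\<phi> \<tau>))\<^sup>2)))) (at \<tau>)"
        by (auto intro!: derivative_eq_intros d simp: algebra_simps)
      then show "\<exists>y. ((\<lambda>\<tau>. exp (psi * (\<tau> - a)) * q x \<tau>) has_real_derivative y) (at \<tau>) \<and> 0 \<le> y"
        by (intro exI conjI) auto
    qed
    then show ?thesis by simp
  qed
  define r0 where "r0 = norm (R 0)"
  have q0: "- r0 * (norm x)\<^sup>2 \<le> q x 0" for x
  proof -
    have "\<bar>q x 0\<bar> \<le> norm x * norm (R 0 *v x)" unfolding q_def by (rule Cauchy_Schwarz_ineq2)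
    also have "\<dots> \<le> norm x * (r0 * norm x)" unfolding r0_def by (intro mult_left_mono norm_matrix_vector_le) simp
    finally show ?thesis by (simp add: power2_eq_square mult_ac)
  qed
  have base: "- r0 * exp (- psi * t) * (norm x)\<^sup>2 \<le> q x t" if "t \<ge> 0" for x t
  proof -
    have "exp (- psi * t) * (- r0 * (norm x)\<^sup>2) \<le> exp (- psi * t) * (exp (psi * t) * q x t)"
      using growth[of 0 t x] q0[of x] that by (intro mult_left_mono) auto
    then show ?thesis by (simp add: exp_minus mult_ac)
  qed
  show thesis
  proof (cases s)
    case False
    show ?thesis
      by (rule that[of 0 r0]) (use base False in \<open>auto simp: r0_def q_def\<close>)
  next
    case True
    then obtain M where M: "\<And>t. t \<ge> 0 \<Longrightarrow> norm (\<phi> t) \<le> M" and "persistently_exciting \<phi>" using pe by blast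
    then obtain T0 \<alpha>0 where T0: "T0 > 0" and \<alpha>0: "\<alpha>0 > 0"
      and P: "\<And>t. t \<ge> 0 \<Longrightarrow> loewner_ge (integral {t..t+T0} (\<lambda>s. outer (\<phi> s) (\<phi> s))) (\<alpha>0 *\<^sub>R mat 1)"
      unfolding persistently_exciting_def by blast
    have PE: "\<alpha>0 * (norm x)\<^sup>2 \<le> integral {t..t+T0} (\<lambda>s. (\<phi> s \<bullet> x)\<^sup>2)" if "t \<ge> 0" for t x
    proof -
      have bl: "bounded_linear (\<lambda>M. x \<bullet> (M *v x))"
        by (rule bounded_linear_compose[OF bounded_linear_inner_right bounded_linear_matrix_apply])
      have c: "continuous_on {t..t+T0} \<phi>" using cont by (rule continuous_on_subset) (use that in auto)
      have "continuous_on {t..t+T0} (\<lambda>s. outer (\<phi> s) (\<phi> s))"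
        unfolding outer_def by (intro continuous_intros c)
      then have "(\<lambda>s. outer (\<phi> s) (\<phi> s)) integrable_on {t..t+T0}" by (rule integrable_continuous_interval)
      from integral_linear[OF this bl]
      have "integral {t..t+T0} (\<lambda>s. (\<phi> s \<bullet> x)\<^sup>2) = x \<bullet> (integral {t..t+T0} (\<lambda>s. outer (\<phi> s) (\<phi> s)) *v x)"
        by (simp add: o_def outer_mult_vec inner_commute[of x] power2_eq_square)
      moreover have "0 \<le> x \<bullet> ((integral {t..t+T0} (\<lambda>s. outer (\<phi> s) (\<phi> s)) - \<alpha>0 *\<^sub>R mat 1) *v x)"
        using P[OF that] by (simp add: loewner_ge_def)
      ultimately show ?thesis
        by (simp add: matrix_vector_mult_diff_rdistrib inner_diff_right scaleR_matrix_vector_assoc[symmetric] dot_square_norm)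
    qed
    \<comment> \<open>The bound \<open>M\<close> on the regressor limits the normalization by
      \<open>1 + M\<^sup>2\<close>, so the forcing collected over one window is at least
      \<open>a\<close> times the squared norm of \<open>x\<close>.\<close>
    define a where "a = \<alpha>0 / (1 + M\<^sup>2)"
    have M1: "1 + M\<^sup>2 > 0" by (simp add: add_pos_nonneg)
    have a: "a > 0" using \<alpha>0 M1 by (simp add: a_def)
    have excite: "q x t + a * (norm x)\<^sup>2 \<le> exp (psi * T0) * q x (t + T0)" if t: "t \<ge> 0" for x t
    proof -
      define I where "I = (\<lambda>\<tau>. integral {t..\<tau>} (\<lambda>s. (\<phi> s \<bullet> x)\<^sup>2))"
      have c: "continuous_on {t..t+T0} (\<lambda>s. (\<phi> s \<bullet> x)\<^sup>2)"
        by (intro continuous_intros continuous_on_subset[OF cont]) (use t in auto)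
      have cI: "continuous_on {t..t+T0} I"
        unfolding I_def by (intro indefinite_integral_continuous_1 integrable_continuous_interval c)
      have dI: "(I has_real_derivative (\<phi> \<tau> \<bullet> x)\<^sup>2) (at \<tau>)" if "t < \<tau>" "\<tau> < t + T0" for \<tau>
      proof -
        have "(I has_vector_derivative (\<phi> \<tau> \<bullet> x)\<^sup>2) (at \<tau> within {t..t+T0})"
          unfolding I_def by (rule integral_has_vector_derivative[OF c]) (use that in auto)
        moreover have "at \<tau> within {t..t+T0} = at \<tau>" using that by (intro at_within_interior) auto
        ultimately show ?thesis by (simp add: has_real_derivative_iff_has_vector_derivative)
      qed
      have "exp (psi * (t - t)) * q x t - I t / (1 + M\<^sup>2) \<le> exp (psi * (t + T0 - t)) * q x (t + T0) - I (t + T0) / (1 + M\<^sup>2)"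
      proof (rule DERIV_nonneg_imp_increasing_open[where f = "\<lambda>\<tau>. exp (psi * (\<tau> - t)) * q x \<tau> - I \<tau> / (1 + M\<^sup>2)"])
        show "t \<le> t + T0" using T0 by simp
        show "continuous_on {t..t + T0} (\<lambda>\<tau>. exp (psi * (\<tau> - t)) * q x \<tau> - I \<tau> / (1 + M\<^sup>2))"
        proof (intro continuous_intros cI)
          show "continuous_on {t..t + T0} (q x)"
            using DERIV_continuous_on[of "{0..}" "q x", OF dq] t by (auto elim: continuous_on_subset)
        qed (use M1 in auto)
        fix \<tau> assume \<tau>: "t < \<tau>" "\<tau> < t + T0"
        have d: "(q x has_real_derivative (- psi * q x \<tau> + (\<phi> \<tau> \<bullet> x)\<^sup>2 / (1 + (norm (\<phi> \<tau>))\<^sup>2))) (at \<tau>)"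
          using dq[of \<tau> x] at_within_halfline[of \<tau>] \<tau> t by simp
        have D: "((\<lambda>\<tau>. exp (psi * (\<tau> - t)) * q x \<tau> - I \<tau> / (1 + M\<^sup>2)) has_real_derivative
           (exp (psi * (\<tau> - t)) * ((\<phi> \<tau> \<bullet> x)\<^sup>2 / (1 + (norm (\<phi> \<tau>))\<^sup>2)) - (\<phi> \<tau> \<bullet> x)\<^sup>2 / (1 + M\<^sup>2))) (at \<tau>)"
        proof (rule DERIV_diff)
          show "((\<lambda>\<tau>. exp (psi * (\<tau> - t)) * q x \<tau>) has_real_derivative
             (exp (psi * (\<tau> - t)) * ((\<phi> \<tau> \<bullet> x)\<^sup>2 / (1 + (norm (\<phi> \<tau>))\<^sup>2)))) (at \<tau>)"
            by (auto intro!: derivative_eq_intros d simp: algebra_simps)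
          show "((\<lambda>\<tau>. I \<tau> / (1 + M\<^sup>2)) has_real_derivative (\<phi> \<tau> \<bullet> x)\<^sup>2 / (1 + M\<^sup>2)) (at \<tau>)"
            by (rule DERIV_cdivide[OF dI[OF \<tau>]])
        qed
        have "(\<phi> \<tau> \<bullet> x)\<^sup>2 / (1 + M\<^sup>2) \<le> (\<phi> \<tau> \<bullet> x)\<^sup>2 / (1 + (norm (\<phi> \<tau>))\<^sup>2)"
          using M[of \<tau>] \<tau> t M1 by (intro divide_left_mono mult_pos_pos add_left_mono power_mono) (auto simp: add_pos_nonneg)
        also have "\<dots> \<le> exp (psi * (\<tau> - t)) * ((\<phi> \<tau> \<bullet> x)\<^sup>2 / (1 + (norm (\<phi> \<tau>))\<^sup>2))"
          using mult_right_mono[of 1 "exp (psi * (\<tau> - t))" "(\<phi> \<tau> \<bullet> x)\<^sup>2 / (1 + (norm (\<phi> \<tau>))\<^sup>2)"] psi \<tau> by simp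
        finally show "\<exists>y. ((\<lambda>\<tau>. exp (psi * (\<tau> - t)) * q x \<tau> - I \<tau> / (1 + M\<^sup>2)) has_real_derivative y) (at \<tau>) \<and> 0 \<le> y"
          using D by (intro exI conjI) auto
      qed
      then have "q x t + I (t + T0) / (1 + M\<^sup>2) \<le> exp (psi * T0) * q x (t + T0)" by (simp add: I_def)
      moreover have "a * (norm x)\<^sup>2 \<le> I (t + T0) / (1 + M\<^sup>2)"
        using PE[OF t, of x] M1 by (simp add: a_def I_def divide_right_mono)
      ultimately show ?thesis by simp
    qed
    show ?thesis
    \<comment> \<open>The gain of the last full window is discounted by
      \<open>exp (- psi * T0)\<close>. For \<open>t < T0\<close> no full window has elapsed; the
      summand \<open>a\<close> in the second constant then outweighs the claimed gain and the bound
      from \<open>r0\<close> suffices.\<close>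
    proof (rule that[of "a * exp (- psi * T0)" "r0 + a"])
      fix t :: real and x :: "real^'n" assume t: "t \<ge> 0"
      show "(a * exp (- psi * T0) - (r0 + a) * exp (- psi * t)) * (norm x)\<^sup>2 \<le> x \<bullet> (R t *v x)"
      proof (cases "t \<ge> T0")
        case True
        have "(a * exp (- psi * T0) - (r0 + a) * exp (- psi * t)) * (norm x)\<^sup>2
            \<le> (a * exp (- psi * T0) - r0 * exp (- psi * t)) * (norm x)\<^sup>2"
          using a by (intro mult_right_mono) (auto simp: algebra_simps)
        also have "\<dots> = exp (- psi * T0) * (- r0 * exp (- psi * (t - T0)) * (norm x)\<^sup>2 + a * (norm x)\<^sup>2)"
        proof -
          have "exp (- psi * T0) * exp (- psi * (t - T0)) = exp (- psi * t)"
            by (simp add: exp_add[symmetric] algebra_simps)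
          then show ?thesis by (simp add: algebra_simps)
        qed
        also have "\<dots> \<le> exp (- psi * T0) * (q x (t - T0) + a * (norm x)\<^sup>2)"
          using base[of "t - T0" x] True by (intro mult_left_mono) auto
        also have "\<dots> \<le> exp (- psi * T0) * (exp (psi * T0) * q x t)"
          using excite[of "t - T0" x] True by (intro mult_left_mono) auto
        also have "\<dots> = x \<bullet> (R t *v x)" by (simp add: exp_minus q_def)
        finally show ?thesis .
      next
        case False
        have "a * exp (- psi * T0) \<le> a * exp (- psi * t)" using False psi a by (intro mult_left_mono) auto
        then have "(a * exp (- psi * T0) - (r0 + a) * exp (- psi * t)) * (norm x)\<^sup>2 \<le> (- r0 * exp (- psi * t)) * (norm x)\<^sup>2"
          by (intro mult_right_mono) (auto simp: algebra_simps)
        also have "\<dots> \<le> q x t" using base[OF t] by simp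
        finally show ?thesis by (simp add: q_def)
      qed
    qed (use a in \<open>auto simp: r0_def\<close>)
  qed
qed

text \<open>The last claim bounds the inverse form from below without eigenvalues: with
  \<open>x = G *v u\<close>, Cauchy-Schwarz for the form of \<open>G\<close> bounds the square of
  \<open>x \<bullet> x\<close> by the product of the forms at \<open>x\<close> and at
  \<open>u\<close>.\<close>

lemma sym_pos_def_inverse:
  fixes G :: "real^'n^'n"
  assumes "sym_pos_def G"
  obtains P where "P ** G = mat 1" "\<And>x y. x \<bullet> (P *v y) = (P *v x) \<bullet> y"
    "\<And>x. (norm x)\<^sup>2 \<le> norm G * (x \<bullet> (P *v x))"
proof -
  have sym: "(G *v u) \<bullet> v = u \<bullet> (G *v v)" for u v
    using assms dot_lmul_matrix[of u G v] by (metis sym_pos_def_def transpose_matrix_vector)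
  have pos: "0 \<le> u \<bullet> (G *v u)" for u
    using assms by (cases "u = 0") (auto simp: sym_pos_def_def intro: less_imp_le)
  have "inj ((*v) G)"
  proof (rule injI)
    fix x y assume "G *v x = G *v y"
    then have "(x - y) \<bullet> (G *v (x - y)) = 0" by (simp add: matrix_vector_mult_diff_distrib)
    then show "x = y" using assms unfolding sym_pos_def_def by (metis eq_iff_diff_eq_0 less_irrefl)
  qed
  then obtain P where P: "P ** G = mat 1" by (auto simp: matrix_left_invertible_injective[symmetric])
  then have GP: "G ** P = mat 1" by (simp add: matrix_left_right_inverse)
  have GPx: "G *v (P *v x) = x" for x by (simp add: matrix_vector_mul_assoc GP)
  show thesis
  proof (rule that[OF P])
    show "x \<bullet> (P *v y) = (P *v x) \<bullet> y" for x y
      using sym[of "P *v x" "P *v y"] by (simp add: GPx)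
    show "(norm x)\<^sup>2 \<le> norm G * (x \<bullet> (P *v x))" for x
    proof -
      define u where "u = P *v x"
      have x: "x = G *v u" by (simp add: u_def GPx)
      have "(x \<bullet> x)\<^sup>2 \<le> (x \<bullet> (G *v x)) * (u \<bullet> (G *v u))"
      proof (rule quadratic_nonneg_discriminant)
        \<comment> \<open>This polynomial is the quadratic form of \<open>G\<close> at
          \<open>u - c *\<^sub>R x\<close>, as \<open>G *v u\<close> equals
          \<open>x\<close>.\<close>
        show "0 \<le> (x \<bullet> (G *v x)) * c\<^sup>2 - 2 * (x \<bullet> x) * c + u \<bullet> (G *v u)" for c
          using pos[of "u - c *\<^sub>R x"] sym[of u x]
          by (simp add: matrix_vector_mult_diff_distrib matrix_vector_mult_scaleR inner_diff_left
              inner_diff_right x[symmetric] inner_commute power2_eq_square algebra_simps)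
      qed (rule pos)
      also have "\<dots> \<le> (norm x * (norm G * norm x)) * (u \<bullet> (G *v u))"
        using norm_cauchy_schwarz[of x "G *v x"] mult_left_mono[OF norm_matrix_vector_le[of G x], of "norm x"]
        by (intro mult_right_mono pos) auto
      also have "\<dots> = (x \<bullet> x) * (norm G * (u \<bullet> (G *v u)))"
        by (simp add: dot_square_norm power2_eq_square)
      finally have *: "(x \<bullet> x) * (x \<bullet> x) \<le> (x \<bullet> x) * (norm G * (u \<bullet> (G *v u)))" by (simp add: power2_eq_square)
      have "x \<bullet> x \<le> norm G * (u \<bullet> (G *v u))"
      proof (cases "x = 0")
        case True
        then show ?thesis using pos[of u] by simp
      qed (use * in simp)
      then show ?thesis by (simp add: dot_square_norm x[symmetric] inner_commute u_def[symmetric])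
    qed
  qed
qed


lemma adaptive_law_exp_bounded:
  fixes R :: "real \<Rightarrow> real^'n^'n" and \<phi> thh Q :: "real \<Rightarrow> real^'n" and e :: "real \<Rightarrow> real"
  assumes psi: "psi > 0" and Gam: "sym_pos_def Gam"
    and cont: "continuous_on {0..} \<phi>"
    and e: "exp_bounded True (\<lambda>t. \<bar>e t - \<phi> t \<bullet> \<theta>\<bar>)"
    and th: "\<And>t. t \<ge> 0 \<Longrightarrow> (thh has_vector_derivative (- (Gam *v (R t *v thh t + Q t)))) (at t within {0..})"
    and R: "\<And>t. t \<ge> 0 \<Longrightarrow> (R has_vector_derivative
        (- psi *\<^sub>R R t + inverse (1 + (norm (\<phi> t))\<^sup>2) *\<^sub>R outer (\<phi> t) (\<phi> t))) (at t within {0..})"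
    and Q: "\<And>t. t \<ge> 0 \<Longrightarrow> (Q has_vector_derivative
        (- psi *\<^sub>R Q t - (e t / (1 + (norm (\<phi> t))\<^sup>2)) *\<^sub>R \<phi> t)) (at t within {0..})"
    and pe: "s \<Longrightarrow> (\<exists>M. \<forall>t\<ge>0. norm (\<phi> t) \<le> M) \<and> persistently_exciting \<phi>"
  shows "exp_bounded s (\<lambda>t. norm (\<theta> - thh t))"
proof -
  define E where "E = (\<lambda>t. R t *v \<theta> + Q t)"
  \<comment> \<open>The laws for \<open>R\<close> and \<open>Q\<close> are driven by the same
    normalized regressor, so only the regression residual remains as forcing of \<open>E\<close>.
    The normalized factor has norm at most 1, and \<open>r\<close> inherits the decay of the
    residual.\<close>
  define r where "r = (\<lambda>t. ((\<phi> t \<bullet> \<theta> - e t) / (1 + (norm (\<phi> t))\<^sup>2)) *\<^sub>R \<phi> t)"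
  have dE: "(E has_vector_derivative (- psi *\<^sub>R E t + r t)) (at t within {0..})" if "t \<ge> 0" for t
  proof -
    have "(E has_vector_derivative
        ((- psi *\<^sub>R R t + inverse (1 + (norm (\<phi> t))\<^sup>2) *\<^sub>R outer (\<phi> t) (\<phi> t)) *v \<theta>
         + (- psi *\<^sub>R Q t - (e t / (1 + (norm (\<phi> t))\<^sup>2)) *\<^sub>R \<phi> t))) (at t within {0..})"
      unfolding E_def
      by (intro has_vector_derivative_add bounded_linear.has_vector_derivative[OF bounded_linear_matrix_apply] R Q that)
    moreover have "(- psi *\<^sub>R R t + inverse (1 + (norm (\<phi> t))\<^sup>2) *\<^sub>R outer (\<phi> t) (\<phi> t)) *v \<theta>
         + (- psi *\<^sub>R Q t - (e t / (1 + (norm (\<phi> t))\<^sup>2)) *\<^sub>R \<phi> t) = - psi *\<^sub>R E t + r t"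
      unfolding matrix_vector_mult_add_rdistrib scaleR_matrix_vector_assoc[symmetric] outer_mult_vec E_def r_def
      by (simp add: left_diff_distrib scaleR_diff_left scaleR_add_right divide_inverse mult.commute)
    ultimately show ?thesis by simp
  qed
  have "exp_bounded True (\<lambda>t. norm (E t))"
  proof (rule exp_bounded_ode[OF _ _ _ psi])
    show "continuous_on {0..} E"
      unfolding continuous_on_eq_continuous_within using dE has_vector_derivative_continuous by fastforce
    show "(E has_vector_derivative (- psi *\<^sub>R E t + r t)) (at t)" if "t > 0" for t
      using dE[of t] that by (simp add: at_within_halfline)
    have "norm (r t) \<le> \<bar>e t - \<phi> t \<bullet> \<theta>\<bar>" for t
    proof -
      have p: "1 + (norm (\<phi> t))\<^sup>2 > 0" by (simp add: add_pos_nonneg)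
      have "norm (\<phi> t) \<le> 1 + (norm (\<phi> t))\<^sup>2"
        using sum_squares_bound[of "norm (\<phi> t)" 1] norm_ge_zero[of "\<phi> t"] by (simp del: norm_ge_zero)
      then have "norm (\<phi> t) / (1 + (norm (\<phi> t))\<^sup>2) \<le> 1" using p by simp
      then have "\<bar>e t - \<phi> t \<bullet> \<theta>\<bar> * (norm (\<phi> t) / (1 + (norm (\<phi> t))\<^sup>2)) \<le> \<bar>e t - \<phi> t \<bullet> \<theta>\<bar> * 1"
        by (intro mult_left_mono) auto
      moreover have "norm (r t) = \<bar>e t - \<phi> t \<bullet> \<theta>\<bar> * (norm (\<phi> t) / (1 + (norm (\<phi> t))\<^sup>2))"
        using p by (simp add: r_def abs_minus_commute)
      ultimately show ?thesis by simp
    qed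
    then show "exp_bounded True (\<lambda>t. norm (r t))" by (rule exp_bounded_mono[OF e])
  qed
  then obtain C \<mu>0 where C: "C \<ge> 0" and \<mu>0: "\<mu>0 > 0" and Eb: "\<And>t. t \<ge> 0 \<Longrightarrow> norm (E t) \<le> C * exp (- \<mu>0 * t)"
    unfolding exp_bounded_def by blast
  obtain \<alpha> c where \<alpha>: "\<alpha> \<ge> 0" "s \<longrightarrow> \<alpha> > 0" and c: "c \<ge> 0"
    and Rb: "\<And>t x. t \<ge> 0 \<Longrightarrow> (\<alpha> - c * exp (- psi * t)) * (norm x)\<^sup>2 \<le> x \<bullet> (R t *v x)"
    using normalized_regressor_lower_bound[OF psi cont R pe] by metis
  obtain P where PG: "P ** Gam = mat 1" and Psym: "\<And>x y. x \<bullet> (P *v y) = (P *v x) \<bullet> y"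
    and Plow: "\<And>x. (norm x)\<^sup>2 \<le> norm Gam * (x \<bullet> (P *v x))"
    using sym_pos_def_inverse[OF Gam] by blast
  define \<gamma> where "\<gamma> = norm Gam"
  have \<gamma>: "\<gamma> \<ge> 0" by (simp add: \<gamma>_def)
  \<comment> \<open>The added 1 makes the upper bound of the form strictly positive, so that it may
    be divided by.\<close>
  define p2 where "p2 = norm P + 1"
  have p2: "p2 > 0" by (simp add: p2_def add_nonneg_pos)
  have Pup: "x \<bullet> (P *v x) \<le> p2 * (norm x)\<^sup>2" for x
  proof -
    have "x \<bullet> (P *v x) \<le> norm x * norm (P *v x)" by (rule norm_cauchy_schwarz)
    also have "\<dots> \<le> norm x * (p2 * norm x)"
      using norm_matrix_vector_le[of P x] by (intro mult_left_mono) (auto simp: p2_def distrib_right intro: add_increasing2)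
    finally show ?thesis by (simp add: power2_eq_square mult_ac)
  qed
  define w where "w = (\<lambda>t. \<theta> - thh t)"
  have dw: "(w has_vector_derivative (Gam *v (E t - R t *v w t))) (at t within {0..})" if "t \<ge> 0" for t
  proof -
    have "(w has_vector_derivative (0 - (- (Gam *v (R t *v thh t + Q t))))) (at t within {0..})"
      unfolding w_def by (intro has_vector_derivative_diff has_vector_derivative_const th that)
    moreover have "R t *v thh t + Q t = E t - R t *v w t"
      by (simp add: E_def w_def matrix_vector_mult_diff_distrib)
    ultimately show ?thesis by simp
  qed
  define V where "V = (\<lambda>t. w t \<bullet> (P *v w t))"
  define V' where "V' = (\<lambda>t. 2 * (w t \<bullet> (E t - R t *v w t)))"
  have dV: "(V has_real_derivative V' t) (at t within {0..})" if "t \<ge> 0" for t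
  proof -
    have "bounded_linear ((*v) P)" by simp
    from bounded_linear.has_vector_derivative[OF this dw[OF that]]
    have dP: "((\<lambda>t. P *v w t) has_vector_derivative (E t - R t *v w t)) (at t within {0..})"
      by (simp add: matrix_vector_mul_assoc PG)
    have "(V has_vector_derivative (w t \<bullet> (E t - R t *v w t) + (Gam *v (E t - R t *v w t)) \<bullet> (P *v w t))) (at t within {0..})"
      unfolding V_def
      by (rule bounded_bilinear.has_vector_derivative[OF bounded_bilinear_inner dw[OF that] dP])
    moreover have "(Gam *v (E t - R t *v w t)) \<bullet> (P *v w t) = w t \<bullet> (E t - R t *v w t)"
      \<comment> \<open>Symmetry of \<open>P\<close> moves it across the inner product, where it
        cancels \<open>Gam\<close>; the two halves of the derivative of \<open>V\<close> are
        therefore equal.\<close>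
      by (subst Psym) (simp add: matrix_vector_mul_assoc PG inner_commute)
    ultimately show ?thesis by (simp add: V'_def has_real_derivative_iff_has_vector_derivative)
  qed
  define \<mu> where "\<mu> = min \<mu>0 psi"
  have \<mu>: "\<mu> > 0" using \<mu>0 psi by (simp add: \<mu>_def)
  \<comment> \<open>The first entry is the decay that the lower bound on \<open>R\<close> provides
    relative to \<open>V\<close>; the second keeps \<open>a\<close> strictly below the rate
    \<open>\<mu>\<close> of the defects. When \<open>\<alpha> = 0\<close> this gives
    \<open>a = 0\<close>, and only boundedness results.\<close>
  define a where "a = min (2 * \<alpha> / p2) (\<mu> / 2)"
  have a: "a \<ge> 0" "s \<longrightarrow> a > 0" "a < \<mu>" "a \<le> 2 * \<alpha> / p2" using \<alpha> p2 \<mu> by (auto simp: a_def)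
  have V0: "V t \<ge> 0" for t
  proof (cases "w t = 0")
    case False
    then have "0 < (norm (w t))\<^sup>2" by simp
    also have "\<dots> \<le> \<gamma> * V t" using Plow[of "w t"] by (simp add: V_def \<gamma>_def)
    finally show ?thesis using \<gamma> by (simp add: zero_less_mult_iff)
  qed (simp add: V_def)
  have bd: "V' t \<le> ((C + 2 * c) * \<gamma> * exp (- \<mu> * t) - a) * V t + C * exp (- \<mu> * t)" if "t > 0" for t
  proof -
    let ?n = "norm (w t)"
    have e1: "exp (- \<mu>0 * t) \<le> exp (- \<mu> * t)" "exp (- psi * t) \<le> exp (- \<mu> * t)"
      using that by (auto simp: \<mu>_def min_def intro: mult_right_mono)
    have "norm (E t) \<le> C * exp (- \<mu> * t)"
      using Eb[of t] mult_left_mono[OF e1(1) C] that by simp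
    then have "2 * (w t \<bullet> E t) \<le> 2 * (?n * (C * exp (- \<mu> * t)))"
      using norm_cauchy_schwarz[of "w t" "E t"] mult_left_mono[of "norm (E t)" "C * exp (- \<mu> * t)" ?n] by simp
    \<comment> \<open>Twice the norm is at most its square plus 1. The term linear in the parameter
      error is thereby split into a decaying perturbation of the rate and a decaying source, as the
      Gronwall lemma requires.\<close>
    also have "\<dots> = (C * exp (- \<mu> * t)) * (2 * ?n * 1)" by simp
    also have "\<dots> \<le> (C * exp (- \<mu> * t)) * (?n\<^sup>2 + 1\<^sup>2)"
      using C by (intro mult_left_mono sum_squares_bound) auto
    finally have 1: "2 * (w t \<bullet> E t) \<le> C * exp (- \<mu> * t) * ?n\<^sup>2 + C * exp (- \<mu> * t)" by (simp add: algebra_simps)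
    have "c * exp (- psi * t) * ?n\<^sup>2 \<le> c * exp (- \<mu> * t) * ?n\<^sup>2"
      using c e1 by (intro mult_right_mono mult_left_mono) auto
    then have 2: "- 2 * (w t \<bullet> (R t *v w t)) \<le> 2 * c * exp (- \<mu> * t) * ?n\<^sup>2 - 2 * \<alpha> * ?n\<^sup>2"
      using Rb[of t "w t"] that by (simp add: algebra_simps)
    have 3: "(C + 2 * c) * exp (- \<mu> * t) * ?n\<^sup>2 \<le> (C + 2 * c) * exp (- \<mu> * t) * (\<gamma> * V t)"
      using Plow[of "w t"] C c by (intro mult_left_mono) (auto simp: V_def \<gamma>_def)
    have 4: "a * V t \<le> 2 * \<alpha> * ?n\<^sup>2"
    proof -
      have "a * V t \<le> (2 * \<alpha> / p2) * V t" by (intro mult_right_mono a V0)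
      also have "\<dots> \<le> (2 * \<alpha> / p2) * (p2 * ?n\<^sup>2)"
        using Pup[of "w t"] \<alpha> p2 by (intro mult_left_mono) (auto simp: V_def)
      finally show ?thesis using p2 by simp
    qed
    have "V' t = 2 * (w t \<bullet> E t) + - 2 * (w t \<bullet> (R t *v w t))" by (simp add: V'_def inner_diff_right)
    then show ?thesis using 1 2 3 4 by (simp add: algebra_simps)
  qed
  have "continuous_on {0..} V" using DERIV_continuous_on[of "{0..}" V] dV by auto
  moreover have "(V has_real_derivative V' t) (at t)" if "t > 0" for t
    using dV[of t] that by (simp add: at_within_halfline)
  ultimately have Vb: "V t \<le> exp ((C + 2 * c) * \<gamma> / \<mu>) * ((V 0 + C / \<bar>a - \<mu>\<bar>) * exp (- min a \<mu> * t))" if "t \<ge> 0" for t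
    by (rule gronwall_exp[OF _ _ bd V0 \<mu>]) (use that C c \<gamma> a in auto)
  define K where "K = \<gamma> * (exp ((C + 2 * c) * \<gamma> / \<mu>) * (V 0 + C / \<bar>a - \<mu>\<bar>))"
  have K: "K \<ge> 0" using \<gamma> V0[of 0] C by (simp add: K_def)
  show ?thesis
  proof (rule exp_boundedI[of "sqrt K" "a / 2"])
    fix t :: real assume t: "t \<ge> 0"
    have "(norm (w t))\<^sup>2 \<le> \<gamma> * V t" using Plow[of "w t"] by (simp add: V_def \<gamma>_def)
    also have "\<dots> \<le> \<gamma> * (exp ((C + 2 * c) * \<gamma> / \<mu>) * ((V 0 + C / \<bar>a - \<mu>\<bar>) * exp (- min a \<mu> * t)))"
      by (intro mult_left_mono Vb t \<gamma>)
    also have "\<dots> = K * exp (- a * t)" using a by (simp add: K_def min_def)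
    also have "exp (- a * t) = (exp (- (a / 2) * t))\<^sup>2" by (simp add: exp_double[symmetric])
    also have "K * (exp (- (a / 2) * t))\<^sup>2 = (sqrt K * exp (- (a / 2) * t))\<^sup>2" using K by (simp add: power_mult_distrib)
    finally have "norm (w t) \<le> sqrt K * exp (- (a / 2) * t)" by (rule power2_le_imp_le) (use K in simp)
    then show "norm (\<theta> - thh t) \<le> sqrt K * exp (- (a / 2) * t)" by (simp add: w_def)
  qed (use K a in auto)
qed

section \<open>The observer error\<close>

lemma L2norm_le_sup:
  assumes f: "L2_01 f" and le: "\<And>\<xi>. \<xi> \<in> {0..1} \<Longrightarrow> norm (f \<xi>) \<le> c"
  shows "L2norm f \<le> c"
proof (rule power2_le_imp_le)
  show c: "c \<ge> 0" using le[of 0] order_trans[OF norm_ge_zero] by auto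
  have "(L2norm f)\<^sup>2 \<le> (\<integral>\<xi>. indicator {0<..<1} \<xi> * c\<^sup>2 \<partial>(lborel::real measure))"
    unfolding L2norm_power2
  proof (rule Bochner_Integration.integral_mono)
    show "integrable lborel (\<lambda>\<xi>. (norm (cut01 f \<xi>))\<^sup>2)" using f by (simp add: L2_01_iff)
    show "integrable lborel (\<lambda>\<xi>::real. indicator {0<..<1} \<xi> * c\<^sup>2)" by simp
    show "(norm (cut01 f \<xi>))\<^sup>2 \<le> indicator {0<..<1} \<xi> * c\<^sup>2" for \<xi>
      using le[of \<xi>] by (auto simp: cut01_def indicator_def intro!: power_mono)
  qed
  then show "(L2norm f)\<^sup>2 \<le> c\<^sup>2" by simp
qed

text \<open>The bound is assumed for every weak derivative and so applies to the one that
  \<open>SOME\<close> selects inside \<open>H1norm\<close>. The L2 part of that norm is bounded by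
  the same \<open>c\<close> through the supremum, hence \<open>2 * c\<close>.\<close>

lemma Ynorm_le:
  assumes f: "\<exists>g. weak_deriv01 f g" and f0: "f 0 = 0" and le: "\<And>g. weak_deriv01 f g \<Longrightarrow> L2norm g \<le> c"
  shows "Ynorm X f \<le> norm X + 2 * c"
proof -
  define g where "g = (SOME g. weak_deriv01 f g)"
  have g: "weak_deriv01 f g" unfolding g_def using f by (rule someI_ex)
  have c: "L2norm g \<le> c" "c \<ge> 0" using le[OF g] L2norm_nonneg[of g] by (simp, linarith)
  have "L2norm f \<le> c"
    by (rule L2norm_le_sup[OF continuous_imp_L2_01[OF weak_deriv01_continuous[OF g]]])
      (use weak_deriv01_bound[OF g f0] c in force)
  then have "H1norm f \<le> c + c"
    unfolding H1norm_def g_def[symmetric] using c sqrt_sum_squares_le_sum[of "L2norm f" "L2norm g"] by simp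
  moreover have "H1norm f \<ge> 0" by (simp add: H1norm_def)
  ultimately show ?thesis
    unfolding Ynorm_def using sqrt_sum_squares_le_sum[of "norm X" "H1norm f"] by simp
qed

lemma Ynorm_leD:
  assumes f: "\<exists>g. weak_deriv01 f g" and le: "Ynorm X f \<le> M"
  shows "norm X \<le> M" "\<exists>g. weak_deriv01 f g \<and> L2norm g \<le> M"
proof -
  have "norm X \<le> Ynorm X f" "H1norm f \<le> Ynorm X f"
    unfolding Ynorm_def by (auto intro: real_le_rsqrt)
  with le show "norm X \<le> M" by simp
  have "L2norm (SOME g. weak_deriv01 f g) \<le> H1norm f"
    unfolding H1norm_def by (auto intro: real_le_rsqrt)
  with le \<open>H1norm f \<le> Ynorm X f\<close> someI_ex[OF f] show "\<exists>g. weak_deriv01 f g \<and> L2norm g \<le> M"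
    by (meson order_trans)
qed

section \<open>Integral operators with continuous kernels\<close>

lemma set_integrable_kernel:
  fixes K :: "real \<Rightarrow> real^'n^'m" and \<zeta> :: "real \<Rightarrow> real^'n"
  assumes "continuous_on {0..1} K" "continuous_on {0..1} \<zeta>"
  shows "set_integrable lborel {0..1} (\<lambda>\<xi>. K \<xi> *v \<zeta> \<xi>)"
proof (rule borel_integrable_atLeastAtMost')
  show "continuous_on {0..1} (\<lambda>\<xi>. K \<xi> *v \<zeta> \<xi>)"
    unfolding matrix_vector_mult_def
    by (intro continuous_intros assms)
qed

lemma kernel_bound:
  fixes K :: "real \<Rightarrow> real^'n^'m"
  assumes K: "continuous_on {0..1} K"
  obtains k where "k \<ge> 0"
    "\<And>\<zeta> c. continuous_on {0..1} \<zeta> \<Longrightarrow> (\<And>\<xi>. \<xi> \<in> {0..1} \<Longrightarrow> norm (\<zeta> \<xi>) \<le> c) \<Longrightarrow>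
      norm (LINT \<xi>:{0..1}|lborel. K \<xi> *v \<zeta> \<xi>) \<le> k * c"
proof -
  have "bounded (K ` {0..1})" by (intro compact_imp_bounded compact_continuous_image K) simp
  then obtain k where k: "k > 0" "\<And>\<xi>. \<xi> \<in> {0..1} \<Longrightarrow> norm (K \<xi>) \<le> k" by (auto simp: bounded_pos)
  show thesis
  proof (rule that[of k])
    fix \<zeta> :: "real \<Rightarrow> real^'n" and c
    assume z: "continuous_on {0..1} \<zeta>" and c: "\<And>\<xi>. \<xi> \<in> {0..1} \<Longrightarrow> norm (\<zeta> \<xi>) \<le> c"
    note int = set_integrable_kernel[OF K z]
    have "norm (LINT \<xi>:{0..1}|lborel. K \<xi> *v \<zeta> \<xi>) \<le> (LINT \<xi>:{0..1}|lborel. norm (K \<xi> *v \<zeta> \<xi>))"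
      by (rule set_integral_norm_bound[OF int])
    also have "\<dots> \<le> (LINT \<xi>:{0..1}|(lborel::real measure). k * c)"
    proof (rule set_integral_mono)
      show "set_integrable lborel {0..1} (\<lambda>\<xi>. norm (K \<xi> *v \<zeta> \<xi>))" by (rule set_integrable_norm[OF int])
      show "set_integrable lborel {0..1} (\<lambda>\<xi>::real. k * c)" by (simp add: set_integrable_def)
      show "norm (K \<xi> *v \<zeta> \<xi>) \<le> k * c" if "\<xi> \<in> {0..1}" for \<xi>
        by (rule order_trans[OF norm_matrix_vector_le]) (use k that c[OF that] in \<open>auto intro: mult_mono\<close>)
    qed
    also have "\<dots> = k * c" by (simp add: set_lebesgue_integral_def)
    finally show "norm (LINT \<xi>:{0..1}|lborel. K \<xi> *v \<zeta> \<xi>) \<le> k * c" .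
  qed (use k in simp)
qed

lemma Kop2_diff:
  assumes "continuous_on {0..1} K" "continuous_on {0..1} f" "continuous_on {0..1} g"
  shows "Kop2 K (\<lambda>\<xi>. f \<xi> - g \<xi>) = Kop2 K f - Kop2 K g"
  unfolding Kop2_def matrix_vector_mult_diff_distrib
  by (rule set_integral_diff(2)[OF set_integrable_kernel set_integrable_kernel]) (use assms in auto)

lemma Kop1_diff:
  assumes "continuous_on {0..1} K" "continuous_on {0..1} f" "continuous_on {0..1} g"
  shows "Kop1 K K' (\<lambda>\<xi>. f \<xi> - g \<xi>) = Kop1 K K' f - Kop1 K K' g"
  using Kop2_diff[OF assms] by (simp add: Kop1_def Kop2_def matrix_vector_mult_diff_distrib)

lemma C1_halfline_continuous: "C1_halfline f \<Longrightarrow> continuous_on {0..} f"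
  unfolding C1_halfline_def continuous_on_eq_continuous_within
  by (auto intro: has_vector_derivative_continuous)

lemma classical_regD:
  assumes "classical_reg X z"
  shows "continuous_on {0..} X" "\<And>t. t \<ge> 0 \<Longrightarrow> \<exists>w. L2_has_deriv z w t"
    "\<And>t. t \<ge> 0 \<Longrightarrow> H1_01 (z t)" "\<And>t. t \<ge> 0 \<Longrightarrow> z t 0 = 0" "\<And>t. t \<ge> 0 \<Longrightarrow> \<exists>g. weak_deriv01 (z t) g"
  using assms unfolding classical_reg_def H1_01_def by (auto simp: C1_halfline_continuous)

text \<open>The filters are chosen so that the output error obeys the linear regression
  \<open>Z\<^sub>1 - \<zeta> = \<theta> \<bullet> \<phi>\<close> up to a term decaying like \<open>exp (- rho * t)\<close>.\<close>
lemma filtered_regression: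
  fixes varphi Y :: "real \<Rightarrow> real^'n" and zeta1 zeta2 :: "real \<Rightarrow> real"
  assumes rho: "rho > 0"
    and Y: "\<And>t. t \<ge> 0 \<Longrightarrow> (Y has_vector_derivative Y' t) (at t within {0..})"
    and Y2: "\<And>t. t \<ge> 0 \<Longrightarrow> (\<Sum>i\<in>UNIV. Y2 t $ i) = theta \<bullet> r t + (\<Sum>i\<in>UNIV. Y' t $ i)"
    and filt1: "\<And>t. t \<ge> 0 \<Longrightarrow> (zeta1 has_real_derivative (- rho * (zeta1 t - (\<Sum>i\<in>UNIV. Y t $ i)))) (at t within {0..})"
    and filt2: "\<And>t. t \<ge> 0 \<Longrightarrow> (zeta2 has_real_derivative (- rho * zeta2 t + (\<Sum>i\<in>UNIV. Y2 t $ i))) (at t within {0..})"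
    and filt3: "\<And>t. t \<ge> 0 \<Longrightarrow> (varphi has_vector_derivative (- rho *\<^sub>R varphi t - r t)) (at t within {0..})"
  shows "exp_bounded True (\<lambda>t. \<bar>((\<Sum>i\<in>UNIV. Y t $ i) - (zeta1 t + zeta2 t)) - varphi t \<bullet> theta\<bar>)"
proof -
  \<comment> \<open>In the derivative of this residual, \<open>Y'\<close> from the output cancels
    \<open>Y'\<close> inside \<open>Y2\<close>, and \<open>theta \<bullet> r t\<close> from
    \<open>Y2\<close> cancels against the input of the third filter. What remains is
    \<open>- rho\<close> times the residual.\<close>
  define \<epsilon> where "\<epsilon> = (\<lambda>t. ((\<Sum>i\<in>UNIV. Y t $ i) - (zeta1 t + zeta2 t)) - varphi t \<bullet> theta)"
  have d: "(\<epsilon> has_vector_derivative (- rho *\<^sub>R \<epsilon> t + 0)) (at t within {0..})" if "t \<ge> 0" for t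
  proof -
    have "((\<lambda>t. \<Sum>i\<in>UNIV. Y t $ i) has_vector_derivative (\<Sum>i\<in>UNIV. Y' t $ i)) (at t within {0..})"
      by (intro has_vector_derivative_sum bounded_linear.has_vector_derivative[OF bounded_linear_vec_nth] Y that)
    moreover have "((\<lambda>t. varphi t \<bullet> theta) has_vector_derivative ((- rho *\<^sub>R varphi t - r t) \<bullet> theta)) (at t within {0..})"
      by (rule bounded_linear.has_vector_derivative[OF bounded_linear_inner_left filt3[OF that]])
    ultimately have "(\<epsilon> has_vector_derivative ((\<Sum>i\<in>UNIV. Y' t $ i)
        - ((- rho * (zeta1 t - (\<Sum>i\<in>UNIV. Y t $ i))) + (- rho * zeta2 t + (\<Sum>i\<in>UNIV. Y2 t $ i)))
        - (- rho *\<^sub>R varphi t - r t) \<bullet> theta)) (at t within {0..})"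
      unfolding \<epsilon>_def using filt1[OF that] filt2[OF that]
      by (intro has_vector_derivative_diff has_vector_derivative_add)
        (simp_all add: has_real_derivative_iff_has_vector_derivative)
    then show ?thesis
      unfolding Y2[OF that] by (simp add: \<epsilon>_def inner_diff_left inner_commute[of theta] algebra_simps)
  qed
  have "exp_bounded True (\<lambda>t. norm (\<epsilon> t))"
  proof (rule exp_bounded_ode[OF _ _ _ rho])
    show "continuous_on {0..} \<epsilon>"
      unfolding continuous_on_eq_continuous_within using d has_vector_derivative_continuous by fastforce
    show "(\<epsilon> has_vector_derivative - rho *\<^sub>R \<epsilon> t + 0) (at t)" if "t > 0" for t
      using d[of t] that by (simp add: at_within_halfline)
    show "exp_bounded True (\<lambda>t. norm (0::real))" by (intro exp_boundedI[of 0 1]) auto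
  qed
  then show ?thesis by (simp add: \<epsilon>_def)
qed

text \<open>\<open>S\<close>, \<open>p\<close> and \<open>b\<close> stand for terms that plant and
  observer share. The errors form a cascade: the PDE error does not feel the ODE error, so it is
  estimated first and then acts as a source in the Hurwitz system.\<close>

lemma observer_error_exp_bounded:
  fixes A1 :: "real^'nx^'nx" and A2 :: "real^'nx^'nz" and G1 L1 :: "real^'nz^'nx"
    and lam theta :: "real^'nz" and S :: "real \<Rightarrow> real^'nz^'nz" and K1 K2 K3
    and X Xh p :: "real \<Rightarrow> real^'nx" and z zh :: "real \<Rightarrow> real \<Rightarrow> real^'nz" and b thh :: "real \<Rightarrow> real^'nz"
  assumes lam: "\<And>i. lam $ i > 0"
    and K1: "continuous_on {0..1} K1" and K3: "continuous_on {0..1} K3"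
    and hur: "hurwitz (A1 + L1 ** A2)"
    and reg: "classical_reg X z" and regh: "classical_reg Xh zh"
    and bounded: "\<And>t. t \<ge> 0 \<Longrightarrow> Ynorm (X t) (z t) \<le> M"
    and S: "\<And>t. t \<ge> 0 \<Longrightarrow> norm (S t) \<le> Sb"
    and th: "exp_bounded s (\<lambda>t. norm (theta - thh t))"
    and ode: "\<And>t. t > 0 \<Longrightarrow> (X has_vector_derivative
        (A1 *v X t + G1 *v Kop1 K1 K2 (z t) + G1 *v ((diagm theta ** S t) *v Kop2 K3 (z t)) + p t)) (at t)"
    and odeh: "\<And>t. t > 0 \<Longrightarrow> (Xh has_vector_derivative
        (A1 *v Xh t + G1 *v Kop1 K1 K2 (zh t) + G1 *v ((diagm (thh t) ** S t) *v Kop2 K3 (zh t)) + p t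
         - L1 *v (A2 *v (X t - Xh t)))) (at t)"
    and pde: "\<And>t. t > 0 \<Longrightarrow> transport_eq z lam (\<lambda>\<xi> \<zeta>. (diagm theta ** S t) *v \<zeta> + b t) t"
    and pdeh: "\<And>t. t > 0 \<Longrightarrow> transport_eq zh lam (\<lambda>\<xi> \<zeta>. (diagm (thh t) ** S t) *v \<zeta> + b t) t"
  shows "exp_bounded s (\<lambda>t. Ynorm (X t - Xh t) (\<lambda>\<xi>. z t \<xi> - zh t \<xi>))"
proof -
  note rz = classical_regD[OF reg] and rzh = classical_regD[OF regh]
  have M: "M \<ge> 0" using Ynorm_leD(1)[OF rz(5) bounded, of 0] order_trans[OF norm_ge_zero] by blast
  have Sb: "Sb \<ge> 0" using S[of 0] order_trans[OF norm_ge_zero] by simp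
  have zw: "\<exists>g. weak_deriv01 (z t) g \<and> L2norm g \<le> M" if "t \<ge> 0" for t
    by (rule Ynorm_leD(2)[OF rz(5) bounded]) (rule that)+
  have zc: "continuous_on {0..1} (z t)" "continuous_on {0..1} (zh t)" if "t \<ge> 0" for t
    using rz(5)[OF that] rzh(5)[OF that] weak_deriv01_continuous by blast+
  have zL: "L2_01 (z t)" "L2_01 (zh t)" if "t \<ge> 0" for t
    using zc[OF that] by (auto intro: continuous_imp_L2_01)
  have zsup: "norm (z t \<xi>) \<le> M" if "t \<ge> 0" "\<xi> \<in> {0..1}" for t \<xi>
  proof -
    obtain g where g: "weak_deriv01 (z t) g" "L2norm g \<le> M" using zw[OF \<open>t \<ge> 0\<close>] by blast
    show ?thesis using weak_deriv01_bound[OF g(1) rz(4)[OF that(1)] that(2)] g(2) by simp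
  qed
  define y where "y = (\<lambda>t \<xi>. z t \<xi> - zh t \<xi>)"
  obtain d \<kappa> where d: "d \<ge> 0" and \<kappa>: "\<kappa> \<ge> 0" "s \<longrightarrow> \<kappa> > 0"
    and thb: "\<And>t. t \<ge> 0 \<Longrightarrow> norm (theta - thh t) \<le> d * exp (- \<kappa> * t)"
    using th unfolding exp_bounded_def by blast
  have thh: "norm (thh t) \<le> norm theta + d" if "t \<ge> 0" for t
  proof -
    have "d * exp (- \<kappa> * t) \<le> d * 1" using d \<kappa> that by (intro mult_left_mono) auto
    then have "norm (theta - thh t) \<le> d" using thb[OF that] by simp
    then show ?thesis using norm_triangle_ineq4[of theta "theta - thh t"] by simp
  qed
  have DS: "norm ((diagm v ** S t) *v x) \<le> norm v * Sb * norm x" if "t \<ge> 0" for v t x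
  proof -
    have "norm ((diagm v ** S t) *v x) \<le> norm v * norm (S t *v x)"
      unfolding matrix_vector_mul_assoc[symmetric] by (rule norm_diagm_vector_le)
    also have "\<dots> \<le> norm v * (Sb * norm x)"
      by (intro mult_left_mono order_trans[OF norm_matrix_vector_le] mult_right_mono S that) auto
    finally show ?thesis by (simp add: mult.assoc)
  qed
  have diagm_diff: "diagm (u - v) ** N = diagm u ** N - diagm v ** N" for u v and N :: "real^'nz^'nz"
    by (simp add: matrix_matrix_mult_def diagm_def vec_eq_iff if_distrib if_distribR algebra_simps cong: if_cong)
  define l where "l = Min (range (\<lambda>i. lam $ i))"
  have l: "l > 0" "\<And>i. l \<le> lam $ i" using lam by (auto simp: l_def)
  \<comment> \<open>A uniform bound for the zero-order coefficient, which contains the estimate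
    \<open>thh\<close>. That estimate stays within \<open>d\<close> of \<open>theta\<close> because
    the parameter error is bounded even when \<open>\<kappa> = 0\<close>.\<close>
  define \<beta> where "\<beta> = (norm theta + d) * Sb"
  have \<beta>: "\<beta> \<ge> 0" using d Sb by (simp add: \<beta>_def)
  have "\<exists>C\<ge>0. \<forall>t\<ge>0. \<forall>g. weak_deriv01 (y t) g \<longrightarrow> L2norm g \<le> C * exp (- \<kappa> * t)"
  proof (rule transport_weak_deriv_bound[where B = "\<lambda>t. diagm (thh t) ** S t"
        and D = "\<lambda>t. diagm (theta - thh t) ** S t" and s = z and lam = lam and M = M and d = "d * Sb" and \<beta> = \<beta> and l = l])
    show "\<exists>g. weak_deriv01 (y t) g" if "t \<ge> 0" for t
      using rz(5)[OF that] rzh(5)[OF that] weak_deriv01_diff unfolding y_def by blast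
    show "\<exists>w. L2_has_deriv y w t" if t: "t \<ge> 0" for t
    proof -
      obtain w w' where "L2_has_deriv z w t" "L2_has_deriv zh w' t" using rz(2)[OF t] rzh(2)[OF t] by blast
      from L2_has_deriv_diff[OF this t zL] show ?thesis unfolding y_def by blast
    qed
    show "y t 0 = 0" if "t \<ge> 0" for t using rz(4)[OF that] rzh(4)[OF that] by (simp add: y_def)
    show "\<exists>w g. L2_has_deriv y w t \<and> weak_deriv01 (y t) g \<and> (AE \<xi> in lborel. \<xi> \<in> {0<..<1} \<longrightarrow>
        w \<xi> + diagm lam *v g \<xi> = (diagm (thh t) ** S t) *v y t \<xi> + (diagm (theta - thh t) ** S t) *v z t \<xi>)"
      if t: "t > 0" for t
    proof -
      have t': "t \<ge> 0" using t by simp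
      obtain w g where wg: "L2_has_deriv z w t" "weak_deriv01 (z t) g"
        "AE \<xi> in lborel. \<xi> \<in> {0<..<1} \<longrightarrow> w \<xi> + diagm lam *v g \<xi> = (diagm theta ** S t) *v z t \<xi> + b t"
        using pde[OF t] unfolding transport_eq_def by blast
      obtain w' g' where wg': "L2_has_deriv zh w' t" "weak_deriv01 (zh t) g'"
        "AE \<xi> in lborel. \<xi> \<in> {0<..<1} \<longrightarrow> w' \<xi> + diagm lam *v g' \<xi> = (diagm (thh t) ** S t) *v zh t \<xi> + b t"
        using pdeh[OF t] unfolding transport_eq_def by blast
      have "L2_has_deriv y (\<lambda>\<xi>. w \<xi> - w' \<xi>) t"
        unfolding y_def by (rule L2_has_deriv_diff[OF wg(1) wg'(1) t' zL])
      moreover have "weak_deriv01 (y t) (\<lambda>\<xi>. g \<xi> - g' \<xi>)"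
        unfolding y_def by (rule weak_deriv01_diff[OF wg(2) wg'(2)])
      moreover have "AE \<xi> in lborel. \<xi> \<in> {0<..<1} \<longrightarrow> (w \<xi> - w' \<xi>) + diagm lam *v (g \<xi> - g' \<xi>)
          = (diagm (thh t) ** S t) *v y t \<xi> + (diagm (theta - thh t) ** S t) *v z t \<xi>"
        using wg(3) wg'(3)
      proof eventually_elim
        case (elim \<xi>)
        show ?case
        proof
          assume \<xi>: "\<xi> \<in> {0<..<1}"
          have "(w \<xi> - w' \<xi>) + diagm lam *v (g \<xi> - g' \<xi>) = (w \<xi> + diagm lam *v g \<xi>) - (w' \<xi> + diagm lam *v g' \<xi>)"
            by (simp add: matrix_vector_mult_diff_distrib)
          also have "\<dots> = ((diagm theta ** S t) *v z t \<xi> + b t) - ((diagm (thh t) ** S t) *v zh t \<xi> + b t)"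
            using elim \<xi> by simp
          \<comment> \<open>The difference of the products is split so that the parameter error
            multiplies the plant state \<open>z\<close>, which is bounded by assumption, while the
            estimate multiplies the error itself.\<close>
          also have "\<dots> = (diagm (thh t) ** S t) *v y t \<xi> + (diagm (theta - thh t) ** S t) *v z t \<xi>"
            by (simp add: y_def diagm_diff matrix_vector_mult_diff_distrib matrix_vector_mult_diff_rdistrib)
          finally show "(w \<xi> - w' \<xi>) + diagm lam *v (g \<xi> - g' \<xi>)
            = (diagm (thh t) ** S t) *v y t \<xi> + (diagm (theta - thh t) ** S t) *v z t \<xi>" .
        qed
      qed
      ultimately show ?thesis by blast
    qed
    show "norm ((diagm (thh t) ** S t) *v x) \<le> \<beta> * norm x" if "t > 0" for t x
    proof -
      have "norm (thh t) * Sb * norm x \<le> \<beta> * norm x"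
        unfolding \<beta>_def using thh[of t] that Sb by (intro mult_right_mono) auto
      then show ?thesis using DS[of t "thh t" x] that by simp
    qed
    show "norm ((diagm (theta - thh t) ** S t) *v x) \<le> d * Sb * exp (- \<kappa> * t) * norm x" if "t > 0" for t x
    proof -
      have "norm (theta - thh t) * Sb * norm x \<le> (d * exp (- \<kappa> * t)) * Sb * norm x"
        using thb[of t] that Sb by (intro mult_right_mono) auto
      then show ?thesis using DS[of t "theta - thh t" x] that by (simp add: mult_ac)
    qed
    show "\<exists>g. weak_deriv01 (z t) g \<and> L2norm g \<le> M" if "t > 0" for t using zw that by simp
    show "z t 0 = 0" if "t > 0" for t using rz(4) that by simp
  qed (use l \<beta> \<kappa> d Sb M in auto)
  then obtain C where C: "C \<ge> 0" and yb: "\<And>t g. t \<ge> 0 \<Longrightarrow> weak_deriv01 (y t) g \<Longrightarrow> L2norm g \<le> C * exp (- \<kappa> * t)"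
    by blast
  have yw: "\<exists>g. weak_deriv01 (y t) g" if "t \<ge> 0" for t
    using rz(5)[OF that] rzh(5)[OF that] weak_deriv01_diff unfolding y_def by blast
  have y0: "y t 0 = 0" if "t \<ge> 0" for t using rz(4)[OF that] rzh(4)[OF that] by (simp add: y_def)
  have yc: "continuous_on {0..1} (y t)" if "t \<ge> 0" for t unfolding y_def by (intro continuous_intros zc that)
  have ysup: "norm (y t \<xi>) \<le> C * exp (- \<kappa> * t)" if "t \<ge> 0" "\<xi> \<in> {0..1}" for t \<xi>
  proof -
    obtain g where g: "weak_deriv01 (y t) g" using yw[OF \<open>t \<ge> 0\<close>] by blast
    show ?thesis using weak_deriv01_bound[OF g y0[OF that(1)] that(2)] yb[OF that(1) g] by simp
  qed
  obtain k1 where k1: "k1 \<ge> 0" "\<And>\<zeta> c. continuous_on {0..1} \<zeta> \<Longrightarrow> (\<And>\<xi>. \<xi> \<in> {0..1} \<Longrightarrow> norm (\<zeta> \<xi>) \<le> c) \<Longrightarrow>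
      norm (LINT \<xi>:{0..1}|lborel. K1 \<xi> *v \<zeta> \<xi>) \<le> k1 * c" using kernel_bound[OF K1] by blast
  obtain k3 where k3: "k3 \<ge> 0" "\<And>\<zeta> c. continuous_on {0..1} \<zeta> \<Longrightarrow> (\<And>\<xi>. \<xi> \<in> {0..1} \<Longrightarrow> norm (\<zeta> \<xi>) \<le> c) \<Longrightarrow>
      norm (Kop2 K3 \<zeta>) \<le> k3 * c" using kernel_bound[OF K3] unfolding Kop2_def by blast
  \<comment> \<open>Every summand contains either the PDE error or the parameter error, both of
    order \<open>exp (- \<kappa> * t)\<close>; the remaining factors are bounded.\<close>
  define f where "f = (\<lambda>t. G1 *v Kop1 K1 K2 (y t) + G1 *v ((diagm (thh t) ** S t) *v Kop2 K3 (y t)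
    + (diagm (theta - thh t) ** S t) *v Kop2 K3 (z t)))"
  have "exp_bounded s (\<lambda>t. norm (X t - Xh t))"
  proof (rule hurwitz_ode_exp_bounded[OF hur])
    show "continuous_on {0..} (\<lambda>t. X t - Xh t)" by (intro continuous_intros rz rzh)
    show "((\<lambda>t. X t - Xh t) has_vector_derivative ((A1 + L1 ** A2) *v (X t - Xh t) + f t)) (at t)" if t: "t > 0" for t
    proof -
      have k: "Kop1 K1 K2 (y t) = Kop1 K1 K2 (z t) - Kop1 K1 K2 (zh t)" "Kop2 K3 (y t) = Kop2 K3 (z t) - Kop2 K3 (zh t)"
        unfolding y_def using t K1 K3 zc[of t] by (auto intro: Kop1_diff Kop2_diff)
      have "((\<lambda>t. X t - Xh t) has_vector_derivative
        ((A1 *v X t + G1 *v Kop1 K1 K2 (z t) + G1 *v ((diagm theta ** S t) *v Kop2 K3 (z t)) + p t)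
        - (A1 *v Xh t + G1 *v Kop1 K1 K2 (zh t) + G1 *v ((diagm (thh t) ** S t) *v Kop2 K3 (zh t)) + p t
         - L1 *v (A2 *v (X t - Xh t))))) (at t)"
        by (rule has_vector_derivative_diff[OF ode[OF t] odeh[OF t]])
      moreover have "(A1 *v X t + G1 *v Kop1 K1 K2 (z t) + G1 *v ((diagm theta ** S t) *v Kop2 K3 (z t)) + p t)
        - (A1 *v Xh t + G1 *v Kop1 K1 K2 (zh t) + G1 *v ((diagm (thh t) ** S t) *v Kop2 K3 (zh t)) + p t
         - L1 *v (A2 *v (X t - Xh t))) = (A1 + L1 ** A2) *v (X t - Xh t) + f t"
        unfolding f_def k diagm_diff
        by (simp add: matrix_vector_mult_diff_distrib matrix_vector_mult_diff_rdistrib matrix_vector_mult_add_rdistrib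
            matrix_vector_right_distrib matrix_vector_mul_assoc[symmetric])
      ultimately show ?thesis by simp
    qed
    show "exp_bounded s (\<lambda>t. norm (f t))"
    proof (rule exp_boundedI[of "norm G1 * ((k1 + norm K2) * C) + norm G1 * (\<beta> * (k3 * C) + d * Sb * (k3 * M))" \<kappa>])
      fix t :: real assume t: "t \<ge> 0"
      let ?e = "exp (- \<kappa> * t)"
      have 1: "norm (Kop1 K1 K2 (y t)) \<le> (k1 + norm K2) * C * ?e"
      proof -
        have "norm (Kop1 K1 K2 (y t)) \<le> k1 * (C * ?e) + norm K2 * (C * ?e)"
          unfolding Kop1_def
          by (intro norm_triangle_mono k1(2) yc ysup t order_trans[OF norm_matrix_vector_le] mult_left_mono) auto
        then show ?thesis by (simp add: algebra_simps)
      qed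
      have 2: "norm ((diagm (thh t) ** S t) *v Kop2 K3 (y t)) \<le> \<beta> * (k3 * (C * ?e))"
      proof -
        have "norm ((diagm (thh t) ** S t) *v Kop2 K3 (y t)) \<le> norm (thh t) * Sb * norm (Kop2 K3 (y t))" by (rule DS[OF t])
        also have "\<dots> \<le> \<beta> * (k3 * (C * ?e))"
          unfolding \<beta>_def using d Sb
          by (intro mult_mono mult_right_mono thh t k3(2) yc ysup) auto
        finally show ?thesis .
      qed
      have 3: "norm ((diagm (theta - thh t) ** S t) *v Kop2 K3 (z t)) \<le> d * ?e * Sb * (k3 * M)"
      proof -
        have "norm ((diagm (theta - thh t) ** S t) *v Kop2 K3 (z t)) \<le> norm (theta - thh t) * Sb * norm (Kop2 K3 (z t))" by (rule DS[OF t])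
        also have "\<dots> \<le> d * ?e * Sb * (k3 * M)"
          using d Sb by (intro mult_mono mult_right_mono thb t k3(2) zc zsup) auto
        finally show ?thesis .
      qed
      have "norm (f t) \<le> norm G1 * ((k1 + norm K2) * C * ?e) + norm G1 * (\<beta> * (k3 * (C * ?e)) + d * ?e * Sb * (k3 * M))"
        unfolding f_def
        by (intro norm_triangle_mono order_trans[OF norm_matrix_vector_le] mult_left_mono 1 2 3) auto
      also have "\<dots> = (norm G1 * ((k1 + norm K2) * C) + norm G1 * (\<beta> * (k3 * C) + d * Sb * (k3 * M))) * ?e"
        by (simp add: algebra_simps)
      finally show "norm (f t) \<le> (norm G1 * ((k1 + norm K2) * C) + norm G1 * (\<beta> * (k3 * C) + d * Sb * (k3 * M))) * ?e" .
    qed (use C \<beta> d Sb M k1 k3 \<kappa> in auto)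
  qed
  moreover have "exp_bounded s (\<lambda>t. 2 * (C * exp (- \<kappa> * t)))"
    by (rule exp_boundedI[of "2 * C" \<kappa>]) (use C \<kappa> in auto)
  ultimately have "exp_bounded s (\<lambda>t. norm (X t - Xh t) + 2 * (C * exp (- \<kappa> * t)))" by (rule exp_bounded_add)
  then show ?thesis
  proof (rule exp_bounded_mono)
    show "Ynorm (X t - Xh t) (\<lambda>\<xi>. z t \<xi> - zh t \<xi>) \<le> norm (X t - Xh t) + 2 * (C * exp (- \<kappa> * t))" if "t \<ge> 0" for t
      using Ynorm_le[OF yw[OF that] y0[OF that] yb[OF that]] by (simp add: y_def)
  qed
qed

theorem theorem3p3:
  fixes A1 :: "real^'nx^'nx" and A2 :: "real^'nx^'nz"
    and G1 :: "real^'nz^'nx" and G2 :: "real^'nu^'nz"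
    and lam theta :: "real^'nz"
    and Sig :: "real^'nz \<Rightarrow> real^'nz^'nz"
    and h1 h2 :: "real^'nz \<Rightarrow> real^'nz"
    and U :: "real \<Rightarrow> real^'nu"
    and K1 K3 :: "real \<Rightarrow> real^'nz^'nz" and K2 :: "real^'nz^'nz"
    and X Xh :: "real \<Rightarrow> real^'nx"
    and z zh :: "real \<Rightarrow> real \<Rightarrow> real^'nz"
    and L1 :: "real^'nz^'nx"
    and rho psi :: real and Gam :: "real^'nz^'nz"
    and Y1 Y2 :: "real \<Rightarrow> real^'nz"
    and zeta1 zeta2 :: "real \<Rightarrow> real"
    and varphi thh Q :: "real \<Rightarrow> real^'nz"
    and R :: "real \<Rightarrow> real^'nz^'nz"
  assumes lam_pos: "\<forall>i. lam $ i > 0"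
    and theta_pos: "\<forall>i. theta $ i > 0"
    and Sig_C1: "C1_map Sig" and h1_C1: "C1_map h1" and h2_C1: "C1_map h2"
    and h2_inv: "bij h2"
    and U_C1: "C1_halfline U"
    and K1_cont: "continuous_on {0..1} K1" and K3_cont: "continuous_on {0..1} K3"
    \<comment> \<open>(A1): boundedness of the classical solution in Y and of the input\<close>
    and A1_sol: "\<exists>M. \<forall>t\<ge>0. Ynorm (X t) (z t) \<le> M"
    and A1_U: "\<exists>M. \<forall>t\<ge>0. norm (U t) \<le> M"
    \<comment> \<open>(A2)\<close>
    and A2_det: "detectable A1 A2"
    \<comment> \<open>(X,z) is a classical solution of the ODE-PDE system\<close>
    and sol_reg: "classical_reg X z"
    and sol_ode: "\<forall>t>0. (X has_vector_derivative
        (A1 *v X t + G1 *v Kop1 K1 K2 (z t)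
         + G1 *v ((diagm theta ** Sig (A2 *v X t + G2 *v U t)) *v Kop2 K3 (z t))
         + G1 *v h1 (A2 *v X t + G2 *v U t))) (at t)"
    and sol_pde: "\<forall>t>0. transport_eq z lam
        (\<lambda>\<xi> \<zeta>. (diagm theta ** Sig (A2 *v X t + G2 *v U t)) *v \<zeta> + h2 (A2 *v X t + G2 *v U t)) t"
    \<comment> \<open>measurements\<close>
    and Y1_def: "\<forall>t\<ge>0. Y1 t = h2 (A2 *v X t + G2 *v U t)"
    and Y2_def: "\<forall>t\<ge>0. Y2 t = (diagm theta ** diagm lam ** Sig (inv h2 (Y1 t)) ** matrix_inv (diagm lam)) *v Y1 t
                              + vector_derivative Y1 (at t within {0..})"
    \<comment> \<open>adaptive law\<close>
    and rho_pos: "rho > 0" and psi_pos: "psi > 0" and Gam_spd: "sym_pos_def Gam"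
    and filt1: "\<forall>t\<ge>0. (zeta1 has_real_derivative (- rho * (zeta1 t - (\<Sum>i\<in>UNIV. Y1 t $ i)))) (at t within {0..})"
    and filt2: "\<forall>t\<ge>0. (zeta2 has_real_derivative (- rho * zeta2 t + (\<Sum>i\<in>UNIV. Y2 t $ i))) (at t within {0..})"
    and filt3: "\<forall>t\<ge>0. (varphi has_vector_derivative
        (- rho *\<^sub>R varphi t
         - (diagm lam ** Sig (inv h2 (Y1 t)) ** matrix_inv (diagm lam)) *v Y1 t)) (at t within {0..})"
    and law_theta: "\<forall>t\<ge>0. (thh has_vector_derivative (- (Gam *v (R t *v thh t + Q t)))) (at t within {0..})"
    and law_R: "\<forall>t\<ge>0. (R has_vector_derivative
        (- psi *\<^sub>R R t + inverse (1 + (norm (varphi t))\<^sup>2) *\<^sub>R outer (varphi t) (varphi t))) (at t within {0..})"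
    and law_Q: "\<forall>t\<ge>0. (Q has_vector_derivative
        (- psi *\<^sub>R Q t - (((\<Sum>i\<in>UNIV. Y1 t $ i) - (zeta1 t + zeta2 t)) / (1 + (norm (varphi t))\<^sup>2)) *\<^sub>R varphi t))
        (at t within {0..})"
    \<comment> \<open>observer\<close>
    and L1_hurwitz: "hurwitz (A1 + L1 ** A2)"
    and obs_reg: "classical_reg Xh zh"
    and obs_ode: "\<forall>t>0. (Xh has_vector_derivative
        (A1 *v Xh t + G1 *v Kop1 K1 K2 (zh t)
         + G1 *v ((diagm (thh t) ** Sig (inv h2 (Y1 t))) *v Kop2 K3 (zh t))
         + G1 *v h1 (inv h2 (Y1 t))
         - L1 *v (inv h2 (Y1 t) - inv h2 (h2 (A2 *v Xh t + G2 *v U t))))) (at t)"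
    and obs_pde: "\<forall>t>0. transport_eq zh lam
        (\<lambda>\<xi> \<zeta>. (diagm (thh t) ** Sig (inv h2 (Y1 t))) *v \<zeta> + Y1 t) t"
    \<comment> \<open>the observer error is a classical solution\<close>
    and err_reg: "classical_reg (\<lambda>t. X t - Xh t) (\<lambda>t \<xi>. z t \<xi> - zh t \<xi>)"
  shows "(\<forall>t\<ge>0. H1_01 (\<lambda>\<xi>. z t \<xi> - zh t \<xi>))
       \<and> (\<exists>M. \<forall>t\<ge>0. Ynorm (X t - Xh t) (\<lambda>\<xi>. z t \<xi> - zh t \<xi>) \<le> M)
       \<and> (((\<exists>M. \<forall>t\<ge>0. norm (varphi t) \<le> M) \<and> persistently_exciting varphi)
          \<longrightarrow> (\<exists>c \<kappa>. c > 0 \<and> \<kappa> > 0 \<and>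
                 (\<forall>t\<ge>0. Ynorm (X t - Xh t) (\<lambda>\<xi>. z t \<xi> - zh t \<xi>) \<le> c * exp (- \<kappa> * t))))"
proof -
  define v where "v = (\<lambda>t. A2 *v X t + G2 *v U t)"
  define S where "S = (\<lambda>t. Sig (v t))"
  have ih: "inv h2 (h2 x) = x" for x using h2_inv by (simp add: bij_is_inj)
  have Y1: "Y1 t = h2 (v t)" "inv h2 (Y1 t) = v t" if "t \<ge> 0" for t
    using Y1_def that ih by (auto simp: v_def)
  obtain M where M: "\<And>t. t \<ge> 0 \<Longrightarrow> Ynorm (X t) (z t) \<le> M" using A1_sol by blast
  obtain MU where MU: "\<And>t. t \<ge> 0 \<Longrightarrow> norm (U t) \<le> MU" using A1_U by blast
  obtain Sb where Sb: "\<And>t. t \<ge> 0 \<Longrightarrow> norm (S t) \<le> Sb"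
  proof -
    define r where "r = norm A2 * M + norm G2 * MU"
    \<comment> \<open>The argument of \<open>Sig\<close> stays in a compact ball, on which the
      continuous map \<open>Sig\<close> is bounded.\<close>
    have vr: "v t \<in> cball 0 r" if "t \<ge> 0" for t
    proof -
      have "norm (X t) \<le> M" using Ynorm_leD(1)[OF classical_regD(5)[OF sol_reg that] M[OF that]] .
      then have "norm (v t) \<le> r" unfolding v_def r_def using MU[OF that]
        by (intro norm_triangle_mono order_trans[OF norm_matrix_vector_le] mult_left_mono) auto
      then show ?thesis by simp
    qed
    have "continuous_on UNIV Sig"
      using Sig_C1 unfolding C1_map_def by (metis continuous_at_imp_continuous_on has_derivative_continuous)
    then have "bounded (Sig ` cball 0 r)"
      by (intro compact_imp_bounded compact_continuous_image) (auto intro: continuous_on_subset)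
    then obtain B where "\<And>x. x \<in> cball 0 r \<Longrightarrow> norm (Sig x) \<le> B" unfolding bounded_iff by blast
    with vr show thesis by (intro that[of B]) (simp add: S_def)
  qed
  obtain X' U' where X': "\<And>t. t \<ge> 0 \<Longrightarrow> (X has_vector_derivative X' t) (at t within {0..})"
    and U': "\<And>t. t \<ge> 0 \<Longrightarrow> (U has_vector_derivative U' t) (at t within {0..})"
    using sol_reg U_C1 unfolding classical_reg_def C1_halfline_def by blast
  obtain D where D: "\<And>x. (h2 has_derivative blinfun_apply (D x)) (at x)" using h2_C1 unfolding C1_map_def by blast
  define Y' where "Y' = (\<lambda>t. blinfun_apply (D (v t)) (A2 *v X' t + G2 *v U' t))"
  have dY: "(Y1 has_vector_derivative Y' t) (at t within {0..})" if "t \<ge> 0" for t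
  proof -
    have bl: "bounded_linear ((*v) A2)" "bounded_linear ((*v) G2)" by simp_all
    have "(v has_vector_derivative (A2 *v X' t + G2 *v U' t)) (at t within {0..})"
      unfolding v_def
      by (intro has_vector_derivative_add bounded_linear.has_vector_derivative[OF bl(1)]
          bounded_linear.has_vector_derivative[OF bl(2)] X' U' that)
    from vector_derivative_diff_chain_within[OF this has_derivative_at_withinI[OF D]]
    have "(h2 \<circ> v has_vector_derivative Y' t) (at t within {0..})" by (simp add: Y'_def)
    then show ?thesis
      by (rule has_vector_derivative_transform[rotated 2]) (use that Y1 in auto)
  qed
  have vd: "vector_derivative Y1 (at t within {0..}) = Y' t" if "t \<ge> 0" for t
  proof (rule vector_derivative_within[OF _ dY[OF that]])
    \<comment> \<open>The one-sided derivative at 0 is included, so uniqueness of derivatives needs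
      every point of the half-line to be a limit point.\<close>
    have "t islimpt {0..}" using that islimpt_subset[of t "{t..t + 1}" "{0..}"] by (auto simp: islimpt_Icc)
    then show "at t within {0..} \<noteq> bot" by (simp add: trivial_limit_within)
  qed
  \<comment> \<open>The negative of the unfiltered regressor. Its product with
    \<open>diagm theta\<close>, summed over components, is the inner product with
    \<open>theta\<close>, which makes the measurement linear in the unknown parameters.\<close>
  define r where "r = (\<lambda>t. (diagm lam ** S t ** matrix_inv (diagm lam)) *v Y1 t)"
  have Y2: "(\<Sum>i\<in>UNIV. Y2 t $ i) = theta \<bullet> r t + (\<Sum>i\<in>UNIV. Y' t $ i)" if "t \<ge> 0" for t
  proof -
    have "Y2 t = diagm theta *v r t + Y' t"
      using Y2_def that vd[OF that] Y1(2)[OF that]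
      by (simp add: r_def S_def matrix_vector_mul_assoc[symmetric])
    then show ?thesis by (simp add: sum.distrib inner_vec_def)
  qed
  have dphi: "(varphi has_vector_derivative (- rho *\<^sub>R varphi t - r t)) (at t within {0..})" if "t \<ge> 0" for t
    using filt3[rule_format, OF that] unfolding r_def S_def Y1(2)[OF that] .
  have phi_cont: "continuous_on {0..} varphi"
    unfolding continuous_on_eq_continuous_within using dphi has_vector_derivative_continuous by fastforce
  have reg: "exp_bounded True (\<lambda>t. \<bar>((\<Sum>i\<in>UNIV. Y1 t $ i) - (zeta1 t + zeta2 t)) - varphi t \<bullet> theta\<bar>)"
    by (rule filtered_regression[OF rho_pos dY Y2 _ _ dphi]) (use filt1 filt2 in auto)
  \<comment> \<open>The excitation premise is itself conditional on \<open>s\<close>: it is vacuous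
    for the boundedness claim and available for the decay claim.\<close>
  have main: "exp_bounded s (\<lambda>t. Ynorm (X t - Xh t) (\<lambda>\<xi>. z t \<xi> - zh t \<xi>))"
    if pe: "s \<Longrightarrow> (\<exists>M. \<forall>t\<ge>0. norm (varphi t) \<le> M) \<and> persistently_exciting varphi" for s
  proof (rule observer_error_exp_bounded[where S = S and theta = theta and thh = thh and M = M and Sb = Sb
        and lam = lam and p = "\<lambda>t. G1 *v h1 (v t)" and b = "\<lambda>t. h2 (v t)"])
    show "exp_bounded s (\<lambda>t. norm (theta - thh t))"
      by (rule adaptive_law_exp_bounded[OF psi_pos Gam_spd phi_cont reg _ _ _ pe])
        (use law_theta law_R law_Q in auto)
    show "(X has_vector_derivative
        (A1 *v X t + G1 *v Kop1 K1 K2 (z t) + G1 *v ((diagm theta ** S t) *v Kop2 K3 (z t)) + G1 *v h1 (v t))) (at t)"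
      if "t > 0" for t
      using sol_ode that by (simp add: S_def v_def)
    show "(Xh has_vector_derivative
        (A1 *v Xh t + G1 *v Kop1 K1 K2 (zh t) + G1 *v ((diagm (thh t) ** S t) *v Kop2 K3 (zh t)) + G1 *v h1 (v t)
         - L1 *v (A2 *v (X t - Xh t)))) (at t)" if "t > 0" for t
    proof -
      have "inv h2 (Y1 t) = v t" using Y1(2)[of t] that by simp
      \<comment> \<open>Inverting the output map makes the correction linear in the ODE error, which
        is what produces the matrix \<open>A1 + L1 ** A2\<close>.\<close>
      moreover have "v t - (A2 *v Xh t + G2 *v U t) = A2 *v (X t - Xh t)"
        by (simp add: v_def matrix_vector_mult_diff_distrib)
      ultimately show ?thesis using obs_ode[rule_format, OF that] by (simp add: S_def ih)
    qed
    show "transport_eq z lam (\<lambda>\<xi> \<zeta>. (diagm theta ** S t) *v \<zeta> + h2 (v t)) t" if "t > 0" for t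
      using sol_pde that by (simp add: S_def v_def)
    show "transport_eq zh lam (\<lambda>\<xi> \<zeta>. (diagm (thh t) ** S t) *v \<zeta> + h2 (v t)) t" if "t > 0" for t
      using obs_pde[rule_format, OF that] that Y1[of t] by (simp add: S_def)
  qed (use lam_pos K1_cont K3_cont L1_hurwitz sol_reg obs_reg M Sb in auto)
  show ?thesis
  proof (intro conjI impI)
    show "\<forall>t\<ge>0. H1_01 (\<lambda>\<xi>. z t \<xi> - zh t \<xi>)" using classical_regD(3)[OF err_reg] by blast
    obtain C where C: "\<And>t. t \<ge> 0 \<Longrightarrow> Ynorm (X t - Xh t) (\<lambda>\<xi>. z t \<xi> - zh t \<xi>) \<le> C"
    proof -
      obtain C \<kappa> where C: "C \<ge> 0" "\<kappa> \<ge> 0" "\<And>t. t \<ge> 0 \<Longrightarrow> Ynorm (X t - Xh t) (\<lambda>\<xi>. z t \<xi> - zh t \<xi>) \<le> C * exp (- \<kappa> * t)"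
        using main[of False] unfolding exp_bounded_def by blast
      have "C * exp (- \<kappa> * t) \<le> C * 1" if "t \<ge> 0" for t using C that by (intro mult_left_mono) auto
      with C(3) show thesis by (intro that[of C]) (metis mult.right_neutral order_trans)
    qed
    then show "\<exists>M. \<forall>t\<ge>0. Ynorm (X t - Xh t) (\<lambda>\<xi>. z t \<xi> - zh t \<xi>) \<le> M" by blast
    assume "(\<exists>M. \<forall>t\<ge>0. norm (varphi t) \<le> M) \<and> persistently_exciting varphi"
    with main[of True] obtain C \<kappa> where C: "C \<ge> 0" "\<kappa> > 0"
      "\<And>t. t \<ge> 0 \<Longrightarrow> Ynorm (X t - Xh t) (\<lambda>\<xi>. z t \<xi> - zh t \<xi>) \<le> C * exp (- \<kappa> * t)"
      unfolding exp_bounded_def by blast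
    \<comment> \<open>The constant \<open>C\<close> may be zero, while the claim asks for a strictly
      positive one.\<close>
    have "C * exp (- \<kappa> * t) \<le> (C + 1) * exp (- \<kappa> * t)" for t by (intro mult_right_mono) auto
    with C have "C + 1 > 0 \<and> \<kappa> > 0 \<and>
       (\<forall>t\<ge>0. Ynorm (X t - Xh t) (\<lambda>\<xi>. z t \<xi> - zh t \<xi>) \<le> (C + 1) * exp (- \<kappa> * t))"
      by (meson add_nonneg_pos order_trans zero_less_one)
    then show "\<exists>c \<kappa>. c > 0 \<and> \<kappa> > 0 \<and>
       (\<forall>t\<ge>0. Ynorm (X t - Xh t) (\<lambda>\<xi>. z t \<xi> - zh t \<xi>) \<le> c * exp (- \<kappa> * t))"
      by blast
  qed
qed

end
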